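(* Let $0<r<1$ and let $T$ be an invertible bounded linear operator on a Hilbert space $H$. The following statements are equivalent. (i) $\alpha(T^*,T)\ge 0$. (ii) $T$ is unitarily equivalent to a part of an operator of the form $$(M_z^t \text{ on } H^2_r(\mathbb{B},E))\oplus S,$$ where $E$ is a Hilbert space and $S$ is a subnormal operator whose minimal normal extension has spectrum contained in the union of the circles $\{|z|=r\}$ and $\{|z|=1\}$. If (i) holds, one can take $E=\mathfrak{D}$ in (ii).
   Context: Notation: $\alpha(T^*,T):=-T^{*2}T^2+(1+r^2)T^*T-r^2I$. When $\alpha(T^*,T)\ge0$, $D:=\alpha(T^*,T)^{1/2}$ is its non-negative square root (the defect operator) and $\mathfrak{D}$ is the closure of the range of $D$ (the defect space). A part of an operator is its restriction to a closed invariant subspace. $\mathbb{B}$ is the complement of the closed annulus $\{r\le|z|\le1\}$. For a Hilbert space $E$, $H^2_r(\mathbb{B},E)$ is the Hilbert space of all functions $f:\mathbb{B}\to E$ representable as $f(z)=\sum_{n=0}^\infty f_nz^n$ for $|z|<r$ and $f(z)=\sum_{n=-\infty}^{-1}f_nz^n$ for $|z|>1$, where $\{f_n\}_{n\in\mathbb{Z}}$ is a sequence in $E$, with finite norm $$\|f\|^2_{H^2_r(\mathbb{B},E)}:=\frac1{1-r^2}\sum_{n=0}^\infty r^{2n}\|f_n\|^2+\frac1{1-r^2}\sum_{n=-\infty}^{-1}\|f_n\|^2 .$$ The operator $M_z^t$ acts by $M_z^tf(z)=zf(z)-\big(zf(z)\big)|_{z=\infty}$, where $\big(zf(z)\big)|_{z=\infty}=\lim_{z\to\infty}zf(z)=f_{-1}$.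 *)

theory Defs
  imports "HOL-Analysis.Analysis" "HOL-Library.Function_Algebras"
begin

section \<open>Complex vector spaces and complex Hilbert spaces\<close>

class scaleC =
  fixes scaleC :: "complex \<Rightarrow> 'a \<Rightarrow> 'a"  (infixr "*\<^sub>C" 75)

class complex_vector = ab_group_add + scaleC +
  assumes scaleC_add_right: "a *\<^sub>C (x + y) = a *\<^sub>C x + a *\<^sub>C y"
    and scaleC_add_left: "(a + b) *\<^sub>C x = a *\<^sub>C x + b *\<^sub>C x"
    and scaleC_scaleC: "a *\<^sub>C (b *\<^sub>C x) = (a * b) *\<^sub>C x"
    and scaleC_one: "1 *\<^sub>C x = x"

global_interpretation complex_vector: vector_space "scaleC :: complex \<Rightarrow> 'a \<Rightarrow> 'a::complex_vector"
  by unfold_locales (simp_all add: scaleC_add_right scaleC_add_left scaleC_scaleC scaleC_one)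

text \<open>
  The complex structure is laid over the library's classes for real inner product spaces, with
  real inner product \<open>x \<bullet> y = Re (cinner x y)\<close>; hence norm, metric, completeness and convergence
  are the library's ones, and \<open>(norm x)\<^sup>2 = cinner x x\<close>. The form \<open>cinner\<close> is linear in the first and
  conjugate-linear in the second argument.
\<close>

class chilbert_space = complex_vector + real_inner + complete_space +
  fixes cinner :: "'a \<Rightarrow> 'a \<Rightarrow> complex"
  assumes scaleR_scaleC: "t *\<^sub>R x = complex_of_real t *\<^sub>C x"
    and cinner_commute: "cinner x y = cnj (cinner y x)"
    and cinner_add_left: "cinner (x + y) z = cinner x z + cinner y z"
    and cinner_scaleC_left: "cinner (a *\<^sub>C x) y = a * cinner x y"
    and inner_eq_Re_cinner: "x \<bullet> y = Re (cinner x y)"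

instantiation complex :: chilbert_space
begin
definition scaleC_complex :: "complex \<Rightarrow> complex \<Rightarrow> complex"
  where "scaleC_complex a x = a * x"
definition cinner_complex :: "complex \<Rightarrow> complex \<Rightarrow> complex"
  where "cinner_complex x y = x * cnj y"
instance
  by standard
    (auto simp: scaleC_complex_def cinner_complex_def algebra_simps scaleR_conv_of_real
       inner_complex_def)
end

instantiation prod :: (scaleC, scaleC) scaleC
begin
definition scaleC_prod :: "complex \<Rightarrow> 'a \<times> 'b \<Rightarrow> 'a \<times> 'b"
  where "scaleC_prod a p = (a *\<^sub>C fst p, a *\<^sub>C snd p)"
instance ..
end

instance prod :: (complex_vector, complex_vector) complex_vector
  by standard
    (auto simp: scaleC_prod_def prod_eq_iff scaleC_add_right scaleC_add_left scaleC_scaleC scaleC_one)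

instantiation prod :: (chilbert_space, chilbert_space) chilbert_space
begin
definition cinner_prod :: "'a \<times> 'b \<Rightarrow> 'a \<times> 'b \<Rightarrow> complex"
  where "cinner_prod p q = cinner (fst p) (fst q) + cinner (snd p) (snd q)"
instance
proof
  show "cinner p q = cnj (cinner q p)" for p q :: "'a \<times> 'b"
    unfolding cinner_prod_def by (simp flip: cinner_commute)
qed (auto simp: cinner_prod_def scaleC_prod_def prod_eq_iff scaleR_scaleC cinner_add_left
       cinner_scaleC_left inner_eq_Re_cinner inner_prod_def algebra_simps)
end

instantiation "fun" :: (type, scaleC) scaleC
begin
definition scaleC_fun :: "complex \<Rightarrow> ('a \<Rightarrow> 'b) \<Rightarrow> 'a \<Rightarrow> 'b"
  where "scaleC_fun a f = (\<lambda>x. a *\<^sub>C f x)"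
instance ..
end

instance "fun" :: (type, complex_vector) complex_vector
  by standard
    (auto simp: scaleC_fun_def fun_eq_iff scaleC_add_right scaleC_add_left scaleC_scaleC scaleC_one)

definition closed_csubspace :: "'a::chilbert_space set \<Rightarrow> bool" where
  "closed_csubspace X \<longleftrightarrow> complex_vector.subspace X \<and> closed X"


section \<open>Bounded operators on a closed subspace\<close>

text \<open>
  A Hilbert space is either a whole type of class \<open>chilbert_space\<close> (then \<open>X = UNIV\<close> below) or a
  closed complex subspace \<open>X\<close> of such a type. An operator on \<open>X\<close> is a function on the ambient type
  of which only the values on \<open>X\<close> matter.
\<close>

definition clinear_on :: "'a::complex_vector set \<Rightarrow> ('a \<Rightarrow> 'b::complex_vector) \<Rightarrow> bool" where
  "clinear_on X f \<longleftrightarrow>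
     (\<forall>x\<in>X. \<forall>y\<in>X. f (x + y) = f x + f y) \<and> (\<forall>c. \<forall>x\<in>X. f (c *\<^sub>C x) = c *\<^sub>C f x)"

definition bounded_op_on :: "'a::chilbert_space set \<Rightarrow> ('a \<Rightarrow> 'a) \<Rightarrow> bool" where
  "bounded_op_on X A \<longleftrightarrow>
     A ` X \<subseteq> X \<and> clinear_on X A \<and> (\<exists>B. \<forall>x\<in>X. norm (A x) \<le> B * norm x)"

definition invertible_op_on :: "'a::chilbert_space set \<Rightarrow> ('a \<Rightarrow> 'a) \<Rightarrow> bool" where
  "invertible_op_on X A \<longleftrightarrow>
     bounded_op_on X A \<and> (\<exists>B. bounded_op_on X B \<and> (\<forall>x\<in>X. A (B x) = x \<and> B (A x) = x))"

definition spectrum_on :: "'a::chilbert_space set \<Rightarrow> ('a \<Rightarrow> 'a) \<Rightarrow> complex set" where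
  "spectrum_on X A = {l. \<not> invertible_op_on X (\<lambda>x. A x - l *\<^sub>C x)}"

definition adjoint_on :: "'a::chilbert_space set \<Rightarrow> ('a \<Rightarrow> 'a) \<Rightarrow> 'a \<Rightarrow> 'a" where
  "adjoint_on X A y = (THE w. w \<in> X \<and> (\<forall>x\<in>X. cinner (A x) y = cinner x w))"

definition positive_op :: "('a::chilbert_space \<Rightarrow> 'a) \<Rightarrow> bool" where
  "positive_op A \<longleftrightarrow> bounded_op_on UNIV A \<and> (\<forall>x. cinner (A x) x \<in> \<real>\<^sub>\<ge>\<^sub>0)"

definition sqrt_op :: "('a::chilbert_space \<Rightarrow> 'a) \<Rightarrow> 'a \<Rightarrow> 'a" where
  "sqrt_op A = (THE B. positive_op B \<and> B \<circ> B = A)"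

definition normal_on :: "'a::chilbert_space set \<Rightarrow> ('a \<Rightarrow> 'a) \<Rightarrow> bool" where
  "normal_on X N \<longleftrightarrow> bounded_op_on X N \<and>
     (\<forall>x\<in>X. adjoint_on X N (N x) = N (adjoint_on X N x))"

definition reducing_for :: "'a::chilbert_space set \<Rightarrow> ('a \<Rightarrow> 'a) \<Rightarrow> 'a set \<Rightarrow> bool" where
  "reducing_for X N M \<longleftrightarrow>
     closed_csubspace M \<and> M \<subseteq> X \<and> N ` M \<subseteq> M \<and> adjoint_on X N ` M \<subseteq> M"

text \<open>
  \<open>S\<close> on \<open>K\<close> is subnormal iff it has a normal extension \<open>N\<close> on some Hilbert space \<open>L \<supseteq> K\<close>. The pair
  \<open>(N, L)\<close> is an explicit argument below, so that subnormality is not tied to the room which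
  \<open>K\<close> happens to leave in its ambient type.
\<close>

definition normal_extension ::
    "'a::chilbert_space set \<Rightarrow> ('a \<Rightarrow> 'a) \<Rightarrow> 'a set \<Rightarrow> ('a \<Rightarrow> 'a) \<Rightarrow> bool" where
  "normal_extension K S L N \<longleftrightarrow>
     closed_csubspace K \<and> bounded_op_on K S \<and>
     closed_csubspace L \<and> normal_on L N \<and> K \<subseteq> L \<and> (\<forall>x\<in>K. N x = S x)"

definition minimal_normal_extension ::
    "'a::chilbert_space set \<Rightarrow> ('a \<Rightarrow> 'a) \<Rightarrow> 'a set \<Rightarrow> ('a \<Rightarrow> 'a) \<Rightarrow> bool" where
  "minimal_normal_extension K S L N \<longleftrightarrow>
     normal_extension K S L N \<and> (\<forall>M. reducing_for L N M \<and> K \<subseteq> M \<longrightarrow> M = L)"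


section \<open>The operator \<open>\<alpha>(T\<^sup>*, T)\<close> and the defect space\<close>

definition alpha_op :: "real \<Rightarrow> ('a::chilbert_space \<Rightarrow> 'a) \<Rightarrow> 'a \<Rightarrow> 'a" where
  "alpha_op r T x =
     (let Ts = adjoint_on UNIV T
      in - Ts (Ts (T (T x))) + (1 + r\<^sup>2) *\<^sub>R Ts (T x) - r\<^sup>2 *\<^sub>R x)"

definition defect_op :: "real \<Rightarrow> ('a::chilbert_space \<Rightarrow> 'a) \<Rightarrow> 'a \<Rightarrow> 'a" where
  "defect_op r T = sqrt_op (alpha_op r T)"

definition defect_space :: "real \<Rightarrow> ('a::chilbert_space \<Rightarrow> 'a) \<Rightarrow> 'a set" where
  "defect_space r T = closure (range (defect_op r T))"


section \<open>The space \<open>H\<^sup>2\<^sub>r(\<bbbB>, E)\<close> and the operator \<open>M\<^sub>z\<^sup>t\<close>\<close>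

definition annulus_compl :: "real \<Rightarrow> complex set" where
  "annulus_compl r = - {z. r \<le> cmod z \<and> cmod z \<le> 1}"

text \<open>
  Functions on \<open>annulus_compl r\<close> are modelled by total functions vanishing elsewhere. The value at
  the point at infinity is not recorded: the expansion in negative powers forces it to be 0.
\<close>

definition laurent_rep :: "real \<Rightarrow> (complex \<Rightarrow> 'e::chilbert_space) \<Rightarrow> (int \<Rightarrow> 'e) \<Rightarrow> bool" where
  "laurent_rep r f c \<longleftrightarrow>
     (\<forall>z. cmod z < r \<longrightarrow> ((\<lambda>n. (z powi n) *\<^sub>C c n) has_sum f z) {0..}) \<and>
     (\<forall>z. 1 < cmod z \<longrightarrow> ((\<lambda>n. (z powi n) *\<^sub>C c n) has_sum f z) {..-1}) \<and>
     (\<forall>z. z \<notin> annulus_compl r \<longrightarrow> f z = 0)"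

definition H2r :: "real \<Rightarrow> 'e::chilbert_space set \<Rightarrow> (complex \<Rightarrow> 'e) set" where
  "H2r r E = {f. \<exists>c. range c \<subseteq> E \<and> laurent_rep r f c \<and>
     (\<lambda>n. r powi (2 * n) * (norm (c n))\<^sup>2) summable_on {0..} \<and>
     (\<lambda>n. (norm (c n))\<^sup>2) summable_on {..-1}}"

text \<open>For \<open>r > 0\<close> the coefficients are determined by \<open>f\<close>.\<close>

definition laurent_coeff :: "real \<Rightarrow> (complex \<Rightarrow> 'e::chilbert_space) \<Rightarrow> int \<Rightarrow> 'e" where
  "laurent_coeff r f = (THE c. laurent_rep r f c)"

definition H2r_norm :: "real \<Rightarrow> (complex \<Rightarrow> 'e::chilbert_space) \<Rightarrow> real" where
  "H2r_norm r f = sqrt (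
      1 / (1 - r\<^sup>2) * (\<Sum>\<^sub>\<infinity>n\<in>{0..}. r powi (2 * n) * (norm (laurent_coeff r f n))\<^sup>2)
    + 1 / (1 - r\<^sup>2) * (\<Sum>\<^sub>\<infinity>n\<in>{..-1}. (norm (laurent_coeff r f n))\<^sup>2))"

definition Mzt :: "real \<Rightarrow> (complex \<Rightarrow> 'e::chilbert_space) \<Rightarrow> complex \<Rightarrow> 'e" where
  "Mzt r f z = (if z \<in> annulus_compl r
     then z *\<^sub>C f z - Lim at_infinity (\<lambda>w. w *\<^sub>C f w) else 0)"


section \<open>Direct sums, parts and unitary equivalence\<close>

text \<open>
  \<open>H2r r E\<close> and its direct sums are Hilbert spaces given by a carrier set and a norm on it that is
  unrelated to any type class norm; closedness and unitarity refer to this norm. A unitary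
  is a surjective linear isometry.
\<close>

definition H2r_sum_norm :: "real \<Rightarrow> (complex \<Rightarrow> 'e::chilbert_space) \<times> 's::chilbert_space \<Rightarrow> real" where
  "H2r_sum_norm r p = sqrt ((H2r_norm r (fst p))\<^sup>2 + (norm (snd p))\<^sup>2)"

definition closed_in_norm :: "('v::complex_vector \<Rightarrow> real) \<Rightarrow> 'v set \<Rightarrow> 'v set \<Rightarrow> bool" where
  "closed_in_norm nrm X M \<longleftrightarrow>
     (\<forall>s. \<forall>x\<in>X. (\<forall>n::nat. s n \<in> M) \<and> (\<lambda>n. nrm (s n - x)) \<longlonglongrightarrow> 0 \<longrightarrow> x \<in> M)"

definition closed_invariant_subspace ::
    "('v::complex_vector \<Rightarrow> real) \<Rightarrow> 'v set \<Rightarrow> ('v \<Rightarrow> 'v) \<Rightarrow> 'v set \<Rightarrow> bool" where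
  "closed_invariant_subspace nrm X A M \<longleftrightarrow>
     M \<subseteq> X \<and> complex_vector.subspace M \<and> closed_in_norm nrm X M \<and> A ` M \<subseteq> M"

definition unitarily_equivalent ::
    "('v::complex_vector \<Rightarrow> real) \<Rightarrow> 'v set \<Rightarrow> ('v \<Rightarrow> 'v) \<Rightarrow>
     ('w::complex_vector \<Rightarrow> real) \<Rightarrow> 'w set \<Rightarrow> ('w \<Rightarrow> 'w) \<Rightarrow> bool" where
  "unitarily_equivalent nrmX X A nrmY Y B \<longleftrightarrow>
     (\<exists>U. clinear_on X U \<and> U ` X = Y \<and> (\<forall>x\<in>X. nrmY (U x) = nrmX x) \<and>
          (\<forall>x\<in>X. U (A x) = B (U x)))"

text \<open>
  \<open>part_of_model r T E TYPE('s)\<close>: \<open>T\<close> is unitarily equivalent to a part of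
  \<open>(M\<^sub>z\<^sup>t on H\<^sup>2\<^sub>r(\<bbbB>, E)) \<oplus> S\<close>, where \<open>S\<close> on \<open>K\<close> has minimal normal extension \<open>N\<close> on \<open>L\<close>, with
  \<open>K \<subseteq> L\<close> closed subspaces of the Hilbert space \<open>'s\<close>.
\<close>

definition part_of_model ::
    "real \<Rightarrow> ('a::chilbert_space \<Rightarrow> 'a) \<Rightarrow> 'e::chilbert_space set \<Rightarrow> 's::chilbert_space itself \<Rightarrow> bool"
  where
  "part_of_model r T E (_ :: 's itself) \<longleftrightarrow>
     closed_csubspace E \<and>
     (\<exists>(K :: 's set) S L N M.
        minimal_normal_extension K S L N \<and>
        spectrum_on L N \<subseteq> {z. cmod z = r} \<union> {z. cmod z = 1} \<and>
        closed_invariant_subspace (H2r_sum_norm r) (H2r r E \<times> K) (map_prod (Mzt r) S) M \<and>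
        unitarily_equivalent norm UNIV T (H2r_sum_norm r) M (map_prod (Mzt r) S))"

text \<open>
  HOL cannot quantify over types inside a formula, so the ambient spaces of \<open>E\<close> and of
  \<open>S\<close> are parameters.
\<close>

definition has_model ::
    "real \<Rightarrow> ('a::chilbert_space \<Rightarrow> 'a) \<Rightarrow> 'e::chilbert_space itself \<Rightarrow> 's::chilbert_space itself \<Rightarrow> bool"
  where
  "has_model r T (_ :: 'e itself) (s :: 's itself) \<longleftrightarrow>
     (\<exists>E :: 'e set. part_of_model r T E s)"

end

theory Submission
  imports Defs "HOL-Complex_Analysis.Complex_Analysis"
begin

text \<open>
  For a vector \<open>x\<close> put \<open>a\<^sub>n = \<parallel>T\<^sup>n x\<parallel>\<^sup>2\<close>, where \<open>n\<close> ranges over all integers since \<open>T\<close> is invertible. The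
  quadratic form of \<open>\<alpha>(T\<^sup>*, T)\<close> along the orbit of \<open>x\<close> is
  \<open>- a\<^sub>n\<^sub>+\<^sub>2 + (1 + r\<^sup>2) a\<^sub>n\<^sub>+\<^sub>1 - r\<^sup>2 a\<^sub>n\<close>, a second order recurrence with the characteristic roots \<open>1\<close> and
  \<open>r\<^sup>2\<close>. The operators \<open>M\<^sub>z\<^sup>t\<close> and \<open>S\<close> of the model stand for its particular and its homogeneous solutions.

  Let \<open>\<alpha>(T\<^sup>*, T) \<ge> 0\<close>, so that the recurrence equals \<open>\<parallel>D T\<^sup>n x\<parallel>\<^sup>2\<close>. Then \<open>a\<^sub>n\<^sub>+\<^sub>1 - r\<^sup>2 a\<^sub>n\<close> and
  \<open>r\<^sup>-\<^sup>2\<^sup>n (a\<^sub>n\<^sub>+\<^sub>1 - a\<^sub>n)\<close> decrease in \<open>n\<close>. As the \<open>a\<^sub>n\<close> are non-negative, this forces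
  \<open>r \<parallel>x\<parallel> \<le> \<parallel>T x\<parallel> \<le> \<parallel>x\<parallel>\<close> (\<open>alpha_nonneg_bounds\<close>), and summing both monotone quantities over the orbit
  gives

    \<open>(1 - r\<^sup>2) \<parallel>x\<parallel>\<^sup>2 = (\<Sum>n\<ge>0. \<parallel>D T\<^sup>n x\<parallel>\<^sup>2) + (\<Sum>n\<ge>0. r\<^sup>2\<^sup>n \<parallel>D T\<^sup>-\<^sup>n\<^sup>-\<^sup>1 x\<parallel>\<^sup>2)
      + (1 - r\<^sup>2) (lim \<parallel>T\<^sup>n x\<parallel>\<^sup>2 + lim r\<^sup>2\<^sup>n \<parallel>T\<^sup>-\<^sup>n x\<parallel>\<^sup>2)\<close>.

  Up to the factor \<open>1 - r\<^sup>2\<close>, the two sums form the square norm of a function in \<open>H\<^sup>2\<^sub>r(\<bbbB>, \<DD>)\<close> on which \<open>T\<close>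
  acts as \<open>M\<^sub>z\<^sup>t\<close>. The two limits are \<open>\<parallel>Q\<^sub>1 x\<parallel>\<^sup>2\<close> and \<open>\<parallel>Q\<^sub>2 x\<parallel>\<^sup>2\<close> for bounded operators \<open>Q\<^sub>1\<close>, \<open>Q\<^sub>2\<close> on \<open>H\<close>
  (\<open>decreasing_limit_operator\<close>). On the closures of their ranges \<open>T\<close> induces a unitary operator and \<open>r\<close>
  times a unitary operator (\<open>scaled_unitary_from_intertwiner\<close>). So \<open>S\<close> is even normal, and it lives on a
  subspace of \<open>H \<times> H\<close>. The isometry thus obtained is \<open>positive_imp_part_of_model\<close>.

  Conversely, the quadratic form only depends on norms along orbits, so it may be computed in the model
  (\<open>part_of_model_imp_positive\<close>). On \<open>H\<^sup>2\<^sub>r\<close> it is \<open>\<parallel>f\<^sub>-\<^sub>1\<parallel>\<^sup>2\<close> (\<open>Mzt_alpha_form\<close>). For \<open>S\<close> it is a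
  restriction of the form \<open>\<langle>(1 - P) (P - r\<^sup>2) x, x\<rangle>\<close> with \<open>P = N\<^sup>* N\<close> for the normal extension \<open>N\<close>, and
  \<open>r\<^sup>2 \<le> P \<le> 1\<close> since the norm of a normal operator and of its inverse is the spectral radius
  (\<open>normal_spectrum_bounds\<close>).

  Adjoints come from the Riesz representation (\<open>sesquilinear_form_representation\<close>), and the square root
  \<open>D\<close> is the limit of an iteration that converges in norm (\<open>symmetric_sqrt_exists\<close>).
\<close>

section \<open>The complex inner product\<close>

instance chilbert_space \<subseteq> banach ..

lemma cinner_add_right: "cinner x (y + z) = cinner x y + cinner x (z::'a::chilbert_space)"
  by (metis cinner_add_left cinner_commute complex_cnj_add)

lemma cinner_scaleC_right: "cinner x (a *\<^sub>C y) = cnj a * cinner x (y::'a::chilbert_space)"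
  by (metis cinner_commute cinner_scaleC_left complex_cnj_mult)

lemma cinner_scaleR_left: "cinner (t *\<^sub>R x) y = of_real t * cinner x (y::'a::chilbert_space)"
  by (simp add: scaleR_scaleC cinner_scaleC_left)

lemma cinner_scaleR_right: "cinner x (t *\<^sub>R y) = of_real t * cinner x (y::'a::chilbert_space)"
  by (simp add: scaleR_scaleC cinner_scaleC_right)

lemma cinner_minus_left: "cinner (- x) y = - cinner x (y::'a::chilbert_space)"
  using cinner_scaleR_left[of "-1" x y] by simp

lemma cinner_minus_right: "cinner x (- y) = - cinner x (y::'a::chilbert_space)"
  using cinner_scaleR_right[of x "-1" y] by simp

lemma cinner_diff_left: "cinner (x - y) z = cinner x z - cinner y (z::'a::chilbert_space)"
  using cinner_add_left[of x "- y" z] by (simp add: cinner_minus_left)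

lemma cinner_diff_right: "cinner x (y - z) = cinner x y - cinner x (z::'a::chilbert_space)"
  using cinner_add_right[of x y "- z"] by (simp add: cinner_minus_right)

lemmas cinner_linear = cinner_add_left cinner_add_right cinner_scaleC_left cinner_scaleC_right
  cinner_scaleR_left cinner_scaleR_right cinner_minus_left cinner_minus_right
  cinner_diff_left cinner_diff_right

lemma scaleC_minus_right: "a *\<^sub>C (- x) = - (a *\<^sub>C (x::'a::complex_vector))"
  by (rule complex_vector.scale_minus_right)

lemma scaleC_diff_right: "a *\<^sub>C (x - y) = a *\<^sub>C x - a *\<^sub>C (y::'a::complex_vector)"
  by (rule complex_vector.scale_right_diff_distrib)

lemma cinner_zero_left [simp]: "cinner 0 (y::'a::chilbert_space) = 0"
  using cinner_scaleR_left[of 0 0 y] by simp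

lemma cinner_zero_right [simp]: "cinner (y::'a::chilbert_space) 0 = 0"
  using cinner_scaleR_right[of y 0 0] by simp

lemma cinner_eq_Complex_inner:
  "cinner x y = Complex (x \<bullet> y) (x \<bullet> (\<i> *\<^sub>C (y::'a::chilbert_space)))"
  by (rule complex_eqI) (simp_all add: inner_eq_Re_cinner cinner_scaleC_right)

lemma cinner_self: "cinner x x = of_real ((norm (x::'a::chilbert_space))\<^sup>2)"
proof (rule complex_eqI)
  have "Im (cinner x x) = - Im (cinner x x)"
    by (metis cinner_commute cnj.simps(2))
  then show "Im (cinner x x) = Im (of_real ((norm x)\<^sup>2))" by simp
qed (simp add: power2_norm_eq_inner flip: inner_eq_Re_cinner)

lemma norm_scaleC: "norm (a *\<^sub>C x) = cmod a * norm (x::'a::chilbert_space)"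
proof -
  have "complex_of_real ((norm (a *\<^sub>C x))\<^sup>2) = of_real ((cmod a * norm x)\<^sup>2)"
    unfolding cinner_self[symmetric] cinner_scaleC_left cinner_scaleC_right
    by (simp add: cinner_self power_mult_distrib complex_norm_square mult_ac del: of_real_power)
  then have "(norm (a *\<^sub>C x))\<^sup>2 = (cmod a * norm x)\<^sup>2"
    using of_real_eq_iff by blast
  then show ?thesis by (simp add: power2_eq_iff_nonneg)
qed

lemma cmod_cinner_le: "cmod (cinner x y) \<le> norm x * norm (y::'a::chilbert_space)"
proof -
  define u where "u = cnj (sgn (cinner x y))"
  have u: "cmod u \<le> 1" by (simp add: u_def norm_sgn)
  have "u * cinner x y = of_real (cmod (cinner x y))"
    by (cases "cinner x y = 0")
      (simp_all add: u_def sgn_eq complex_norm_square[symmetric] mult.commute power2_eq_square)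
  then have "cmod (cinner x y) = Re (u * cinner x y)" by simp
  also have "\<dots> = (u *\<^sub>C x) \<bullet> y" by (simp add: inner_eq_Re_cinner cinner_scaleC_left)
  also have "\<dots> \<le> norm (u *\<^sub>C x) * norm y" by (rule norm_cauchy_schwarz)
  also have "\<dots> \<le> norm x * norm y"
    using u by (intro mult_right_mono) (simp_all add: norm_scaleC mult_left_le_one_le)
  finally show ?thesis .
qed

lemma bounded_linear_scaleC: "bounded_linear ((*\<^sub>C) a :: 'a::chilbert_space \<Rightarrow> 'a)"
proof (rule bounded_linear_intro[where K = "cmod a"])
  show "a *\<^sub>C (t *\<^sub>R x) = t *\<^sub>R (a *\<^sub>C x)" for t and x :: 'a
    by (simp add: scaleR_scaleC scaleC_scaleC mult.commute)
qed (simp_all add: scaleC_add_right norm_scaleC mult.commute)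

lemma bounded_bilinear_scaleC: "bounded_bilinear ((*\<^sub>C) :: complex \<Rightarrow> 'a::chilbert_space \<Rightarrow> 'a)"
proof
  show "\<exists>K. \<forall>a (b::'a). norm (a *\<^sub>C b) \<le> norm a * norm b * K"
    by (rule exI[of _ 1]) (simp add: norm_scaleC)
qed (simp_all add: scaleC_add_left scaleC_add_right scaleR_scaleC scaleC_scaleC scaleC_complex_def
    mult.commute)

lemma bounded_bilinear_cinner:
  "bounded_bilinear (cinner :: 'a::chilbert_space \<Rightarrow> 'a \<Rightarrow> complex)"
proof
  show "\<exists>K. \<forall>a (b::'a). norm (cinner a b) \<le> norm a * norm b * K"
    by (rule exI[of _ 1]) (simp add: cmod_cinner_le)
qed (simp_all add: cinner_linear scaleR_conv_of_real)

lemmas tendsto_cinner = bounded_bilinear.tendsto[OF bounded_bilinear_cinner]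
lemmas tendsto_scaleC = bounded_bilinear.tendsto[OF bounded_bilinear_scaleC]

lemma csubspaceD:
  assumes "closed_csubspace X"
  shows "0 \<in> X" "x \<in> X \<Longrightarrow> y \<in> X \<Longrightarrow> x + y \<in> X" "x \<in> X \<Longrightarrow> y \<in> X \<Longrightarrow> x - y \<in> X"
    "x \<in> X \<Longrightarrow> a *\<^sub>C x \<in> X" "x \<in> X \<Longrightarrow> t *\<^sub>R x \<in> X" "closed X"
  using assms unfolding closed_csubspace_def scaleR_scaleC
  by (auto simp: complex_vector.subspace_0 complex_vector.subspace_add
      complex_vector.subspace_diff complex_vector.subspace_scale)

lemma closed_csubspace_UNIV [simp]: "closed_csubspace UNIV"
  by (simp add: closed_csubspace_def complex_vector.subspace_UNIV)

lemma eq_if_cinner_eq: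
  fixes v w :: "'a::chilbert_space"
  assumes "closed_csubspace X" "v \<in> X" "w \<in> X" "\<And>x. x \<in> X \<Longrightarrow> cinner x v = cinner x w"
  shows "v = w"
proof -
  have "cinner (v - w) (v - w) = 0"
    using assms(4)[of "v - w"] csubspaceD(3)[OF assms(1-3)] by (simp add: cinner_diff_right)
  then show ?thesis by (simp add: cinner_self)
qed

section \<open>Riesz representation and adjoints\<close>

text \<open>
  The representing vector minimises \<open>\<parallel>x\<parallel>\<^sup>2 - 2 Re (f x)\<close> over \<open>X\<close>: a minimum exists because minimising
  sequences are Cauchy, and the derivative of the functional vanishes there.
\<close>

lemma riesz_representation_on:
  fixes f :: "'a::chilbert_space \<Rightarrow> complex"
  assumes X: "closed_csubspace X"
    and add: "\<And>x y. x \<in> X \<Longrightarrow> y \<in> X \<Longrightarrow> f (x + y) = f x + f y"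
    and scale: "\<And>a x. x \<in> X \<Longrightarrow> f (a *\<^sub>C x) = a * f x"
    and bound: "\<And>x. x \<in> X \<Longrightarrow> cmod (f x) \<le> B * norm x"
  shows "\<exists>w\<in>X. \<forall>x\<in>X. f x = cinner x w"
proof -
  note XD = csubspaceD[OF X]
  define \<phi> where "\<phi> x = (norm x)\<^sup>2 - 2 * Re (f x)" for x
  have scaleR: "f (t *\<^sub>R x) = of_real t * f x" if "x \<in> X" for t x
    using that by (simp add: scaleR_scaleC scale)
  have lower: "- B\<^sup>2 \<le> \<phi> x" if "x \<in> X" for x
  proof -
    have "0 \<le> (norm x - B)\<^sup>2" by simp
    moreover have "Re (f x) \<le> B * norm x"
      using bound[OF that] complex_Re_le_cmod[of "f x"] by linarith
    ultimately show ?thesis by (simp add: \<phi>_def power2_diff mult.commute)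
  qed
  define d where "d = Inf (\<phi> ` X)"
  have bdd: "bdd_below (\<phi> ` X)" using lower by (intro bdd_belowI) auto
  have d: "d \<le> \<phi> x" if "x \<in> X" for x
    unfolding d_def using bdd that by (intro cInf_lower) auto
  have "\<exists>x\<in>X. \<phi> x < d + 1 / Suc n" for n
    using cInf_lessD[of "\<phi> ` X" "d + 1 / Suc n"] XD(1) by (auto simp: d_def)
  then obtain s where s: "\<And>n. s n \<in> X" "\<And>n. \<phi> (s n) < d + 1 / Suc n" by metis
  \<comment> \<open>The parallelogram law turns almost minimality into the Cauchy property.\<close>
  have mid: "(norm (x - y))\<^sup>2 \<le> 2 * (\<phi> x - d) + 2 * (\<phi> y - d)" if "x \<in> X" "y \<in> X" for x y
  proof -
    have h: "(1/2) *\<^sub>R (x + y) \<in> X" by (intro XD that)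
    have "Re (f ((1/2) *\<^sub>R (x + y))) = (Re (f x) + Re (f y)) / 2"
      using that XD by (simp add: scaleR add)
    moreover have "(norm ((1/2) *\<^sub>R (x + y)))\<^sup>2 = (norm (x + y))\<^sup>2 / 4"
      by (simp add: power_divide)
    moreover have "(norm (x - y))\<^sup>2 + (norm (x + y))\<^sup>2 = 2 * (norm x)\<^sup>2 + 2 * (norm y)\<^sup>2"
      by (simp add: power2_norm_eq_inner inner_add inner_diff inner_commute)
    ultimately have "(norm (x - y))\<^sup>2 = 2 * \<phi> x + 2 * \<phi> y - 4 * \<phi> ((1/2) *\<^sub>R (x + y))"
      unfolding \<phi>_def by argo
    then show ?thesis using d[OF h] by simp
  qed
  have "Cauchy s"
  proof (rule metric_CauchyI)
    fix e :: real assume e: "0 < e"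
    obtain M where M: "4 / e\<^sup>2 < real M" using reals_Archimedean2 by blast
    have M0: "M > 0" using M e by (intro gr0I) (auto simp: field_simps)
    have "dist (s m) (s n) < e" if "m \<ge> M" "n \<ge> M" for m n
    proof -
      have tail: "\<phi> (s k) - d < 1 / real M" if "k \<ge> M" for k
      proof -
        have "\<phi> (s k) - d < 1 / real (Suc k)" using s(2)[of k] by simp
        also have "\<dots> \<le> 1 / real M"
          using that M0 by (intro divide_left_mono) auto
        finally show ?thesis .
      qed
      have "(norm (s m - s n))\<^sup>2 < 4 / real M"
        using mid[OF s(1) s(1), of m n] tail[OF that(1)] tail[OF that(2)] by simp
      also have "\<dots> < e\<^sup>2"
        using M M0 e by (simp add: field_simps)
      finally show ?thesis
        using e by (simp add: dist_norm power2_less_imp_less)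
    qed
    then show "\<exists>M. \<forall>m\<ge>M. \<forall>n\<ge>M. dist (s m) (s n) < e" by blast
  qed
  then obtain w where w: "s \<longlonglongrightarrow> w" using Cauchy_convergent convergent_def by blast
  have wX: "w \<in> X" using closed_sequentially[OF XD(6)] s(1) w by blast
  have Re_f: "(\<lambda>n. Re (f (s n))) \<longlonglongrightarrow> Re (f w)"
  proof -
    have "(\<lambda>n. f (s n) - f w) \<longlonglongrightarrow> 0"
    proof (rule Lim_null_comparison)
      have "cmod (f (s n) - f w) \<le> B * norm (s n - w)" for n
      proof -
        have "s n - w \<in> X" by (intro XD s wX)
        moreover have "f (s n) = f (s n - w) + f w" using add[OF calculation wX] by simp
        ultimately show ?thesis using bound by simp
      qed
      then show "\<forall>\<^sub>F n in sequentially. norm (f (s n) - f w) \<le> B * norm (s n - w)" by simp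
      show "(\<lambda>n. B * norm (s n - w)) \<longlonglongrightarrow> 0"
        using tendsto_mult_right_zero[OF tendsto_norm_zero[OF LIM_zero[OF w]], of B] by simp
    qed
    then have "(\<lambda>n. f (s n)) \<longlonglongrightarrow> f w" by (rule LIM_zero_cancel)
    then show ?thesis by (rule tendsto_Re)
  qed
  have "(\<lambda>n. \<phi> (s n)) \<longlonglongrightarrow> \<phi> w"
    unfolding \<phi>_def by (intro tendsto_intros w Re_f)
  moreover have "(\<lambda>n. \<phi> (s n)) \<longlonglongrightarrow> d"
  proof (rule tendsto_sandwich[of "\<lambda>_. d" _ _ "\<lambda>n. d + 1 / Suc n"])
    show "(\<lambda>n. d + 1 / Suc n) \<longlonglongrightarrow> d"
      using tendsto_add[OF tendsto_const[of d] LIMSEQ_inverse_real_of_nat]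
      by (simp add: inverse_eq_divide)
  qed (use d s in \<open>auto intro!: always_eventually simp del: of_nat_Suc intro: less_imp_le\<close>)
  ultimately have \<phi>w: "\<phi> w = d" by (rule LIMSEQ_unique)
  have real_part: "Re (f x) = x \<bullet> w" if x: "x \<in> X" for x
  proof (rule ccontr)
    assume ne: "Re (f x) \<noteq> x \<bullet> w"
    define g where "g = Re (f x) - x \<bullet> w"
    have q: "2 * t * g \<le> t\<^sup>2 * (norm x)\<^sup>2" for t
    proof -
      have "d \<le> \<phi> (w + t *\<^sub>R x)" by (intro d XD x wX)
      also have "\<phi> (w + t *\<^sub>R x) = \<phi> w + t\<^sup>2 * (norm x)\<^sup>2 - 2 * t * g"
      proof -
        have "(norm (w + t *\<^sub>R x))\<^sup>2 = (norm w)\<^sup>2 + 2 * t * (x \<bullet> w) + t\<^sup>2 * (norm x)\<^sup>2"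
          unfolding power2_norm_eq_inner
          by (simp add: inner_add inner_commute[of w x] power2_eq_square algebra_simps)
        then show ?thesis
          unfolding \<phi>_def g_def using x wX XD(5) by (simp add: add scaleR algebra_simps)
      qed
      finally show ?thesis using \<phi>w by simp
    qed
    define t where "t = g / ((norm x)\<^sup>2 + 1)"
    have pos: "(norm x)\<^sup>2 + 1 > 0" by (smt (verit) zero_le_power2)
    have "t\<^sup>2 * (norm x)\<^sup>2 \<le> t\<^sup>2 * ((norm x)\<^sup>2 + 1)" by (simp add: mult_left_mono)
    also have "\<dots> = t * g" using pos by (simp add: t_def power2_eq_square)
    finally have "2 * (t * g) \<le> t * g" using q[of t] by (simp only: mult.assoc)
    moreover have "t * g = g\<^sup>2 / ((norm x)\<^sup>2 + 1)" by (simp add: t_def power2_eq_square)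
    moreover have "g\<^sup>2 / ((norm x)\<^sup>2 + 1) > 0" using ne pos by (simp add: g_def)
    ultimately show False by simp
  qed
  have "f x = cinner x w" if x: "x \<in> X" for x
  proof (rule complex_eqI)
    show "Re (f x) = Re (cinner x w)" using real_part[OF x] by (simp add: inner_eq_Re_cinner)
    have "Re (f (\<i> *\<^sub>C x)) = (\<i> *\<^sub>C x) \<bullet> w" by (intro real_part XD x)
    then show "Im (f x) = Im (cinner x w)"
      using x by (simp add: scale inner_eq_Re_cinner cinner_scaleC_left)
  qed
  then show ?thesis using wX by blast
qed

lemma bounded_op_onD:
  assumes "bounded_op_on X A"
  shows "x \<in> X \<Longrightarrow> A x \<in> X" "x \<in> X \<Longrightarrow> y \<in> X \<Longrightarrow> A (x + y) = A x + A y"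
    "x \<in> X \<Longrightarrow> A (c *\<^sub>C x) = c *\<^sub>C A x" "\<exists>B>0. \<forall>x\<in>X. norm (A x) \<le> B * norm x"
proof -
  show "x \<in> X \<Longrightarrow> A x \<in> X" "x \<in> X \<Longrightarrow> y \<in> X \<Longrightarrow> A (x + y) = A x + A y"
    "x \<in> X \<Longrightarrow> A (c *\<^sub>C x) = c *\<^sub>C A x"
    using assms unfolding bounded_op_on_def clinear_on_def by auto
  obtain B where B: "\<forall>x\<in>X. norm (A x) \<le> B * norm x"
    using assms unfolding bounded_op_on_def by blast
  have "norm (A x) \<le> (\<bar>B\<bar> + 1) * norm x" if "x \<in> X" for x
  proof -
    have "B * norm x \<le> (\<bar>B\<bar> + 1) * norm x" by (intro mult_right_mono) auto
    then show ?thesis using B that by force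
  qed
  then show "\<exists>B>0. \<forall>x\<in>X. norm (A x) \<le> B * norm x" by (intro exI[of _ "\<bar>B\<bar> + 1"]) auto
qed

lemma bounded_op_on_diff:
  assumes X: "closed_csubspace X" and A: "bounded_op_on X A" and "x \<in> X" "y \<in> X"
  shows "A (x - y) = A x - A y"
  using bounded_op_onD(2)[OF A, of "x - y" y] csubspaceD(3)[OF X] assms(3,4) by simp

lemma bounded_op_on_zero:
  assumes X: "closed_csubspace X" and A: "bounded_op_on X A"
  shows "A 0 = 0"
  using bounded_op_on_diff[OF X A csubspaceD(1)[OF X] csubspaceD(1)[OF X]] by simp

lemma bounded_op_onI:
  assumes "\<And>x. x \<in> X \<Longrightarrow> A x \<in> X" "\<And>x y. x \<in> X \<Longrightarrow> y \<in> X \<Longrightarrow> A (x + y) = A x + A y"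
    "\<And>c x. x \<in> X \<Longrightarrow> A (c *\<^sub>C x) = c *\<^sub>C A x" "\<And>x. x \<in> X \<Longrightarrow> norm (A x) \<le> B * norm x"
  shows "bounded_op_on X A"
  using assms unfolding bounded_op_on_def clinear_on_def by blast

text \<open>
  This yields both the adjoints and the positive operators that describe the limits of \<open>\<parallel>T\<^sup>n x\<parallel>\<close> along both ends of an orbit.
\<close>

lemma sesquilinear_form_representation:
  fixes b :: "'a::chilbert_space \<Rightarrow> 'a \<Rightarrow> complex"
  assumes X: "closed_csubspace X" and B: "0 \<le> B"
    and add1: "\<And>x y z. x \<in> X \<Longrightarrow> y \<in> X \<Longrightarrow> z \<in> X \<Longrightarrow> b (x + y) z = b x z + b y z"
    and scale1: "\<And>a x z. x \<in> X \<Longrightarrow> z \<in> X \<Longrightarrow> b (a *\<^sub>C x) z = a * b x z"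
    and add2: "\<And>x y z. x \<in> X \<Longrightarrow> y \<in> X \<Longrightarrow> z \<in> X \<Longrightarrow> b x (y + z) = b x y + b x z"
    and scale2: "\<And>a x z. x \<in> X \<Longrightarrow> z \<in> X \<Longrightarrow> b x (a *\<^sub>C z) = cnj a * b x z"
    and bound: "\<And>x z. x \<in> X \<Longrightarrow> z \<in> X \<Longrightarrow> cmod (b x z) \<le> B * norm x * norm z"
  shows "\<exists>A. bounded_op_on X A \<and> (\<forall>x\<in>X. \<forall>z\<in>X. b x z = cinner x (A z))"
proof -
  note XD = csubspaceD[OF X]
  have "\<exists>w\<in>X. \<forall>x\<in>X. b x z = cinner x w" if "z \<in> X" for z
    using riesz_representation_on[OF X, of "\<lambda>x. b x z" "B * norm z"] that bound[of _ z]
    by (simp add: add1 scale1 mult.assoc mult.left_commute mult.commute)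
  then obtain A where A: "\<And>z. z \<in> X \<Longrightarrow> A z \<in> X"
    "\<And>x z. x \<in> X \<Longrightarrow> z \<in> X \<Longrightarrow> b x z = cinner x (A z)" by metis
  have "bounded_op_on X A"
  proof (rule bounded_op_onI)
    show "A (y + z) = A y + A z" if "y \<in> X" "z \<in> X" for y z
      by (rule eq_if_cinner_eq[OF X])
        (use that A XD add2 in \<open>auto simp: cinner_add_right simp flip: A(2)\<close>)
    show "A (c *\<^sub>C z) = c *\<^sub>C A z" if "z \<in> X" for c z
      by (rule eq_if_cinner_eq[OF X])
        (use that A XD scale2 in \<open>auto simp: cinner_scaleC_right simp flip: A(2)\<close>)
    show "norm (A z) \<le> B * norm z" if z: "z \<in> X" for z
    proof -
      have "(norm (A z))\<^sup>2 = cmod (b (A z) z)"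
        using A z by (simp add: cinner_self norm_power)
      also have "\<dots> \<le> B * norm (A z) * norm z" using bound A z by blast
      finally have "norm (A z) * norm (A z) \<le> norm (A z) * (B * norm z)"
        by (simp add: power2_eq_square mult_ac)
      then show ?thesis
        using B by (cases "A z = 0") (auto simp: mult_le_cancel_left)
    qed
  qed (use A in auto)
  then show ?thesis using A(2) by blast
qed

text \<open>
  Riesz vectors exist and are unique, so the definite description in \<open>adjoint_on\<close> denotes.
\<close>

lemma adjoint_on_works:
  assumes X: "closed_csubspace X" and A: "bounded_op_on X A"
  shows "bounded_op_on X (adjoint_on X A)"
    and "x \<in> X \<Longrightarrow> y \<in> X \<Longrightarrow> cinner (A x) y = cinner x (adjoint_on X A y)"
proof -
  obtain B where B: "B > 0" "\<forall>x\<in>X. norm (A x) \<le> B * norm x" using bounded_op_onD(4)[OF A] by blast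
  have "cmod (cinner (A x) z) \<le> B * norm x * norm z" if "x \<in> X" for x z
    using cmod_cinner_le[of "A x" z] B(2) that by (meson mult_right_mono norm_ge_zero order_trans)
  then obtain C where C: "bounded_op_on X C" "\<And>x z. x \<in> X \<Longrightarrow> z \<in> X \<Longrightarrow> cinner (A x) z = cinner x (C z)"
    using sesquilinear_form_representation[OF X, of B "\<lambda>x z. cinner (A x) z"] B(1)
    by (auto simp: bounded_op_onD[OF A] cinner_linear)
  have eq: "adjoint_on X A y = C y" if y: "y \<in> X" for y
    unfolding adjoint_on_def
  proof (rule the_equality)
    show "C y \<in> X \<and> (\<forall>x\<in>X. cinner (A x) y = cinner x (C y))"
      using C y bounded_op_onD(1) by blast
    show "w = C y" if "w \<in> X \<and> (\<forall>x\<in>X. cinner (A x) y = cinner x w)" for w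
      by (rule eq_if_cinner_eq[OF X]) (use that C y bounded_op_onD(1) in auto)
  qed
  show "bounded_op_on X (adjoint_on X A)"
  proof -
    obtain B' where B': "\<forall>x\<in>X. norm (C x) \<le> B' * norm x"
      using bounded_op_onD(4)[OF C(1)] by blast
    show ?thesis
      by (rule bounded_op_onI[of _ _ B'])
        (use csubspaceD[OF X] B' in \<open>auto simp: eq bounded_op_onD[OF C(1)]\<close>)
  qed
  show "x \<in> X \<Longrightarrow> y \<in> X \<Longrightarrow> cinner (A x) y = cinner x (adjoint_on X A y)"
    using C(2) eq by simp
qed

lemma adjoint_on_eqI:
  assumes X: "closed_csubspace X" and "w \<in> X" "\<And>x. x \<in> X \<Longrightarrow> cinner (A x) y = cinner x w"
  shows "adjoint_on X A y = w"
  unfolding adjoint_on_def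
proof (rule the_equality)
  show "w \<in> X \<and> (\<forall>x\<in>X. cinner (A x) y = cinner x w)" using assms by blast
  show "w' = w" if "w' \<in> X \<and> (\<forall>x\<in>X. cinner (A x) y = cinner x w')" for w'
    by (rule eq_if_cinner_eq[OF X]) (use that assms in auto)
qed

section \<open>Square roots of positive operators\<close>

text \<open>
  Evaluate the form of \<open>A\<close> at \<open>c x - A x\<close>. The inequality has two uses: \<open>1 - A / c\<close> is a contraction,
  and a vector on which the form vanishes lies in the kernel of \<open>A\<close>.
\<close>

lemma symmetric_nonneg_norm_le:
  fixes A :: "'a::real_inner \<Rightarrow>\<^sub>L 'a"
  assumes sym: "\<And>x y. A x \<bullet> y = x \<bullet> A y" and pos: "\<And>x. 0 \<le> A x \<bullet> x"
    and c: "0 < c" "norm A \<le> c"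
  shows "(norm (A x))\<^sup>2 \<le> c * (A x \<bullet> x)"
proof -
  have "A (A x) \<bullet> A x \<le> norm (A (A x)) * norm (A x)" by (rule norm_cauchy_schwarz)
  also have "\<dots> \<le> (c * norm (A x)) * norm (A x)"
    by (intro mult_right_mono order_trans[OF norm_blinfun] c norm_ge_zero)
  finally have 1: "A (A x) \<bullet> A x \<le> c * (norm (A x))\<^sup>2" by (simp add: power2_eq_square mult.assoc)
  have "0 \<le> A (c *\<^sub>R x - A x) \<bullet> (c *\<^sub>R x - A x)" by (rule pos)
  also have "\<dots> = c\<^sup>2 * (A x \<bullet> x) - 2 * c * (norm (A x))\<^sup>2 + A (A x) \<bullet> A x"
    unfolding power2_norm_eq_inner
    by (simp add: blinfun.diff_right blinfun.scaleR_right inner_diff sym[of "A x" x]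
        inner_commute[of x "A x"] inner_commute[of "A (A x)" x] power2_eq_square algebra_simps)
  finally have "0 \<le> c * (c * (A x \<bullet> x) - (norm (A x))\<^sup>2)"
    using 1 by (simp add: power2_eq_square algebra_simps)
  then show ?thesis using c by (simp add: zero_le_mult_iff)
qed

text \<open>The iteration \<open>Y \<mapsto> (X + Y\<^sup>2) / 2\<close>, whose fixed points satisfy \<open>(1 - Y)\<^sup>2 = 1 - X\<close>.\<close>

primrec sqrt_iter :: "('a::real_normed_vector \<Rightarrow>\<^sub>L 'a) \<Rightarrow> nat \<Rightarrow> 'a \<Rightarrow>\<^sub>L 'a" where
  "sqrt_iter X 0 = 0"
| "sqrt_iter X (Suc n) = (1/2) *\<^sub>R (X + (sqrt_iter X n o\<^sub>L sqrt_iter X n))"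

text \<open>
  The scalar case \<open>X = 1\<close> of the iteration. It increases to the fixed point \<open>1\<close> and dominates the
  operator iteration for every contraction \<open>X\<close>.
\<close>

primrec sqrt_majorant :: "nat \<Rightarrow> real" where
  "sqrt_majorant 0 = 0"
| "sqrt_majorant (Suc n) = (1 + (sqrt_majorant n)\<^sup>2) / 2"

lemma sqrt_majorant_bounds: "0 \<le> sqrt_majorant n \<and> sqrt_majorant n \<le> 1"
proof (induction n)
  case (Suc n)
  then have "(sqrt_majorant n)\<^sup>2 \<le> 1" by (simp add: power_le_one)
  then show ?case by simp
qed simp

lemma sqrt_majorant_mono: "sqrt_majorant n \<le> sqrt_majorant (Suc n)"
proof -
  have "0 \<le> (1 - sqrt_majorant n)\<^sup>2" by simp
  then show ?thesis by (simp add: power2_diff)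
qed

lemma blinfun_compose_assoc: "(A o\<^sub>L B) o\<^sub>L C = A o\<^sub>L (B o\<^sub>L C)"
  by (rule blinfun_eqI) simp

lemmas bilinear_compose = bounded_bilinear_blinfun_compose
lemmas blinfun_compose_simps =
  bounded_bilinear.add_left[OF bilinear_compose] bounded_bilinear.add_right[OF bilinear_compose]
  bounded_bilinear.diff_left[OF bilinear_compose] bounded_bilinear.diff_right[OF bilinear_compose]
  bounded_bilinear.scaleR_left[OF bilinear_compose] bounded_bilinear.scaleR_right[OF bilinear_compose]

lemma sqrt_iter_commute:
  assumes C: "C o\<^sub>L X = X o\<^sub>L C"
  shows "C o\<^sub>L sqrt_iter X n = sqrt_iter X n o\<^sub>L C"
proof (induction n)
  case (Suc n)
  have "C o\<^sub>L (sqrt_iter X n o\<^sub>L sqrt_iter X n) = (sqrt_iter X n o\<^sub>L sqrt_iter X n) o\<^sub>L C"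
    by (metis Suc blinfun_compose_assoc)
  then show ?case using C by (simp add: blinfun_compose_simps)
qed simp

lemma norm_sqrt_iter:
  assumes "norm X \<le> 1"
  shows "norm (sqrt_iter X n) \<le> sqrt_majorant n"
proof (induction n)
  case (Suc n)
  have "norm (sqrt_iter X n o\<^sub>L sqrt_iter X n) \<le> (sqrt_majorant n)\<^sup>2"
    using norm_blinfun_compose[of "sqrt_iter X n" "sqrt_iter X n"] Suc
    by (smt (verit) mult_mono norm_ge_zero power2_eq_square)
  then show ?case
    using assms norm_triangle_ineq[of X "sqrt_iter X n o\<^sub>L sqrt_iter X n"] by simp
qed simp

text \<open>
  Consecutive iterates commute, so the difference of their squares factors as it does for numbers.
  The increments are therefore dominated by those of the scalar iteration, which telescope to a
  finite sum; this gives convergence in norm.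
\<close>

lemma norm_sqrt_iter_step:
  assumes X: "norm X \<le> 1"
  shows "norm (sqrt_iter X (Suc n) - sqrt_iter X n) \<le> sqrt_majorant (Suc n) - sqrt_majorant n"
proof (induction n)
  case 0
  then show ?case using X by simp
next
  case (Suc n)
  let ?Y = "sqrt_iter X" and ?t = sqrt_majorant
  have comm: "?Y n o\<^sub>L ?Y (Suc n) = ?Y (Suc n) o\<^sub>L ?Y n"
    by (rule sqrt_iter_commute) (rule sqrt_iter_commute[symmetric], simp)
  have "?Y (Suc (Suc n)) - ?Y (Suc n) = (1/2) *\<^sub>R ((?Y (Suc n) o\<^sub>L ?Y (Suc n)) - (?Y n o\<^sub>L ?Y n))"
    by (subst sqrt_iter.simps(2)[of X "Suc n"], subst (3) sqrt_iter.simps(2)[of X n])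
      (simp only: scaleR_diff_right[symmetric] add_diff_cancel_left)
  also have "(?Y (Suc n) o\<^sub>L ?Y (Suc n)) - (?Y n o\<^sub>L ?Y n)
      = (?Y (Suc n) - ?Y n) o\<^sub>L (?Y (Suc n) + ?Y n)"
    using comm by (simp only: blinfun_compose_simps) simp
  finally have "norm (?Y (Suc (Suc n)) - ?Y (Suc n))
      \<le> 1/2 * (norm (?Y (Suc n) - ?Y n) * norm (?Y (Suc n) + ?Y n))"
    using norm_blinfun_compose[of "?Y (Suc n) - ?Y n" "?Y (Suc n) + ?Y n"]
    by (simp only: norm_scaleR)
  also have "\<dots> \<le> 1/2 * ((?t (Suc n) - ?t n) * (?t (Suc n) + ?t n))"
    using norm_triangle_ineq[of "?Y (Suc n)" "?Y n"] norm_sqrt_iter[OF X, of n]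
      norm_sqrt_iter[OF X, of "Suc n"] sqrt_majorant_mono[of n]
    by (intro mult_left_mono mult_mono Suc.IH) (simp_all del: sqrt_iter.simps sqrt_majorant.simps)
  also have "\<dots> = ?t (Suc (Suc n)) - ?t (Suc n)"
    by (subst (3) sqrt_majorant.simps(2), subst (4) sqrt_majorant.simps(2))
      (simp only: power2_eq_square, simp add: algebra_simps)
  finally show ?case .
qed

lemma sqrt_iter_convergent:
  fixes X :: "'a::banach \<Rightarrow>\<^sub>L 'a"
  assumes X: "norm X \<le> 1"
  shows "convergent (sqrt_iter X)"
proof -
  have "convergent sqrt_majorant"
    using Bseq_mono_convergent[of sqrt_majorant] sqrt_majorant_bounds sqrt_majorant_mono
    by (metis BseqI' abs_of_nonneg incseq_SucI incseqD real_norm_def)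
  then have "summable (\<lambda>n. sqrt_majorant (Suc n) - sqrt_majorant n)"
    unfolding convergent_def using telescope_summable by blast
  then have "summable (\<lambda>n. sqrt_iter X (Suc n) - sqrt_iter X n)"
    by (rule summable_comparison_test[rotated])
      (use norm_sqrt_iter_step[OF X] in \<open>blast\<close>)
  then have "convergent (\<lambda>n. \<Sum>k<n. sqrt_iter X (Suc k) - sqrt_iter X k)"
    using summable_iff_convergent by blast
  moreover have "(\<Sum>k<n. sqrt_iter X (Suc k) - sqrt_iter X k) = sqrt_iter X n" for n
    by (subst sum_lessThan_telescope) simp
  ultimately show ?thesis by simp
qed

text \<open>
  The root is \<open>\<surd>c (1 - Y)\<close> with \<open>Y\<close> the limit of the iteration for the contraction \<open>X = 1 - A / c\<close>.
  The commutation clause has two uses later: applied to scalar multiplication it makes the root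
  complex linear, and applied to another root of \<open>A\<close> it gives uniqueness.
\<close>

lemma symmetric_sqrt_exists:
  fixes A :: "'a::{real_inner,banach} \<Rightarrow>\<^sub>L 'a"
  assumes sym: "\<And>x y. A x \<bullet> y = x \<bullet> A y" and pos: "\<And>x. 0 \<le> A x \<bullet> x"
  obtains B where "B o\<^sub>L B = A" "\<And>x y. B x \<bullet> y = x \<bullet> B y" "\<And>x. 0 \<le> B x \<bullet> x"
    "\<And>C. C o\<^sub>L A = A o\<^sub>L C \<Longrightarrow> C o\<^sub>L B = B o\<^sub>L C"
proof -
  define c where "c = norm A + 1"
  have c: "0 < c" "norm A \<le> c" by (auto simp: c_def add_nonneg_pos)
  define X where "X = id_blinfun - (1/c) *\<^sub>R A"
  have Xx: "X x = x - (1/c) *\<^sub>R A x" for x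
    by (simp add: X_def blinfun.diff_left blinfun.scaleR_left)
  have Xsym: "X x \<bullet> y = x \<bullet> X y" for x y
    by (simp add: Xx inner_diff sym)
  have nX: "norm X \<le> 1"
  proof (rule norm_blinfun_bound)
    fix x
    have "(norm (X x))\<^sup>2 = (norm x)\<^sup>2 - 2 / c * (A x \<bullet> x) + (norm (A x))\<^sup>2 / c\<^sup>2"
      unfolding Xx power2_norm_eq_inner
      by (simp add: inner_diff inner_commute[of x "A x"] power2_eq_square diff_divide_distrib)
    also have "(norm (A x))\<^sup>2 / c\<^sup>2 \<le> c * (A x \<bullet> x) / c\<^sup>2"
      by (intro divide_right_mono symmetric_nonneg_norm_le sym pos c) simp
    also have "(norm x)\<^sup>2 - 2 / c * (A x \<bullet> x) + c * (A x \<bullet> x) / c\<^sup>2 = (norm x)\<^sup>2 - (A x \<bullet> x) / c"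
      using c by (simp add: power2_eq_square field_simps)
    also have "\<dots> \<le> (norm x)\<^sup>2" using pos[of x] c by simp
    finally show "norm (X x) \<le> 1 * norm x" by (simp add: power2_le_iff_abs_le)
  qed simp
  obtain Y where Y: "sqrt_iter X \<longlonglongrightarrow> Y" using sqrt_iter_convergent[OF nX] convergent_def by blast
  note tendsto_o = bounded_bilinear.tendsto[OF bilinear_compose]
  have "(\<lambda>n. sqrt_iter X (Suc n)) \<longlonglongrightarrow> (1/2) *\<^sub>R (X + (Y o\<^sub>L Y))"
    unfolding sqrt_iter.simps by (intro tendsto_intros tendsto_o Y)
  then have fixed: "Y = (1/2) *\<^sub>R (X + (Y o\<^sub>L Y))"
    using LIMSEQ_Suc[OF Y] LIMSEQ_unique by blast
  have Yx: "(\<lambda>n. sqrt_iter X n x) \<longlonglongrightarrow> Y x" for x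
    by (intro blinfun.tendsto Y tendsto_const)
  have iter_sym: "sqrt_iter X n x \<bullet> y = x \<bullet> sqrt_iter X n y" for n x y
    by (induction n arbitrary: x y)
      (simp_all add: blinfun.scaleR_left blinfun.add_left inner_add_left inner_add_right Xsym)
  have Ysym: "Y x \<bullet> y = x \<bullet> Y y" for x y
  proof (rule LIMSEQ_unique)
    show "(\<lambda>n. sqrt_iter X n x \<bullet> y) \<longlonglongrightarrow> Y x \<bullet> y" by (intro tendsto_intros Yx)
    show "(\<lambda>n. sqrt_iter X n x \<bullet> y) \<longlonglongrightarrow> x \<bullet> Y y" unfolding iter_sym by (intro tendsto_intros Yx)
  qed
  have nY: "norm Y \<le> 1"
  proof (rule LIMSEQ_le_const2[OF tendsto_norm[OF Y]])
    have "norm (sqrt_iter X n) \<le> 1" for n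
      using norm_sqrt_iter[OF nX, of n] sqrt_majorant_bounds[of n] by linarith
    then show "\<exists>N. \<forall>n\<ge>N. norm (sqrt_iter X n) \<le> 1" by blast
  qed
  define B where "B = sqrt c *\<^sub>R (id_blinfun - Y)"
  have Bx: "B x = sqrt c *\<^sub>R (x - Y x)" for x
    by (simp add: B_def blinfun.diff_left blinfun.scaleR_left)
  show thesis
  proof
    show "B o\<^sub>L B = A"
    proof (rule blinfun_eqI)
      fix x
      have "Y x = (1/2) *\<^sub>R (X x + Y (Y x))"
        by (subst fixed) (simp add: blinfun.add_left blinfun.scaleR_left)
      from arg_cong[OF this, of "(*\<^sub>R) 2"] have "2 *\<^sub>R Y x = X x + Y (Y x)" by simp
      then have "x - 2 *\<^sub>R Y x + Y (Y x) = (1/c) *\<^sub>R A x"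
        by (simp add: Xx)
      moreover have "(B o\<^sub>L B) x = c *\<^sub>R (x - 2 *\<^sub>R Y x + Y (Y x))"
        using c by (simp add: Bx blinfun.diff_right blinfun.scaleR_right algebra_simps scaleR_2)
      ultimately show "(B o\<^sub>L B) x = A x" using c by simp
    qed
    show "B x \<bullet> y = x \<bullet> B y" for x y by (simp add: Bx inner_diff Ysym)
    show "0 \<le> B x \<bullet> x" for x
    proof -
      have "Y x \<bullet> x \<le> norm (Y x) * norm x" by (rule norm_cauchy_schwarz)
      also have "\<dots> \<le> norm x * norm x"
        using order_trans[OF norm_blinfun[of Y x] mult_left_le_one_le[OF norm_ge_zero norm_ge_zero nY]]
        by (rule mult_right_mono) simp
      finally have "0 \<le> (x - Y x) \<bullet> x"
        by (simp add: inner_diff_left power2_norm_eq_inner flip: power2_eq_square)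
      then show ?thesis using c by (simp add: Bx)
    qed
    fix C assume C: "C o\<^sub>L A = A o\<^sub>L C"
    have "C o\<^sub>L id_blinfun = id_blinfun o\<^sub>L C" by (rule blinfun_eqI) simp
    then have commid: "C o\<^sub>L X = X o\<^sub>L C" and id: "C o\<^sub>L id_blinfun = id_blinfun o\<^sub>L C"
      using C by (simp_all add: X_def blinfun_compose_simps)
    from commid have iter: "C o\<^sub>L sqrt_iter X n = sqrt_iter X n o\<^sub>L C" for n by (rule sqrt_iter_commute)
    have "C o\<^sub>L Y = Y o\<^sub>L C"
    proof (rule LIMSEQ_unique)
      show "(\<lambda>n. C o\<^sub>L sqrt_iter X n) \<longlonglongrightarrow> (C o\<^sub>L Y)" by (intro tendsto_o tendsto_const Y)
      show "(\<lambda>n. C o\<^sub>L sqrt_iter X n) \<longlonglongrightarrow> (Y o\<^sub>L C)" unfolding iter by (intro tendsto_o tendsto_const Y)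
    qed
    then show "C o\<^sub>L B = B o\<^sub>L C" using id by (simp add: B_def blinfun_compose_simps)
  qed
qed

text \<open>
  For \<open>y = (B - C) x\<close> commutation gives \<open>(B + C) y = (B\<^sup>2 - C\<^sup>2) x = 0\<close>. Then the forms of \<open>B\<close> and \<open>C\<close>
  both vanish at \<open>y\<close>, so \<open>B y = C y = 0\<close> and \<open>\<parallel>y\<parallel>\<^sup>2 = \<langle>x, (B - C) y\<rangle> = 0\<close>.
\<close>

lemma symmetric_sqrt_unique:
  fixes B C :: "'a::{real_inner,banach} \<Rightarrow>\<^sub>L 'a"
  assumes B: "\<And>x y. B x \<bullet> y = x \<bullet> B y" "\<And>x. 0 \<le> B x \<bullet> x"
    and C: "\<And>x y. C x \<bullet> y = x \<bullet> C y" "\<And>x. 0 \<le> C x \<bullet> x"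
    and sq: "B o\<^sub>L B = C o\<^sub>L C" and comm: "C o\<^sub>L B = B o\<^sub>L C"
  shows "B = C"
proof (rule blinfun_eqI)
  fix x
  have null: "P y = 0" if P: "\<And>x y. P x \<bullet> y = x \<bullet> P y" "\<And>x. 0 \<le> P x \<bullet> x" and "P y \<bullet> y = 0"
    for P :: "'a \<Rightarrow>\<^sub>L 'a" and y
    using symmetric_nonneg_norm_le[of P "norm P + 1" y] P that(3) by (simp add: add_nonneg_pos)
  define y where "y = B x - C x"
  have sqx: "B (B x) = C (C x)" and commx: "C (B x) = B (C x)"
    using sq comm by (metis blinfun_apply_blinfun_compose)+
  have "B y + C y = 0" by (simp add: y_def blinfun.diff_right sqx commx)
  then have "B y \<bullet> y + C y \<bullet> y = 0" by (metis inner_add_left inner_zero_left)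
  then have "B y \<bullet> y = 0" "C y \<bullet> y = 0" using B(2)[of y] C(2)[of y] by linarith+
  then have "B y = 0" "C y = 0" using null B C by blast+
  then have "y \<bullet> y = 0"
    using B(1)[of x y] C(1)[of x y] by (subst (1) y_def) (simp add: inner_diff_left)
  then show "B x = C x" by (simp add: y_def)
qed

text \<open>
  Over the complex field a non-negative quadratic form is automatically hermitian, so positivity
  amounts to symmetry and non-negativity for the real inner product.
\<close>

lemma positive_op_sym:
  assumes A: "positive_op A"
  shows "cinner (A x) y = cinner x (A y)" "A x \<bullet> y = x \<bullet> A y" "0 \<le> A x \<bullet> x"
    "cinner (A x) x = of_real (A x \<bullet> x)"
proof -
  have b: "bounded_op_on UNIV A" and p: "cinner (A x) x \<in> \<real>\<^sub>\<ge>\<^sub>0" for x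
    using A by (auto simp: positive_op_def)
  have im: "Im (cinner (A z) z) = 0" for z
    using p[of z] by (auto simp: nonneg_Reals_def)
  have "Im (cinner (A x) y) + Im (cinner (A y) x) = 0"
    using im[of "x + y"] im[of x] im[of y]
    by (simp add: bounded_op_onD[OF b] cinner_linear)
  moreover have "Re (cinner (A y) x) - Re (cinner (A x) y) = 0"
    using im[of "x + \<i> *\<^sub>C y"] im[of x] im[of y]
    by (simp add: bounded_op_onD[OF b] cinner_linear)
  ultimately have "cinner (A x) y = cnj (cinner (A y) x)"
    by (simp add: complex_eq_iff)
  then show 1: "cinner (A x) y = cinner x (A y)" by (simp flip: cinner_commute)
  then show "A x \<bullet> y = x \<bullet> A y" by (simp add: inner_eq_Re_cinner)
  show "0 \<le> A x \<bullet> x" using p[of x] by (auto simp: nonneg_Reals_def inner_eq_Re_cinner)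
  show "cinner (A x) x = of_real (A x \<bullet> x)"
    using im[of x] by (simp add: inner_eq_Re_cinner complex_eq_iff)
qed

lemma positive_opI:
  assumes b: "bounded_op_on UNIV A"
    and sym: "\<And>x y. A x \<bullet> y = x \<bullet> A y" and pos: "\<And>x. 0 \<le> A x \<bullet> x"
  shows "positive_op A"
proof -
  have "Im (cinner (A x) x) = 0" for x
  proof -
    have "A x \<bullet> (\<i> *\<^sub>C x) = x \<bullet> (\<i> *\<^sub>C A x)" by (simp add: sym bounded_op_onD[OF b])
    then have "Re (cinner (A x) (\<i> *\<^sub>C x)) = Re (cnj (cinner (\<i> *\<^sub>C A x) x))"
      by (simp add: inner_eq_Re_cinner flip: cinner_commute)
    then show ?thesis by (simp add: cinner_linear)
  qed
  then have "cinner (A x) x = of_real (A x \<bullet> x)" for x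
    by (simp add: complex_eq_iff inner_eq_Re_cinner)
  then show ?thesis using b pos by (simp add: positive_op_def nonneg_Reals_of_real_iff)
qed

lemma bounded_op_on_imp_bounded_linear:
  assumes "bounded_op_on UNIV A"
  shows "bounded_linear A"
proof -
  obtain B where "\<forall>x\<in>UNIV. norm (A x) \<le> B * norm x" using bounded_op_onD(4)[OF assms] by blast
  then show ?thesis
    by (intro bounded_linear_intro[where K = B])
      (use bounded_op_onD[OF assms] in \<open>auto simp: scaleR_scaleC mult.commute\<close>)
qed

lemma sqrt_op_works:
  assumes A: "positive_op A"
  shows "positive_op (sqrt_op A)" and "sqrt_op A (sqrt_op A x) = A x"
proof -
  have bA: "bounded_op_on UNIV A" using A by (simp add: positive_op_def)
  define A' where "A' = Blinfun A"
  have A': "A' x = A x" for x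
    unfolding A'_def by (simp add: bounded_linear_Blinfun_apply bounded_op_on_imp_bounded_linear[OF bA])
  obtain B where B: "B o\<^sub>L B = A'" "\<And>x y. B x \<bullet> y = x \<bullet> B y" "\<And>x. 0 \<le> B x \<bullet> x"
    "\<And>C. C o\<^sub>L A' = A' o\<^sub>L C \<Longrightarrow> C o\<^sub>L B = B o\<^sub>L C"
    using symmetric_sqrt_exists[of A'] positive_op_sym[OF A] A' by metis
  have Bpos: "positive_op (blinfun_apply B)"
  proof (rule positive_opI[OF _ B(2,3)])
    have "B (c *\<^sub>C x) = c *\<^sub>C B x" for c x
    proof -
      define C :: "'a \<Rightarrow>\<^sub>L 'a" where "C = Blinfun ((*\<^sub>C) c)"
      have C: "C x = c *\<^sub>C x" for x
        unfolding C_def by (simp add: bounded_linear_Blinfun_apply bounded_linear_scaleC)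
      have "C o\<^sub>L A' = A' o\<^sub>L C"
        by (rule blinfun_eqI) (simp add: C A' bounded_op_onD[OF bA])
      then have "(C o\<^sub>L B) x = (B o\<^sub>L C) x" using B(4) by simp
      then show ?thesis by (simp add: C)
    qed
    then show "bounded_op_on UNIV (blinfun_apply B)"
      by (intro bounded_op_onI[where B = "norm B"]) (auto simp: blinfun.add_right norm_blinfun)
  qed
  have Bsq: "blinfun_apply B \<circ> blinfun_apply B = A"
    using B(1) A' by (auto simp: fun_eq_iff)
  have "sqrt_op A = blinfun_apply B"
    unfolding sqrt_op_def
  proof (rule the_equality)
    fix C assume C: "positive_op C \<and> C \<circ> C = A"
    define C' where "C' = Blinfun C"
    have C': "C' x = C x" for x
      unfolding C'_def using C
      by (simp add: bounded_linear_Blinfun_apply bounded_op_on_imp_bounded_linear positive_op_def)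
    have CC: "C' o\<^sub>L C' = A'" by (rule blinfun_eqI) (use C in \<open>auto simp: C' A' fun_eq_iff\<close>)
    have "C' o\<^sub>L B = B o\<^sub>L C'" by (rule B(4)) (simp flip: CC add: blinfun_compose_assoc)
    then have "B = C'"
      using symmetric_sqrt_unique[OF B(2,3), of C'] C positive_op_sym[of C] C' B(1) CC by simp
    then show "C = blinfun_apply B" using C' by auto
  qed (use Bpos Bsq in simp)
  then show "positive_op (sqrt_op A)" "sqrt_op A (sqrt_op A x) = A x"
    using Bpos by simp_all (use Bsq in \<open>simp add: fun_eq_iff\<close>)
qed

lemma norm_sqrt_op:
  assumes A: "positive_op A"
  shows "(norm (sqrt_op A x))\<^sup>2 = A x \<bullet> x"
  using positive_op_sym(2)[OF sqrt_op_works(1)[OF A], of x "sqrt_op A x"]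
  by (simp add: power2_norm_eq_inner sqrt_op_works(2)[OF A] inner_commute)

section \<open>Normal operators with spectrum in the two circles\<close>

text \<open>
  A form of the fact that a normal operator has norm equal to its spectral radius. The function
  \<open>(1 - z G)\<^sup>-\<^sup>1 x\<close> is holomorphic for \<open>\<bar>z\<bar> < \<rho>\<close> with Taylor coefficients \<open>G\<^sup>n x\<close>, so Cauchy's inequality
  bounds these by \<open>C / \<sigma>\<^sup>n\<close> for each \<open>\<sigma> < \<rho>\<close>. Log-convexity, on the other hand, makes \<open>\<parallel>G\<^sup>n x\<parallel>\<close> grow
  at least geometrically with ratio \<open>\<parallel>G x\<parallel> / \<parallel>x\<parallel>\<close>, which therefore is at most \<open>1 / \<rho>\<close>.
\<close>

lemma log_convex_op_bound:
  fixes G :: "'a::chilbert_space \<Rightarrow> 'a"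
  assumes L: "closed_csubspace L" and G: "bounded_op_on L G" and \<rho>: "0 < \<rho>"
    and inv: "\<And>z. cmod z < \<rho> \<Longrightarrow> invertible_op_on L (\<lambda>x. x - z *\<^sub>C G x)"
    and convex: "\<And>x. x \<in> L \<Longrightarrow> (norm (G x))\<^sup>2 \<le> norm (G (G x)) * norm x"
    and x: "x \<in> L"
  shows "\<rho> * norm (G x) \<le> norm x"
proof (rule ccontr)
  assume contra: "\<not> \<rho> * norm (G x) \<le> norm x"
  note LD = csubspaceD[OF L]
  obtain \<Gamma> where \<Gamma>: "0 < \<Gamma>" "\<And>v. v \<in> L \<Longrightarrow> norm (G v) \<le> \<Gamma> * norm v"
    using bounded_op_onD(4)[OF G] by blast
  have "\<exists>R. bounded_op_on L R \<and> (\<forall>v\<in>L. R v - z *\<^sub>C G (R v) = v \<and> R (v - z *\<^sub>C G v) = v)"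
    if "cmod z < \<rho>" for z
    using inv[OF that] unfolding invertible_op_on_def by blast
  then obtain R where R: "\<And>z. cmod z < \<rho> \<Longrightarrow> bounded_op_on L (R z)"
    and RG: "\<And>z v. cmod z < \<rho> \<Longrightarrow> v \<in> L \<Longrightarrow> R z v - z *\<^sub>C G (R z v) = v"
    and GR: "\<And>z v. cmod z < \<rho> \<Longrightarrow> v \<in> L \<Longrightarrow> R z (v - z *\<^sub>C G v) = v"
    by metis
  have RL: "R z v \<in> L" if "cmod z < \<rho>" "v \<in> L" for z v
    using bounded_op_onD(1)[OF R] that by blast
  have GL: "G v \<in> L" if "v \<in> L" for v using bounded_op_onD(1)[OF G] that by blast
  have resolvent: "R z v = R w v + (z - w) *\<^sub>C R z (G (R w v))"
    if z: "cmod z < \<rho>" and w: "cmod w < \<rho>" and v: "v \<in> L" for z w v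
  proof -
    define u where "u = R w v"
    have u: "u \<in> L" "G u \<in> L" using RL GL w v by (auto simp: u_def)
    have "v = (u - z *\<^sub>C G u) + (z - w) *\<^sub>C G u"
      using RG[OF w v] unfolding u_def
      by (simp add: complex_vector.scale_left_diff_distrib)
    also have "R z \<dots> = R z (u - z *\<^sub>C G u) + (z - w) *\<^sub>C R z (G u)"
      using u LD by (subst bounded_op_onD(2)[OF R[OF z]]) (auto simp: bounded_op_onD(3)[OF R[OF z]])
    also have "R z (u - z *\<^sub>C G u) = u" using GR z u by blast
    finally show ?thesis by (simp add: u_def)
  qed
  have R_cont: "((\<lambda>z. R z v) \<longlongrightarrow> R w v) (at w)" if w: "cmod w < \<rho>" and v: "v \<in> L" for w v
  proof -
    obtain K where K: "0 < K" "\<And>v. v \<in> L \<Longrightarrow> norm (R w v) \<le> K * norm v"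
      using bounded_op_onD(4)[OF R[OF w]] by blast
    define \<delta> where "\<delta> = min (\<rho> - cmod w) (1 / (2 * K * \<Gamma>))"
    have \<delta>: "\<delta> > 0" using w K \<Gamma> by (simp add: \<delta>_def)
    have est: "norm (R z v - R w v) \<le> cmod (z - w) * (K * \<Gamma> * (2 * (K * norm v)))"
      if z: "cmod (z - w) < \<delta>" for z
    proof -
      have z\<rho>: "cmod z < \<rho>" using z norm_triangle_ineq[of "z - w" w] by (simp add: \<delta>_def)
      have KG: "cmod (z - w) * (K * \<Gamma>) \<le> 1/2"
      proof -
        have "cmod (z - w) \<le> 1 / (2 * K * \<Gamma>)" using z by (simp add: \<delta>_def)
        then have "cmod (z - w) * (K * \<Gamma>) \<le> 1 / (2 * K * \<Gamma>) * (K * \<Gamma>)"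
          using K \<Gamma> by (intro mult_right_mono) auto
        also have "\<dots> = 1/2" using K \<Gamma> by simp
        finally show ?thesis .
      qed
      have eq: "R z v - R w v = (z - w) *\<^sub>C R w (G (R z v))"
        using resolvent[OF w z\<rho> v] complex_vector.scale_minus_left[of "w - z", symmetric]
        by (simp del: complex_vector.scale_minus_left)
      have 1: "norm (R z v - R w v) \<le> cmod (z - w) * (K * \<Gamma> * norm (R z v))"
      proof -
        have "norm (R w (G (R z v))) \<le> K * (\<Gamma> * norm (R z v))"
          using K RL[OF z\<rho> v] GL \<Gamma> by (meson less_imp_le mult_left_mono order_trans)
        then show ?thesis unfolding eq norm_scaleC by (simp add: mult_left_mono mult.assoc)
      qed
      also have "\<dots> = (cmod (z - w) * (K * \<Gamma>)) * norm (R z v)" by simp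
      also have "\<dots> \<le> 1/2 * norm (R z v)" using KG by (rule mult_right_mono) simp
      finally have "norm (R z v) \<le> 2 * norm (R w v)"
        using norm_triangle_ineq2[of "R z v" "R w v"] by simp
      then have "norm (R z v) \<le> 2 * (K * norm v)" using K(2)[OF v] by simp
      then have "cmod (z - w) * (K * \<Gamma> * norm (R z v))
          \<le> cmod (z - w) * (K * \<Gamma> * (2 * (K * norm v)))"
        using K \<Gamma> by (intro mult_left_mono) auto
      with 1 show ?thesis by linarith
    qed
    have "((\<lambda>z. R z v - R w v) \<longlongrightarrow> 0) (at w)"
    proof (rule Lim_null_comparison)
      show "\<forall>\<^sub>F z in at w. norm (R z v - R w v) \<le> cmod (z - w) * (K * \<Gamma> * (2 * (K * norm v)))"
        using est \<delta> unfolding eventually_at dist_norm by blast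
      show "((\<lambda>z. cmod (z - w) * (K * \<Gamma> * (2 * (K * norm v)))) \<longlongrightarrow> 0) (at w)"
        by (auto intro!: tendsto_mult_left_zero tendsto_norm_zero LIM_zero)
    qed
    then show ?thesis by (rule LIM_zero_cancel)
  qed
  have holo: "(\<lambda>z. cinner (R z v) y) holomorphic_on ball 0 \<rho>" if v: "v \<in> L" for v y
  proof -
    have "((\<lambda>z. cinner (R z v) y) has_field_derivative cinner (R w (G (R w v))) y) (at w)"
      if w: "w \<in> ball 0 \<rho>" for w
    proof -
      have w': "cmod w < \<rho>" using w by simp
      have "((\<lambda>z. cinner (R z (G (R w v))) y) \<longlongrightarrow> cinner (R w (G (R w v))) y) (at w)"
        by (intro tendsto_cinner tendsto_const R_cont w' GL RL v)
      moreover have "\<forall>\<^sub>F z in at w. cinner (R z (G (R w v))) y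
          = (cinner (R z v) y - cinner (R w v) y) / (z - w)"
      proof -
        have "\<forall>\<^sub>F z in at w. z \<in> ball 0 \<rho> - {w}"
          using w by (intro eventually_at_in_open) auto
        then show ?thesis
        proof eventually_elim
          case (elim z)
          then have "R z v = R w v + (z - w) *\<^sub>C R z (G (R w v))"
            using resolvent[OF _ w' v, of z] by simp
          then have "cinner (R z v) y = cinner (R w v) y + (z - w) * cinner (R z (G (R w v))) y"
            by (metis cinner_add_left cinner_scaleC_left)
          then show ?case using elim by simp
        qed
      qed
      ultimately show ?thesis
        unfolding has_field_derivative_iff by (rule Lim_transform_eventually)
    qed
    then show ?thesis
      unfolding holomorphic_on_def field_differentiable_def
      using has_field_derivative_at_within by blast
  qed
  define g where "g n = (G ^^ n) x" for n
  have g_Suc: "g (Suc n) = G (g n)" and g0: "g 0 = x" for n by (simp_all add: g_def)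
  have gL: "g n \<in> L" for n by (induction n) (simp_all add: g0 g_Suc x GL)
  have g_bound: "norm (g n) \<le> \<Gamma> ^ n * norm x" for n
  proof (induction n)
    case (Suc n)
    have "norm (g (Suc n)) \<le> \<Gamma> * norm (g n)" unfolding g_Suc by (rule \<Gamma>(2)[OF gL])
    also have "\<dots> \<le> \<Gamma> * (\<Gamma> ^ n * norm x)" using Suc \<Gamma>(1) by (intro mult_left_mono) auto
    finally show ?case by (simp add: mult.assoc)
  qed (simp add: g0)
  have expand: "R z x = (\<Sum>k<n. z ^ k *\<^sub>C g k) + z ^ n *\<^sub>C R z (g n)" if z: "cmod z < \<rho>" for z n
  proof (induction n)
    case 0
    show ?case by (simp add: g0 scaleC_one)
  next
    case (Suc n)
    have "R z (g n) = R z (g n - z *\<^sub>C G (g n)) + R z (z *\<^sub>C G (g n))"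
      using gL GL LD by (subst bounded_op_onD(2)[OF R[OF z], symmetric]) auto
    also have "\<dots> = g n + z *\<^sub>C R z (g (Suc n))"
      using GR[OF z gL] bounded_op_onD(3)[OF R[OF z] gL[of "Suc n"]] by (simp add: g_Suc)
    finally show ?case using Suc
      by (simp add: scaleC_add_right scaleC_scaleC add.assoc mult.commute)
  qed
  \<comment> \<open>The Taylor coefficients of the local resolvent are the powers of \<open>G\<close>.\<close>
  have taylor: "(deriv ^^ n) (\<lambda>z. cinner (R z x) y) 0 / fact n = cinner (g n) y" for n y
  proof -
    define \<sigma> where "\<sigma> = min (\<rho> / 2) (1 / (2 * \<Gamma>))"
    have \<sigma>: "0 < \<sigma>" using \<rho> \<Gamma> by (simp add: \<sigma>_def)
    have sums: "(\<lambda>n. cinner (g n) y * z ^ n) sums cinner (R z x) y" if z: "cmod z < \<sigma>" for z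
    proof -
      have z\<rho>: "cmod z < \<rho>" using z \<rho> by (simp add: \<sigma>_def)
      have q: "cmod z * \<Gamma> \<le> 1/2"
      proof -
        have "cmod z * \<Gamma> \<le> 1 / (2 * \<Gamma>) * \<Gamma>"
          using z \<Gamma> by (intro mult_right_mono) (auto simp: \<sigma>_def)
        then show ?thesis using \<Gamma> by simp
      qed
      obtain K where K: "0 < K" "\<And>v. v \<in> L \<Longrightarrow> norm (R z v) \<le> K * norm v"
        using bounded_op_onD(4)[OF R[OF z\<rho>]] by blast
      have "(\<lambda>n. z ^ n *\<^sub>C R z (g n)) \<longlonglongrightarrow> 0"
      proof (rule Lim_null_comparison)
        have "norm (z ^ n *\<^sub>C R z (g n)) \<le> (1/2) ^ n * (K * norm x)" for n
        proof -
          have "norm (z ^ n *\<^sub>C R z (g n)) \<le> cmod z ^ n * (K * (\<Gamma> ^ n * norm x))"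
            unfolding norm_scaleC norm_power using K(2)[OF gL, of n] g_bound[of n] K(1)
            by (intro mult_left_mono) (auto intro: order_trans mult_left_mono)
          also have "\<dots> = (cmod z * \<Gamma>) ^ n * (K * norm x)" by (simp add: power_mult_distrib)
          also have "\<dots> \<le> (1/2) ^ n * (K * norm x)"
            using q \<Gamma> K(1) by (intro mult_right_mono power_mono) auto
          finally show ?thesis .
        qed
        then show "\<forall>\<^sub>F n in sequentially. norm (z ^ n *\<^sub>C R z (g n)) \<le> (1/2) ^ n * (K * norm x)"
          by simp
        show "(\<lambda>n. (1/2) ^ n * (K * norm x)) \<longlonglongrightarrow> 0"
          by (intro tendsto_mult_left_zero LIMSEQ_power_zero) simp
      qed
      then have "(\<lambda>n. cinner (R z x - z ^ n *\<^sub>C R z (g n)) y) \<longlonglongrightarrow> cinner (R z x - 0) y"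
        by (intro tendsto_cinner tendsto_diff tendsto_const)
      moreover have "cinner (R z x - z ^ n *\<^sub>C R z (g n)) y = (\<Sum>k<n. cinner (g k) y * z ^ k)" for n
      proof -
        have "cinner (R z x - z ^ n *\<^sub>C R z (g n)) y = cinner (\<Sum>k<n. z ^ k *\<^sub>C g k) y"
          using expand[OF z\<rho>, of n] by simp
        also have "\<dots> = (\<Sum>k<n. cinner (z ^ k *\<^sub>C g k) y)"
          by (induction n) (simp_all add: cinner_add_left)
        finally show ?thesis by (simp add: cinner_scaleC_left mult.commute)
      qed
      ultimately show ?thesis by (simp add: sums_def)
    qed
    have "(\<lambda>z. cinner (R z x) y) has_fps_expansion Abs_fps (\<lambda>n. cinner (g n) y)"
    proof (rule has_fps_expansionI)
      have "\<forall>\<^sub>F u in nhds 0. u \<in> ball 0 \<sigma>"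
        using \<sigma> by (intro eventually_nhds_in_open) auto
      then show "\<forall>\<^sub>F u in nhds 0. (\<lambda>n. fps_nth (Abs_fps (\<lambda>n. cinner (g n) y)) n * u ^ n)
          sums cinner (R u x) y"
        by eventually_elim (use sums in simp)
    qed
    from fps_nth_fps_expansion[OF this, of n] show ?thesis by simp
  qed
  have xpos: "0 < norm x"
  proof (rule ccontr)
    assume "\<not> 0 < norm x"
    then have "x = 0" by simp
    then show False using contra bounded_op_on_zero[OF L G] by simp
  qed
  define q where "q = norm (G x) / norm x"
  have q: "\<rho> * q > 1" "q > 0"
  proof -
    show "\<rho> * q > 1" using contra xpos by (simp add: q_def)
    then show "q > 0" using \<rho> by (metis less_trans zero_less_mult_pos zero_less_one)
  qed
  \<comment> \<open>Log-convexity makes the orbit of \<open>x\<close> grow at least like \<open>q ^ n\<close>.\<close>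
  have ratio: "norm (g (Suc n)) \<ge> q * norm (g n) \<and> norm (g n) > 0" for n
  proof (induction n)
    case 0
    then show ?case using xpos by (simp add: g0 g_Suc q_def)
  next
    case (Suc n)
    then have pos: "norm (g (Suc n)) > 0" using q by (smt (verit) mult_pos_pos)
    have "norm (g (Suc n)) * (q * norm (g n)) \<le> norm (g (Suc n)) * norm (g (Suc n))"
      using Suc by (intro mult_left_mono) auto
    also have "\<dots> \<le> norm (g (Suc (Suc n))) * norm (g n)"
      using convex[OF gL[of n]] by (simp add: g_Suc power2_eq_square)
    finally have "(q * norm (g (Suc n))) * norm (g n) \<le> norm (g (Suc (Suc n))) * norm (g n)"
      by (simp add: mult_ac)
    then have "q * norm (g (Suc n)) \<le> norm (g (Suc (Suc n)))"
      using Suc by (metis mult_le_cancel_right_pos)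
    with pos show ?case by simp
  qed
  have growth: "q ^ n * norm x \<le> norm (g n)" for n
  proof (induction n)
    case (Suc n)
    have "q * (q ^ n * norm x) \<le> q * norm (g n)" using Suc q by (intro mult_left_mono) auto
    then show ?case using ratio[of n] by (simp add: mult.assoc)
  qed (simp add: g0)
  obtain \<sigma> where \<sigma>: "1 / q < \<sigma>" "\<sigma> < \<rho>"
    using dense[of "1 / q" \<rho>] q by (auto simp: field_simps)
  have \<sigma>0: "0 < \<sigma>" using \<sigma>(1) q(2) by (meson less_trans zero_less_divide_1_iff)
  obtain C where C: "\<And>z. z \<in> cball 0 \<sigma> \<Longrightarrow> norm (R z x) \<le> C"
  proof -
    have "continuous_on (cball 0 \<sigma>) (\<lambda>z. R z x)"
      using \<sigma>(2) x by (intro continuous_at_imp_continuous_on ballI) (auto simp: isCont_def intro!: R_cont)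
    then have "bounded ((\<lambda>z. R z x) ` cball 0 \<sigma>)"
      by (intro compact_imp_bounded compact_continuous_image compact_cball)
    then show thesis using that unfolding bounded_iff by blast
  qed
  \<comment> \<open>\<open>C\<close> does not depend on the vector paired with the resolvent, so that vector may be \<open>g n\<close>.\<close>
  have bound: "norm (g n) * \<sigma> ^ n \<le> C" for n
  proof -
    define F where "F = (\<lambda>z. cinner (R z x) (g n))"
    have hol: "F holomorphic_on ball 0 \<rho>" unfolding F_def by (rule holo[OF x])
    have "norm ((deriv ^^ n) F 0) \<le> fact n * (C * norm (g n)) / \<sigma> ^ n"
    proof (rule Cauchy_inequality[OF _ _ \<sigma>0])
      show "F holomorphic_on ball 0 \<sigma>" using hol \<sigma> by (auto intro: holomorphic_on_subset)
      show "continuous_on (cball 0 \<sigma>) F"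
        by (rule holomorphic_on_imp_continuous_on)
          (use hol \<sigma> in \<open>auto intro!: holomorphic_on_subset[OF hol]\<close>)
      show "norm (F z) \<le> C * norm (g n)" if "norm (0 - z) = \<sigma>" for z
      proof -
        have "norm (F z) \<le> norm (R z x) * norm (g n)" unfolding F_def by (rule cmod_cinner_le)
        also have "\<dots> \<le> C * norm (g n)" using C[of z] that by (intro mult_right_mono) auto
        finally show ?thesis .
      qed
    qed
    moreover have "(deriv ^^ n) F 0 = fact n * of_real ((norm (g n))\<^sup>2)"
      using taylor[of n "g n"] by (simp add: F_def cinner_self field_simps)
    ultimately have "fact n * (norm (g n))\<^sup>2 \<le> fact n * (C * norm (g n) / \<sigma> ^ n)"
      by (simp add: norm_mult norm_power)
    then have "(norm (g n))\<^sup>2 \<le> C * norm (g n) / \<sigma> ^ n"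
      by (simp only: mult_le_cancel_left_pos fact_gt_zero)
    then have "norm (g n) * (norm (g n) * \<sigma> ^ n) \<le> norm (g n) * C"
      using \<sigma>0 by (simp add: field_simps power2_eq_square)
    then show ?thesis using ratio[of n] by (metis mult_le_cancel_left_pos)
  qed
  have "1 < q * \<sigma>" using \<sigma>(1) q by (simp add: field_simps)
  then obtain n where n: "C / norm x < (q * \<sigma>) ^ n" using real_arch_pow by blast
  have "C < (q * \<sigma>) ^ n * norm x" using n xpos by (simp add: field_simps)
  also have "\<dots> = (q ^ n * norm x) * \<sigma> ^ n" by (simp add: power_mult_distrib)
  also have "\<dots> \<le> norm (g n) * \<sigma> ^ n" using growth \<sigma>0 by (intro mult_right_mono) auto
  also have "\<dots> \<le> C" by (rule bound)
  finally show False by simp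
qed

lemma normal_on_norm_adjoint:
  assumes L: "closed_csubspace L" and N: "normal_on L N" and x: "x \<in> L"
  shows "norm (adjoint_on L N x) = norm (N x)"
proof -
  have b: "bounded_op_on L N" using N by (simp add: normal_on_def)
  note A = adjoint_on_works[OF L b]
  have mem: "N x \<in> L" "adjoint_on L N x \<in> L"
    using bounded_op_onD(1)[OF b] bounded_op_onD(1)[OF A(1)] x by auto
  have "cinner (adjoint_on L N x) (adjoint_on L N x) = cinner (N (adjoint_on L N x)) x"
    using A(2)[OF mem(2) x] by simp
  also have "\<dots> = cinner (adjoint_on L N (N x)) x" using N x by (simp add: normal_on_def)
  also have "\<dots> = cnj (cinner x (adjoint_on L N (N x)))" by (rule cinner_commute)
  also have "\<dots> = cnj (cinner (N x) (N x))" using A(2)[OF x mem(1)] by simp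
  finally have "complex_of_real ((norm (adjoint_on L N x))\<^sup>2) = of_real ((norm (N x))\<^sup>2)"
    unfolding cinner_self by (simp del: of_real_power)
  then have "(norm (adjoint_on L N x))\<^sup>2 = (norm (N x))\<^sup>2" using of_real_eq_iff by blast
  then show ?thesis by (simp add: power2_eq_iff_nonneg)
qed

text \<open>
  \<open>\<parallel>N x\<parallel>\<^sup>2 = \<langle>x, N\<^sup>* N x\<rangle> \<le> \<parallel>x\<parallel> \<parallel>N\<^sup>* N x\<parallel>\<close>, and \<open>N\<^sup>*\<close> may be replaced by \<open>N\<close> in the last norm.
\<close>

lemma normal_on_log_convex:
  assumes L: "closed_csubspace L" and N: "normal_on L N" and x: "x \<in> L"
  shows "(norm (N x))\<^sup>2 \<le> norm (N (N x)) * norm x"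
proof -
  have b: "bounded_op_on L N" using N by (simp add: normal_on_def)
  have NxL: "N x \<in> L" using bounded_op_onD(1)[OF b x] .
  have "(norm (N x))\<^sup>2 = cmod (cinner (N x) (N x))" by (simp add: cinner_self norm_power)
  also have "\<dots> = cmod (cinner x (adjoint_on L N (N x)))"
    using adjoint_on_works(2)[OF L b x NxL] by simp
  also have "\<dots> \<le> norm x * norm (adjoint_on L N (N x))" by (rule cmod_cinner_le)
  finally show ?thesis using normal_on_norm_adjoint[OF L N NxL] by (simp add: mult.commute)
qed

text \<open>
  The upper bound is \<open>log_convex_op_bound\<close> for \<open>N\<close> with \<open>\<rho> = 1\<close>, since \<open>1 - z N = - z (N - 1 / z)\<close>. The
  lower bound is the same for \<open>N\<^sup>-\<^sup>1\<close> with \<open>\<rho> = r\<close>, since \<open>1 - z N\<^sup>-\<^sup>1 = (N - z) N\<^sup>-\<^sup>1\<close>.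
\<close>

lemma normal_spectrum_bounds:
  fixes N :: "'a::chilbert_space \<Rightarrow> 'a"
  assumes L: "closed_csubspace L" and N: "normal_on L N" and r: "0 < r" "r < 1"
    and spec: "spectrum_on L N \<subseteq> {z. cmod z = r} \<union> {z. cmod z = 1}" and x: "x \<in> L"
  shows "norm (N x) \<le> norm x" and "r * norm x \<le> norm (N x)"
proof -
  note LD = csubspaceD[OF L]
  have b: "bounded_op_on L N" using N by (simp add: normal_on_def)
  note ND = bounded_op_onD[OF b]
  have res: "invertible_op_on L (\<lambda>x. N x - l *\<^sub>C x)" if "cmod l \<noteq> r" "cmod l \<noteq> 1" for l
    using spec that by (auto simp: spectrum_on_def)
  have scaled: "invertible_op_on L (\<lambda>x. c *\<^sub>C A x)" if A: "invertible_op_on L A" and c: "c \<noteq> 0" for c A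
  proof -
    obtain B where B: "bounded_op_on L A" "bounded_op_on L B" "\<And>x. x \<in> L \<Longrightarrow> A (B x) = x \<and> B (A x) = x"
      using A unfolding invertible_op_on_def by blast
    have sc: "bounded_op_on L (\<lambda>x. d *\<^sub>C D x)" if D: "bounded_op_on L D" for d D
    proof -
      obtain K where K: "0 < K" "\<forall>x\<in>L. norm (D x) \<le> K * norm x" using bounded_op_onD(4)[OF D] by blast
      show ?thesis
        by (rule bounded_op_onI[where B = "cmod d * K"])
          (use K LD(4) in \<open>auto simp: bounded_op_onD(1-3)[OF D] scaleC_add_right scaleC_scaleC
              mult.commute[of d] norm_scaleC mult.assoc intro!: mult_left_mono\<close>)
    qed
    show ?thesis unfolding invertible_op_on_def
      by (intro conjI exI[of _ "\<lambda>x. inverse c *\<^sub>C B x"] sc B ballI)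
        (use B c bounded_op_onD(1,3)[OF B(1)] bounded_op_onD(1,3)[OF B(2)] LD(4)
          in \<open>simp_all add: scaleC_scaleC scaleC_one\<close>)
  qed
  show "norm (N x) \<le> norm x"
  proof -
    have "1 * norm (N x) \<le> norm x"
    proof (rule log_convex_op_bound[OF L b zero_less_one _ normal_on_log_convex[OF L N] x])
      fix z assume z: "cmod z < 1"
      show "invertible_op_on L (\<lambda>x. x - z *\<^sub>C N x)"
      proof (cases "z = 0")
        case True
        have "bounded_op_on L (\<lambda>x. x)" by (rule bounded_op_onI[where B = 1]) auto
        then show ?thesis using True unfolding invertible_op_on_def by auto
      next
        case False
        have "cmod (1 / z) > 1" using z False by (simp add: norm_divide)
        then have "invertible_op_on L (\<lambda>x. N x - (1 / z) *\<^sub>C x)" using r by (intro res) auto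
        then have "invertible_op_on L (\<lambda>x. (- z) *\<^sub>C (N x - (1 / z) *\<^sub>C x))"
          by (rule scaled) (use False in simp)
        also have "(\<lambda>x. (- z) *\<^sub>C (N x - (1 / z) *\<^sub>C x)) = (\<lambda>x. x - z *\<^sub>C N x)"
          using False by (simp add: fun_eq_iff scaleC_diff_right scaleC_scaleC scaleC_one
              complex_vector.scale_minus_left)
        finally show ?thesis .
      qed
    qed
    then show ?thesis by simp
  qed
  show "r * norm x \<le> norm (N x)"
  proof -
    have "invertible_op_on L (\<lambda>x. N x - 0 *\<^sub>C x)" using r by (intro res) auto
    then obtain I where I: "bounded_op_on L I" and NI: "\<And>x. x \<in> L \<Longrightarrow> N (I x) = x"
      and IN: "\<And>x. x \<in> L \<Longrightarrow> I (N x) = x" unfolding invertible_op_on_def by auto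
    note ID = bounded_op_onD[OF I]
    have "r * norm (I (N x)) \<le> norm (N x)"
    proof (rule log_convex_op_bound[OF L I r(1)])
      show "N x \<in> L" using ND x by blast
      show "(norm (I v))\<^sup>2 \<le> norm (I (I v)) * norm v" if v: "v \<in> L" for v
        using normal_on_log_convex[OF L N, of "I (I v)"] ID(1) v NI by (simp add: mult.commute)
      fix z assume z: "cmod z < r"
      have "invertible_op_on L (\<lambda>x. N x - z *\<^sub>C x)" using z r by (intro res) auto
      then obtain R where R: "bounded_op_on L R"
        and NR: "\<And>x. x \<in> L \<Longrightarrow> N (R x) - z *\<^sub>C R x = x"
        and RN: "\<And>x. x \<in> L \<Longrightarrow> R (N x - z *\<^sub>C x) = x" unfolding invertible_op_on_def by auto
      have comp: "bounded_op_on L (\<lambda>v. A (B v))" if A: "bounded_op_on L A" and B: "bounded_op_on L B" for A B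
      proof -
        obtain K where K: "0 < K" "\<forall>x\<in>L. norm (A x) \<le> K * norm x" using bounded_op_onD(4)[OF A] by blast
        obtain K' where K': "0 < K'" "\<forall>x\<in>L. norm (B x) \<le> K' * norm x" using bounded_op_onD(4)[OF B] by blast
        have "norm (A (B v)) \<le> K * K' * norm v" if v: "v \<in> L" for v
          using K K' v bounded_op_onD(1)[OF B v]
          by (metis mult.assoc mult_le_cancel_left_pos order_trans)
        then show ?thesis
          by (intro bounded_op_onI[where B = "K * K'"])
            (auto simp: bounded_op_onD(1-3)[OF A] bounded_op_onD(1-3)[OF B])
      qed
      have fwd: "(\<lambda>v. v - z *\<^sub>C I v) w = N (I w) - z *\<^sub>C I w" if "w \<in> L" for w using NI that by simp
      have bNz: "bounded_op_on L (\<lambda>v. v - z *\<^sub>C I v)"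
      proof -
        obtain K where K: "0 < K" "\<forall>x\<in>L. norm (I x) \<le> K * norm x" using ID(4) by blast
        have "norm (v - z *\<^sub>C I v) \<le> (1 + cmod z * K) * norm v" if "v \<in> L" for v
        proof -
          have "norm (v - z *\<^sub>C I v) \<le> norm v + cmod z * norm (I v)"
            using norm_triangle_ineq4[of v "z *\<^sub>C I v"] by (simp add: norm_scaleC)
          also have "\<dots> \<le> norm v + cmod z * (K * norm v)"
            using K that by (intro add_left_mono mult_left_mono) auto
          finally show ?thesis by (simp add: algebra_simps)
        qed
        then show ?thesis
          by (intro bounded_op_onI[where B = "1 + cmod z * K"])
            (use LD ID(1) in \<open>auto simp: ID(2,3) scaleC_add_right scaleC_diff_right scaleC_scaleC mult.commute\<close>)
      qed
      show "invertible_op_on L (\<lambda>v. v - z *\<^sub>C I v)"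
        unfolding invertible_op_on_def
      proof (intro conjI exI[of _ "\<lambda>v. N (R v)"] bNz comp[OF b R] ballI)
        fix v assume v: "v \<in> L"
        have Rv: "R v \<in> L" using bounded_op_onD(1)[OF R v] .
        show "N (R v) - z *\<^sub>C I (N (R v)) = v" using IN[OF Rv] NR[OF v] by simp
        have "v - z *\<^sub>C I v = N (I v) - z *\<^sub>C I v" using NI[OF v] by simp
        then have "R (v - z *\<^sub>C I v) = I v" using RN[OF ID(1)[OF v]] by simp
        then show "N (R (v - z *\<^sub>C I v)) = v" using NI[OF v] by simp
      qed
    qed
    then show ?thesis using IN[OF x] by simp
  qed
qed

text \<open>
  With \<open>P = N\<^sup>* N\<close> the left-hand side is \<open>- \<langle>(1 - P) (P - r\<^sup>2) x, x\<rangle>\<close>, and the spectral bounds say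
  \<open>r\<^sup>2 \<le> P \<le> 1\<close>. The product of the two commuting non-negative factors is non-negative.
\<close>

lemma normal_alpha_form_nonneg:
  fixes N :: "'a::chilbert_space \<Rightarrow> 'a"
  assumes L: "closed_csubspace L" and N: "normal_on L N" and r: "0 < r" "r < 1"
    and spec: "spectrum_on L N \<subseteq> {z. cmod z = r} \<union> {z. cmod z = 1}" and x: "x \<in> L"
  shows "(norm (N (N x)))\<^sup>2 - (1 + r\<^sup>2) * (norm (N x))\<^sup>2 + r\<^sup>2 * (norm x)\<^sup>2 \<le> 0"
proof -
  note LD = csubspaceD[OF L]
  have b: "bounded_op_on L N" using N by (simp add: normal_on_def)
  note A = adjoint_on_works[OF L b]
  define P where "P v = adjoint_on L N (N v)" for v
  have PL: "P v \<in> L" if "v \<in> L" for v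
    unfolding P_def using bounded_op_onD(1)[OF A(1)] bounded_op_onD(1)[OF b] that by blast
  have form: "P v \<bullet> w = N v \<bullet> N w" if "v \<in> L" "w \<in> L" for v w
  proof -
    have "cinner (N w) (N v) = cinner w (P v)"
      unfolding P_def using A(2)[OF that(2)] bounded_op_onD(1)[OF b that(1)] by blast
    then show ?thesis by (metis inner_commute inner_eq_Re_cinner)
  qed
  have normP: "norm (P v) = norm (N (N v))" if "v \<in> L" for v
    unfolding P_def by (rule normal_on_norm_adjoint[OF L N]) (rule bounded_op_onD(1)[OF b that])
  define u where "u = x - P x"
  define v where "v = P x - r\<^sup>2 *\<^sub>R x"
  have uL: "u \<in> L" and vL: "v \<in> L" unfolding u_def v_def by (intro LD x PL)+
  have upper: "(norm (N v))\<^sup>2 \<le> (norm v)\<^sup>2"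
    using normal_spectrum_bounds(1)[OF L N r spec vL] by (simp add: power_mono)
  have lower: "r\<^sup>2 * (norm u)\<^sup>2 \<le> (norm (N u))\<^sup>2"
    using power_mono[OF normal_spectrum_bounds(2)[OF L N r spec uL], of 2] r by (simp add: power_mult_distrib)
  define q where "q = P (P x) \<bullet> P x"
  have Nlin: "N (s - t) = N s - N t" "N (c *\<^sub>R s) = c *\<^sub>R N s" if "s \<in> L" "t \<in> L" for s t c
    using bounded_op_on_diff[OF L b that] bounded_op_onD(3)[OF b that(1)] by (simp_all add: scaleR_scaleC)
  have PP: "N x \<bullet> N (P x) = P x \<bullet> P x" "N (P x) \<bullet> N (P x) = q" "N x \<bullet> N x = P x \<bullet> x"
    using form[OF x PL[OF x]] form[OF PL[OF x] PL[OF x]] form[OF x x] by (simp_all add: q_def)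
  have Nu: "(norm (N u))\<^sup>2 = P x \<bullet> x - 2 * (P x \<bullet> P x) + q"
    unfolding u_def power2_norm_eq_inner Nlin(1)[OF x PL[OF x]]
    by (simp add: inner_diff PP inner_commute[of "N (P x)" "N x"])
  have Nv: "(norm (N v))\<^sup>2 = q - 2 * r\<^sup>2 * (P x \<bullet> P x) + r\<^sup>2 * r\<^sup>2 * (P x \<bullet> x)"
    unfolding v_def power2_norm_eq_inner Nlin(1)[OF PL[OF x] LD(5)[OF x]] Nlin(2)[OF x x]
    by (simp add: inner_diff PP inner_commute[of "N (P x)" "N x"] algebra_simps)
  have nu: "(norm u)\<^sup>2 = (norm x)\<^sup>2 - 2 * (P x \<bullet> x) + P x \<bullet> P x"
    unfolding u_def power2_norm_eq_inner by (simp add: inner_diff inner_commute[of x "P x"])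
  have nv: "(norm v)\<^sup>2 = P x \<bullet> P x - 2 * r\<^sup>2 * (P x \<bullet> x) + r\<^sup>2 * r\<^sup>2 * (norm x)\<^sup>2"
    unfolding v_def power2_norm_eq_inner by (simp add: inner_diff inner_commute[of x "P x"] algebra_simps)
  \<comment> \<open>The two brackets are the forms of \<open>(1 - P) (P - r\<^sup>2) (1 - P)\<close> and \<open>(P - r\<^sup>2) (1 - P) (P - r\<^sup>2)\<close>,
    whose sum is \<open>(1 - r\<^sup>2) (1 - P) (P - r\<^sup>2)\<close> because \<open>(1 - P) + (P - r\<^sup>2) = 1 - r\<^sup>2\<close>.\<close>
  have "0 \<le> ((norm (N u))\<^sup>2 - r\<^sup>2 * (norm u)\<^sup>2) + ((norm v)\<^sup>2 - (norm (N v))\<^sup>2)"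
    using upper lower by simp
  also have "\<dots> = (1 - r\<^sup>2) * (- (P x \<bullet> P x) + (1 + r\<^sup>2) * (P x \<bullet> x) - r\<^sup>2 * (norm x)\<^sup>2)"
    unfolding Nu Nv nu nv by (simp add: algebra_simps)
  finally have prod: "0 \<le> (1 - r\<^sup>2) * (- (P x \<bullet> P x) + (1 + r\<^sup>2) * (P x \<bullet> x) - r\<^sup>2 * (norm x)\<^sup>2)" .
  have "0 < 1 - r\<^sup>2" using r by (simp add: power2_less_1_iff)
  then have "0 \<le> - (P x \<bullet> P x) + (1 + r\<^sup>2) * (P x \<bullet> x) - r\<^sup>2 * (norm x)\<^sup>2"
    using prod by (simp only: zero_le_mult_iff) linarith
  moreover have "P x \<bullet> x = (norm (N x))\<^sup>2" by (simp add: power2_norm_eq_inner PP)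
  moreover have "P x \<bullet> P x = (norm (N (N x)))\<^sup>2"
    by (simp add: power2_norm_eq_inner flip: normP[OF x])
  ultimately show ?thesis by simp
qed

section \<open>Laurent expansions\<close>

lemma has_sum_nonneg_ints_iff:
  fixes g :: "int \<Rightarrow> 'b::topological_comm_monoid_add"
  shows "(g has_sum s) {0..} \<longleftrightarrow> ((\<lambda>k. g (int k)) has_sum s) UNIV"
proof -
  have "{0..} = range int" by (auto dest: zero_le_imp_eq_int)
  then show ?thesis using has_sum_reindex[of int UNIV g s] by (simp add: comp_def)
qed

lemma has_sum_neg_ints_iff:
  fixes g :: "int \<Rightarrow> 'b::topological_comm_monoid_add"
  shows "(g has_sum s) {..-1} \<longleftrightarrow> ((\<lambda>k. g (- 1 - int k)) has_sum s) UNIV"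
proof -
  have "{..-1} = range (\<lambda>k. - 1 - int k)"
  proof (intro equalityI subsetI)
    fix n :: int assume "n \<in> {..-1}"
    then have "n = - 1 - int (nat (- 1 - n))" by simp
    then show "n \<in> range (\<lambda>k. - 1 - int k)" by blast
  qed auto
  moreover have "inj (\<lambda>k. - 1 - int k)" by (auto simp: inj_on_def)
  ultimately show ?thesis using has_sum_reindex[of "\<lambda>k. - 1 - int k" UNIV g s] by (simp add: comp_def)
qed

lemma has_sum_shift_nonneg_ints:
  fixes g :: "int \<Rightarrow> 'b::topological_comm_monoid_add"
  assumes "(g has_sum s) {0..}"
  shows "((\<lambda>n. if n = 0 then a else g (n - 1)) has_sum (a + s)) {0..}"
proof -
  have im: "{1..} = (\<lambda>n::int. n + 1) ` {0..}"
  proof (intro equalityI subsetI)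
    fix n :: int assume "n \<in> {1..}"
    then have "n = (n - 1) + 1" "n - 1 \<in> {0..}" by auto
    then show "n \<in> (\<lambda>n. n + 1) ` {0..}" by blast
  qed auto
  have "((\<lambda>n. g (n - 1)) has_sum s) {1..}"
    unfolding im using assms by (subst has_sum_reindex) (auto simp: comp_def inj_on_def)
  then have "((\<lambda>n. if n = 0 then a else g (n - 1)) has_sum s) {1..}"
    by (rule has_sum_cong[THEN iffD1, rotated]) auto
  from has_sum_insert[OF _ this, of 0] have
    "((\<lambda>n. if n = 0 then a else g (n - 1)) has_sum (a + s)) (insert 0 {1..})" by simp
  moreover have "insert 0 {1..} = {0::int..}" by auto
  ultimately show ?thesis by simp
qed

lemma has_sum_shift_neg_ints:
  fixes g :: "int \<Rightarrow> 'b::{topological_ab_group_add, t2_space}"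
  assumes "(g has_sum s) {..-1}"
  shows "((\<lambda>n. g (n - 1)) has_sum (s - g (- 1))) {..-1}"
proof -
  have "((\<lambda>n. if n = - 1 then - g (- 1) else 0) has_sum (- g (- 1))) {- 1}"
    by (rule has_sum_finiteI) simp_all
  then have "((\<lambda>n. if n = - 1 then - g (- 1) else 0) has_sum (- g (- 1))) {..-1::int}"
    by (rule has_sum_cong_neutral[THEN iffD1, rotated -1]) auto
  from has_sum_add[OF assms this]
  have "((\<lambda>n. g n + (if n = - 1 then - g (- 1) else 0)) has_sum (s - g (- 1))) {..-1}" by simp
  then have "(g has_sum (s - g (- 1))) {..-2}"
  proof (rule has_sum_cong_neutral[THEN iffD1, rotated -1])
    show "g n + (if n = - 1 then - g (- 1) else 0) = 0" if "n \<in> {..-1} - {..-2}" for n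
    proof -
      have "n = - 1" using that by simp
      then show ?thesis by simp
    qed
  qed auto
  moreover have im: "{..-2} = (\<lambda>n::int. n - 1) ` {..-1}"
  proof (intro equalityI subsetI)
    fix n :: int assume "n \<in> {..-2}"
    then have "n = (n + 1) - 1" "n + 1 \<in> {..-1}" by auto
    then show "n \<in> (\<lambda>n. n - 1) ` {..-1}" by blast
  qed auto
  ultimately show ?thesis
    by (simp add: im has_sum_reindex inj_on_def comp_def)
qed

text \<open>
  The point \<open>w = 0\<close> is left out because for the expansion in \<open>1 / z\<close> it corresponds to \<open>z = \<infinity>\<close>. The
  coefficients are recovered one after the other as limits at \<open>0\<close>.
\<close>

lemma powser_coeffs_zero:
  fixes a :: "nat \<Rightarrow> complex"
  assumes s: "0 < s" and sums: "\<And>w. w \<noteq> 0 \<Longrightarrow> norm w < s \<Longrightarrow> (\<lambda>n. a n * w ^ n) sums 0"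
  shows "a n = 0"
proof (induction n rule: less_induct)
  case (less n)
  have "(\<lambda>k. a (k + n) * w ^ k) sums 0" if w: "w \<noteq> 0" "norm w < s" for w
  proof -
    have "(\<lambda>k. a (k + n) * w ^ (k + n)) sums 0"
      using sums_split_initial_segment[OF sums[OF w], of n] less by simp
    from sums_mult[OF this, of "inverse (w ^ n)"] show ?thesis
      using w by (simp add: power_add field_simps)
  qed
  from powser_limit_0_strong[OF s this] have "((\<lambda>x::complex. 0::complex) \<longlongrightarrow> a n) (at 0)" by simp
  then show ?case by (simp add: tendsto_const_iff)
qed

text \<open>
  Paired with a fixed vector, the difference of two expansions is a scalar power series in \<open>z\<close> near
  \<open>0\<close> and in \<open>1 / z\<close> near \<open>\<infinity>\<close>; pairing with \<open>c n - d n\<close> itself isolates the \<open>n\<close>-th coefficient.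
\<close>

lemma laurent_rep_coeff_unique:
  fixes f :: "complex \<Rightarrow> 'e::chilbert_space"
  assumes r: "0 < r" and c: "laurent_rep r f c" and d: "laurent_rep r f d"
  shows "c = d"
proof
  fix n
  define y where "y = c n - d n"
  define e where "e m = cinner (c m - d m) y" for m
  have bl: "bounded_linear (\<lambda>x. cinner x y)"
    by (rule bounded_bilinear.bounded_linear_left[OF bounded_bilinear_cinner])
  have diff: "((\<lambda>m. z powi m * e m) has_sum 0) A"
    if "((\<lambda>m. (z powi m) *\<^sub>C c m) has_sum f z) A" "((\<lambda>m. (z powi m) *\<^sub>C d m) has_sum f z) A" for z A
  proof -
    have "((\<lambda>m. - ((z powi m) *\<^sub>C d m)) has_sum - f z) A" using that(2) by (simp add: has_sum_uminus)
    from has_sum_bounded_linear[OF bl has_sum_add[OF that(1) this]]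
    show ?thesis by (simp add: e_def cinner_linear right_diff_distrib)
  qed
  have "e n = 0"
  proof (cases "0 \<le> n")
    case True
    have "(\<lambda>k. e (int k) * z ^ k) sums 0" if "cmod z < r" for z
      using diff[of z "{0..}"] c d that has_sum_imp_sums[of "\<lambda>k. z powi (int k) * e (int k)" 0]
      by (auto simp: laurent_rep_def has_sum_nonneg_ints_iff mult.commute)
    then have "e (int (nat n)) = 0" by (intro powser_coeffs_zero[OF r]) auto
    then show ?thesis using True by simp
  next
    case False
    have "(\<lambda>k. e (- 1 - int k) * w ^ k) sums 0" if w: "w \<noteq> 0" "cmod w < 1" for w
    proof -
      have "1 < cmod (inverse w)" using w by (simp add: norm_inverse one_less_inverse)
      then have "((\<lambda>m. (inverse w) powi m * e m) has_sum 0) {..-1}"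
        using diff c d unfolding laurent_rep_def by blast
      then have "(\<lambda>k. (inverse w) powi (- 1 - int k) * e (- 1 - int k)) sums 0"
        unfolding has_sum_neg_ints_iff by (rule has_sum_imp_sums)
      moreover have "(inverse w) powi (- 1 - int k) = w * w ^ k" for k
      proof -
        have "- 1 - int k = - int (Suc k)" by simp
        then have "(inverse w) powi (- 1 - int k) = inverse (inverse w ^ Suc k)"
          by (simp only: power_int_minus power_int_of_nat)
        then show ?thesis by (simp add: power_inverse)
      qed
      ultimately have "(\<lambda>k. (w * w ^ k) * e (- 1 - int k)) sums 0" by simp
      from sums_mult[OF this, of "inverse w"] show ?thesis using w by (simp add: field_simps)
    qed
    then have "e (- 1 - int (nat (- 1 - n))) = 0" by (intro powser_coeffs_zero[OF zero_less_one]) auto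
    then show ?thesis using False by simp
  qed
  then show "c n = d n" by (simp add: e_def y_def cinner_self)
qed

lemma laurent_coeff_eq:
  assumes "0 < r" "laurent_rep r f c"
  shows "laurent_coeff r f = c"
  unfolding laurent_coeff_def using assms laurent_rep_coeff_unique by blast

lemma laurent_rep_fun_unique:
  assumes "laurent_rep r f c" "laurent_rep r g c"
  shows "f = g"
proof
  fix z
  consider "cmod z < r" | "1 < cmod z" | "z \<notin> annulus_compl r"
    unfolding annulus_compl_def by (auto simp: not_le)
  then show "f z = g z"
  proof cases
    case 1
    then show ?thesis
      using assms has_sum_unique[of "\<lambda>n. (z powi n) *\<^sub>C c n" "{0..}" "f z" "g z"]
      unfolding laurent_rep_def by blast
  next
    case 2
    then show ?thesis
      using assms has_sum_unique[of "\<lambda>n. (z powi n) *\<^sub>C c n" "{..-1}" "f z" "g z"]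
      unfolding laurent_rep_def by blast
  next
    case 3
    then show ?thesis using assms unfolding laurent_rep_def by simp
  qed
qed

lemma laurent_rep_add:
  assumes "laurent_rep r f c" "laurent_rep r g d"
  shows "laurent_rep r (f + g) (\<lambda>n. c n + d n)"
  using assms unfolding laurent_rep_def by (auto simp: scaleC_add_right intro!: has_sum_add)

lemma laurent_rep_scaleC:
  fixes f :: "complex \<Rightarrow> 'e::chilbert_space"
  assumes "laurent_rep r f c"
  shows "laurent_rep r (a *\<^sub>C f) (\<lambda>n. a *\<^sub>C c n)"
proof -
  have "((\<lambda>n. (z powi n) *\<^sub>C a *\<^sub>C c n) has_sum a *\<^sub>C f z) A"
    if "((\<lambda>n. (z powi n) *\<^sub>C c n) has_sum f z) A" for z A
    using has_sum_bounded_linear[OF bounded_linear_scaleC that, of a]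
    by (simp add: scaleC_scaleC mult.commute)
  then show ?thesis using assms unfolding laurent_rep_def by (auto simp: scaleC_fun_def)
qed

section \<open>The space \<open>H\<^sup>2\<^sub>r(\<bbbB>, E)\<close>\<close>

text \<open>
  The values of the two sums in the square norm are carried along, because the effect of \<open>M\<^sub>z\<^sup>t\<close> on the
  norm is linear in them and in the square norm of one coefficient.
\<close>

definition H2r_rep ::
    "real \<Rightarrow> (complex \<Rightarrow> 'e::chilbert_space) \<Rightarrow> (int \<Rightarrow> 'e) \<Rightarrow> real \<Rightarrow> real \<Rightarrow> bool" where
  "H2r_rep r f c P Q \<longleftrightarrow> laurent_rep r f c \<and>
     ((\<lambda>n. r powi (2 * n) * (norm (c n))\<^sup>2) has_sum P) {0..} \<and>
     ((\<lambda>n. (norm (c n))\<^sup>2) has_sum Q) {..-1}"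

lemma H2r_iff_rep: "f \<in> H2r r E \<longleftrightarrow> (\<exists>c P Q. range c \<subseteq> E \<and> H2r_rep r f c P Q)"
  unfolding H2r_def H2r_rep_def summable_on_def by blast

lemma H2r_rep_nonneg:
  assumes "H2r_rep r f c P Q"
  shows "0 \<le> P" "0 \<le> Q"
  using assms unfolding H2r_rep_def
  by (auto intro: has_sum_nonneg[where M = "{0..}"] has_sum_nonneg[where M = "{..-1}"] simp: power_int_mult)

lemma H2r_norm_eq:
  assumes r: "0 < r" "r < 1" and f: "H2r_rep r f c P Q"
  shows "(H2r_norm r f)\<^sup>2 = (P + Q) / (1 - r\<^sup>2)"
proof -
  have "laurent_coeff r f = c" using f r by (simp add: H2r_rep_def laurent_coeff_eq)
  moreover have "(\<Sum>\<^sub>\<infinity>n\<in>{0..}. r powi (2 * n) * (norm (c n))\<^sup>2) = P"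
    "(\<Sum>\<^sub>\<infinity>n\<in>{..-1}. (norm (c n))\<^sup>2) = Q"
    using f by (auto simp: H2r_rep_def intro: infsumI)
  moreover have "0 < 1 - r\<^sup>2" using r by (simp add: power2_less_1_iff)
  ultimately show ?thesis
    using H2r_rep_nonneg[OF f] by (simp add: H2r_norm_def add_divide_distrib)
qed

lemma H2r_rep_coeff_le:
  assumes r: "0 < r" and f: "((\<lambda>n. r powi (2 * n) * (norm (c n))\<^sup>2) has_sum P) {0..}"
    "((\<lambda>n. (norm (c n))\<^sup>2) has_sum Q) {..-1}"
  shows "r ^ k * norm (c (int k)) \<le> sqrt P" and "norm (c (- 1 - int k)) \<le> sqrt Q"
proof -
  have "(\<Sum>n\<in>{int k}. r powi (2 * n) * (norm (c n))\<^sup>2) \<le> P"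
    by (rule finite_sum_le_has_sum[OF f(1)]) (use r in auto)
  moreover have "r powi (2 * int k) * (norm (c (int k)))\<^sup>2 = (r ^ k * norm (c (int k)))\<^sup>2"
    by (simp add: power_int_mult power_mult_distrib flip: power_mult)
      (simp add: mult.commute flip: power_mult)
  ultimately have "(r ^ k * norm (c (int k)))\<^sup>2 \<le> P" by simp
  then show "r ^ k * norm (c (int k)) \<le> sqrt P" by (rule real_le_rsqrt)
  have "(\<Sum>n\<in>{- 1 - int k}. (norm (c n))\<^sup>2) \<le> Q"
    by (rule finite_sum_le_has_sum[OF f(2)]) auto
  then show "norm (c (- 1 - int k)) \<le> sqrt Q" by (intro real_le_rsqrt) simp
qed

text \<open>
  Weighted square summability bounds the coefficients, so both expansions are dominated by geometric
  series and every admissible coefficient sequence is that of a function.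
\<close>

lemma H2r_synthesis:
  fixes c :: "int \<Rightarrow> 'e::chilbert_space"
  assumes r: "0 < r" "r < 1"
    and c: "((\<lambda>n. r powi (2 * n) * (norm (c n))\<^sup>2) has_sum P) {0..}"
    "((\<lambda>n. (norm (c n))\<^sup>2) has_sum Q) {..-1}"
  shows "\<exists>f. H2r_rep r f c P Q"
proof -
  define f where "f z = (if cmod z < r then \<Sum>\<^sub>\<infinity>n\<in>{0..}. (z powi n) *\<^sub>C c n
    else if 1 < cmod z then \<Sum>\<^sub>\<infinity>n\<in>{..-1}. (z powi n) *\<^sub>C c n else 0)" for z
  have inner: "(\<lambda>n. (z powi n) *\<^sub>C c n) summable_on {0..}" if z: "cmod z < r" for z
  proof -
    have "summable (\<lambda>k. norm ((z powi int k) *\<^sub>C c (int k)))"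
    proof (rule summable_comparison_test')
      show "summable (\<lambda>k. (cmod z / r) ^ k * sqrt P)"
        using z r by (intro summable_mult2 summable_geometric) simp
      fix k :: nat assume "k \<ge> 0"
      have "norm ((z powi int k) *\<^sub>C c (int k)) = (cmod z / r) ^ k * (r ^ k * norm (c (int k)))"
        using r by (simp add: norm_scaleC norm_power power_divide)
      also have "\<dots> \<le> (cmod z / r) ^ k * sqrt P"
        using H2r_rep_coeff_le(1)[OF r(1) c] r by (intro mult_left_mono) auto
      finally show "norm (norm ((z powi int k) *\<^sub>C c (int k))) \<le> (cmod z / r) ^ k * sqrt P" by simp
    qed
    from has_sum_infsum[OF norm_summable_imp_summable_on[OF this]] show ?thesis
      by (intro has_sum_imp_summable[OF iffD2[OF has_sum_nonneg_ints_iff[of "\<lambda>n. (z powi n) *\<^sub>C c n"]]])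
  qed
  have outer: "(\<lambda>n. (z powi n) *\<^sub>C c n) summable_on {..-1}" if z: "1 < cmod z" for z
  proof -
    have "summable (\<lambda>k. norm ((z powi (- 1 - int k)) *\<^sub>C c (- 1 - int k)))"
    proof (rule summable_comparison_test')
      show "summable (\<lambda>k. (1 / cmod z) ^ k * (1 / cmod z * sqrt Q))"
        using z by (intro summable_mult2 summable_geometric) (simp add: divide_less_eq)
      fix k :: nat assume "k \<ge> 0"
      have "- 1 - int k = - int (Suc k)" by simp
      then have "cmod (z powi (- 1 - int k)) = inverse (cmod z ^ Suc k)"
        by (simp only: power_int_minus norm_inverse power_int_of_nat norm_power)
      then have pow: "cmod (z powi (- 1 - int k)) = (1 / cmod z) ^ Suc k"
        by (simp only: power_one_over inverse_eq_divide)
      have "norm ((z powi (- 1 - int k)) *\<^sub>C c (- 1 - int k))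
          = (1 / cmod z) ^ Suc k * norm (c (- 1 - int k))"
        unfolding norm_scaleC pow ..
      also have "\<dots> \<le> (1 / cmod z) ^ Suc k * sqrt Q"
        using H2r_rep_coeff_le(2)[OF r(1) c, of k] by (rule mult_left_mono) simp
      also have "\<dots> = (1 / cmod z) ^ k * (1 / cmod z * sqrt Q)"
        by (simp only: power_Suc mult_ac)
      finally show "norm (norm ((z powi (- 1 - int k)) *\<^sub>C c (- 1 - int k)))
          \<le> (1 / cmod z) ^ k * (1 / cmod z * sqrt Q)" by (simp only: real_norm_def abs_norm_cancel)
    qed
    from has_sum_infsum[OF norm_summable_imp_summable_on[OF this]] show ?thesis
      by (intro has_sum_imp_summable[OF iffD2[OF has_sum_neg_ints_iff[of "\<lambda>n. (z powi n) *\<^sub>C c n"]]])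
  qed
  have "laurent_rep r f c"
    unfolding laurent_rep_def using inner outer r
    by (auto simp: f_def annulus_compl_def intro!: has_sum_infsum)
  then show ?thesis using c unfolding H2r_rep_def by blast
qed

text \<open>
  The parallelogram law holds term by term and yields a triangle inequality with a constant, which is
  enough for the limit arguments below.
\<close>

lemma H2r_rep_diff:
  fixes f g :: "complex \<Rightarrow> 'e::chilbert_space"
  assumes r: "0 < r" and f: "H2r_rep r f c P Q" and g: "H2r_rep r g d P' Q'"
  shows "\<exists>P'' Q''. H2r_rep r (f - g) (\<lambda>n. c n - d n) P'' Q'' \<and>
    P'' + Q'' \<le> 2 * (P + Q) + 2 * (P' + Q')"
proof -
  have le: "(norm (x - y))\<^sup>2 \<le> 2 * (norm x)\<^sup>2 + 2 * (norm y)\<^sup>2" for x y :: 'e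
  proof -
    have "(norm (x - y))\<^sup>2 + (norm (x + y))\<^sup>2 = 2 * (norm x)\<^sup>2 + 2 * (norm y)\<^sup>2"
      by (simp add: power2_norm_eq_inner inner_add inner_diff inner_commute)
    then show ?thesis using zero_le_power2[of "norm (x + y)"] by linarith
  qed
  let ?w = "\<lambda>n. r powi (2 * n)"
  have 1: "((\<lambda>n. 2 * (?w n * (norm (c n))\<^sup>2) + 2 * (?w n * (norm (d n))\<^sup>2)) has_sum (2 * P + 2 * P')) {0..}"
    using f g unfolding H2r_rep_def by (intro has_sum_add has_sum_cmult_right) auto
  have 2: "((\<lambda>n. 2 * (norm (c n))\<^sup>2 + 2 * (norm (d n))\<^sup>2) has_sum (2 * Q + 2 * Q')) {..-1}"
    using f g unfolding H2r_rep_def by (intro has_sum_add has_sum_cmult_right) auto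
  have le1: "?w n * (norm (c n - d n))\<^sup>2 \<le> 2 * (?w n * (norm (c n))\<^sup>2) + 2 * (?w n * (norm (d n))\<^sup>2)" for n
  proof -
    have "?w n * (norm (c n - d n))\<^sup>2 \<le> ?w n * (2 * (norm (c n))\<^sup>2 + 2 * (norm (d n))\<^sup>2)"
      using r le by (intro mult_left_mono) auto
    then show ?thesis by (simp add: algebra_simps)
  qed
  have "(\<lambda>n. ?w n * (norm (c n - d n))\<^sup>2) summable_on {0..}"
    by (rule summable_on_comparison_test[OF has_sum_imp_summable[OF 1] le1]) (use r in simp)
  then obtain P'' where P'': "((\<lambda>n. ?w n * (norm (c n - d n))\<^sup>2) has_sum P'') {0..}"
    unfolding summable_on_def by blast
  have "(\<lambda>n. (norm (c n - d n))\<^sup>2) summable_on {..-1}"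
    by (rule summable_on_comparison_test[OF has_sum_imp_summable[OF 2] le]) simp
  then obtain Q'' where Q'': "((\<lambda>n. (norm (c n - d n))\<^sup>2) has_sum Q'') {..-1}"
    unfolding summable_on_def by blast
  have "laurent_rep r (f - g) (\<lambda>n. c n - d n)"
  proof -
    have "laurent_rep r (f + (- 1) *\<^sub>C g) (\<lambda>n. c n + (- 1) *\<^sub>C d n)"
      using f g unfolding H2r_rep_def by (intro laurent_rep_add laurent_rep_scaleC) auto
    moreover have "(- 1) *\<^sub>C v = - v" for v :: 'e
      using complex_vector.scale_minus_left[of 1 v] by (simp add: scaleC_one)
    ultimately show ?thesis by (simp add: scaleC_fun_def fun_diff_def plus_fun_def)
  qed
  moreover have "P'' \<le> 2 * P + 2 * P'" by (rule has_sum_mono[OF P'' 1 le1])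
  moreover have "Q'' \<le> 2 * Q + 2 * Q'" by (rule has_sum_mono[OF Q'' 2 le])
  ultimately show ?thesis using P'' Q'' unfolding H2r_rep_def
    by (intro exI[of _ P''] exI[of _ Q'']) auto
qed

lemma H2r_rep_zero:
  assumes r: "0 < r" and f: "H2r_rep r f c P Q" and z: "P = 0" "Q = 0"
  shows "f = 0"
proof -
  have "c n = 0" for n
  proof (cases "0 \<le> n")
    case True
    have "r powi (2 * n) * (norm (c n))\<^sup>2 = 0"
      by (rule nonneg_has_sum_le_0D[where A = "{0..}" and a = P])
        (use f z True r in \<open>auto simp: H2r_rep_def\<close>)
    then show ?thesis using r by simp
  next
    case False
    have "(norm (c n))\<^sup>2 = 0"
      by (rule nonneg_has_sum_le_0D[where A = "{..-1}" and a = Q])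
        (use f z False in \<open>auto simp: H2r_rep_def\<close>)
    then show ?thesis by simp
  qed
  then have "c = (\<lambda>_. 0)" by auto
  then have "laurent_rep r f (\<lambda>_. 0)" using f by (simp add: H2r_rep_def)
  moreover have "laurent_rep r (0 :: complex \<Rightarrow> 'a) (\<lambda>_. 0)" by (simp add: laurent_rep_def)
  ultimately show ?thesis by (rule laurent_rep_fun_unique)
qed

text \<open>\<open>M\<^sub>z\<^sup>t\<close> shifts the coefficients and flips the sign of the one that crosses from \<open>-1\<close> to \<open>0\<close>.\<close>

definition mzt_coeffs :: "(int \<Rightarrow> 'e::ab_group_add) \<Rightarrow> int \<Rightarrow> 'e" where
  "mzt_coeffs c n = (if n = 0 then - c (- 1) else c (n - 1))"

text \<open>
  \<open>w f(w)\<close> is a power series in \<open>1 / w\<close> with constant term \<open>c\<^sub>-\<^sub>1\<close> and coefficients bounded by \<open>\<surd>Q\<close>.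
\<close>

lemma H2r_rep_limit_at_infinity:
  fixes f :: "complex \<Rightarrow> 'e::chilbert_space"
  assumes r: "0 < r" and f: "H2r_rep r f c P Q"
  shows "Lim at_infinity (\<lambda>w. w *\<^sub>C f w) = c (- 1)"
proof (rule tendsto_Lim)
  have "((\<lambda>w. w *\<^sub>C f w - c (- 1)) \<longlongrightarrow> 0) at_infinity"
  proof (rule Lim_null_comparison)
    have "norm (w *\<^sub>C f w - c (- 1)) \<le> norm (inverse w) * (2 * sqrt Q)" if w: "2 \<le> norm w" for w
    proof -
      define u where "u = inverse w"
      have u: "cmod u \<le> 1/2" "u \<noteq> 0" "w * u = 1"
        using w le_imp_inverse_le[OF w] by (auto simp: u_def norm_inverse intro!: right_inverse)
      have "((\<lambda>n. (w powi n) *\<^sub>C c n) has_sum f w) {..-1}"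
        using f w unfolding H2r_rep_def laurent_rep_def by auto
      then have "((\<lambda>n. w *\<^sub>C (w powi n) *\<^sub>C c n) has_sum w *\<^sub>C f w) {..-1}"
        by (rule has_sum_bounded_linear[OF bounded_linear_scaleC])
      then have "(\<lambda>k. w *\<^sub>C (w powi (- 1 - int k)) *\<^sub>C c (- 1 - int k)) sums (w *\<^sub>C f w)"
        unfolding has_sum_neg_ints_iff by (rule has_sum_imp_sums)
      moreover have "w * w powi (- 1 - int k) = u ^ k" for k
      proof -
        have "- 1 - int k = - int (Suc k)" by simp
        then have "w powi (- 1 - int k) = u * u ^ k"
          by (simp only: power_int_minus power_int_of_nat) (simp add: u_def power_inverse)
        then show ?thesis using u by (simp flip: mult.assoc)
      qed
      ultimately have "(\<lambda>k. u ^ k *\<^sub>C c (- 1 - int k)) sums (w *\<^sub>C f w)"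
        by (simp add: scaleC_scaleC)
      from sums_split_initial_segment[OF this, of 1]
      have tail: "(\<lambda>k. u ^ Suc k *\<^sub>C c (- 1 - int (Suc k))) sums (w *\<^sub>C f w - c (- 1))"
        by (simp add: scaleC_one)
      have geo: "(\<lambda>k. (1/2) ^ k * (cmod u * sqrt Q)) sums (2 * (cmod u * sqrt Q))"
        using sums_mult2[OF geometric_sums[of "1/2::real"]] by simp
      have "norm (w *\<^sub>C f w - c (- 1)) \<le> 2 * (cmod u * sqrt Q)"
      proof (rule norm_sums_le[OF tail geo])
        fix k
        have "norm (u ^ Suc k *\<^sub>C c (- 1 - int (Suc k))) = cmod u ^ k * (cmod u * norm (c (- 1 - int (Suc k))))"
          by (simp only: norm_scaleC norm_power power_Suc norm_mult mult_ac)
        also have "\<dots> \<le> (1/2) ^ k * (cmod u * sqrt Q)"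
          using u H2r_rep_coeff_le(2)[OF r, of c P Q "Suc k"] f unfolding H2r_rep_def
          by (intro mult_mono power_mono mult_nonneg_nonneg) auto
        finally show "norm (u ^ Suc k *\<^sub>C c (- 1 - int (Suc k))) \<le> (1/2) ^ k * (cmod u * sqrt Q)" .
      qed
      then show ?thesis by (simp add: u_def)
    qed
    then show "\<forall>\<^sub>F w in at_infinity. norm (w *\<^sub>C f w - c (- 1)) \<le> norm (inverse w) * (2 * sqrt Q)"
      unfolding eventually_at_infinity by blast
    show "((\<lambda>w::complex. norm (inverse w) * (2 * sqrt Q)) \<longlongrightarrow> 0) at_infinity"
      by (intro tendsto_mult_left_zero tendsto_norm_zero tendsto_inverse_0)
  qed
  then show "((\<lambda>w. w *\<^sub>C f w) \<longlongrightarrow> c (- 1)) at_infinity" by (rule LIM_zero_cancel)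
qed (rule trivial_limit_at_infinity)

text \<open>
  Only the coefficient \<open>c\<^sub>-\<^sub>1\<close> changes sides, so its square norm moves from the second sum to the first,
  while the old first sum picks up the weight \<open>r\<^sup>2\<close>.
\<close>

lemma H2r_rep_Mzt:
  fixes f :: "complex \<Rightarrow> 'e::chilbert_space"
  assumes r: "0 < r" "r < 1" and f: "H2r_rep r f c P Q"
  shows "H2r_rep r (Mzt r f) (mzt_coeffs c)
    ((norm (c (- 1)))\<^sup>2 + r\<^sup>2 * P) (Q - (norm (c (- 1)))\<^sup>2)"
  unfolding H2r_rep_def
proof (intro conjI)
  have P: "((\<lambda>n. r powi (2 * n) * (norm (c n))\<^sup>2) has_sum P) {0..}"
    and Q: "((\<lambda>n. (norm (c n))\<^sup>2) has_sum Q) {..-1}" and c: "laurent_rep r f c"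
    using f by (auto simp: H2r_rep_def)
  note lim = H2r_rep_limit_at_infinity[OF r(1) f]
  show "laurent_rep r (Mzt r f) (mzt_coeffs c)"
    unfolding laurent_rep_def
  proof (intro conjI allI impI)
    fix z assume z: "cmod z < r"
    have "((\<lambda>n. z *\<^sub>C (z powi n) *\<^sub>C c n) has_sum z *\<^sub>C f z) {0..}"
      using c z unfolding laurent_rep_def by (intro has_sum_bounded_linear[OF bounded_linear_scaleC]) auto
    from has_sum_shift_nonneg_ints[OF this, of "- c (- 1)"]
    have "((\<lambda>n. if n = 0 then - c (- 1) else z *\<^sub>C (z powi (n - 1)) *\<^sub>C c (n - 1)) has_sum Mzt r f z) {0..}"
      using z r by (simp add: Mzt_def annulus_compl_def lim)
    then show "((\<lambda>n. (z powi n) *\<^sub>C mzt_coeffs c n) has_sum Mzt r f z) {0..}"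
    proof (rule has_sum_cong[THEN iffD1, rotated])
      fix n :: int assume n: "n \<in> {0..}"
      show "(if n = 0 then - c (- 1) else z *\<^sub>C (z powi (n - 1)) *\<^sub>C c (n - 1)) = (z powi n) *\<^sub>C mzt_coeffs c n"
      proof (cases "n = 0")
        case False
        then have "z powi n = z * z powi (n - 1)"
          using power_int_add_1'[of z "n - 1"] n by simp
        then show ?thesis using False by (simp add: mzt_coeffs_def scaleC_scaleC)
      qed (simp add: mzt_coeffs_def scaleC_one)
    qed
  next
    fix z assume z: "1 < cmod z"
    have "((\<lambda>n. z *\<^sub>C (z powi n) *\<^sub>C c n) has_sum z *\<^sub>C f z) {..-1}"
      using c z unfolding laurent_rep_def by (intro has_sum_bounded_linear[OF bounded_linear_scaleC]) auto
    from has_sum_shift_neg_ints[OF this]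
    have "((\<lambda>n. z *\<^sub>C (z powi (n - 1)) *\<^sub>C c (n - 1)) has_sum Mzt r f z) {..-1}"
      using z by (cases "z = 0") (auto simp: Mzt_def annulus_compl_def lim scaleC_scaleC power_int_minus scaleC_one)
    then show "((\<lambda>n. (z powi n) *\<^sub>C mzt_coeffs c n) has_sum Mzt r f z) {..-1}"
    proof (rule has_sum_cong[THEN iffD1, rotated])
      fix n :: int assume n: "n \<in> {..-1}"
      have "z powi n = z * z powi (n - 1)"
        using power_int_add_1'[of z "n - 1"] z by force
      then show "z *\<^sub>C (z powi (n - 1)) *\<^sub>C c (n - 1) = (z powi n) *\<^sub>C mzt_coeffs c n"
        using n by (simp add: mzt_coeffs_def scaleC_scaleC)
    qed
  next
    fix z assume "z \<notin> annulus_compl r"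
    then show "Mzt r f z = 0" by (simp add: Mzt_def)
  qed
  have "((\<lambda>n. r\<^sup>2 * (r powi (2 * n) * (norm (c n))\<^sup>2)) has_sum r\<^sup>2 * P) {0..}"
    using P by (rule has_sum_cmult_right)
  from has_sum_shift_nonneg_ints[OF this, of "(norm (c (- 1)))\<^sup>2"]
  show "((\<lambda>n. r powi (2 * n) * (norm (mzt_coeffs c n))\<^sup>2) has_sum ((norm (c (- 1)))\<^sup>2 + r\<^sup>2 * P)) {0..}"
  proof (rule has_sum_cong[THEN iffD1, rotated])
    fix n :: int
    have "r powi (2 * n) = r\<^sup>2 * r powi (2 * (n - 1))"
      using r power_int_add[of r 2 "2 * (n - 1)"] by (simp add: algebra_simps)
    then show "(if n = 0 then (norm (c (- 1)))\<^sup>2 else r\<^sup>2 * (r powi (2 * (n - 1)) * (norm (c (n - 1)))\<^sup>2))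
        = r powi (2 * n) * (norm (mzt_coeffs c n))\<^sup>2"
      by (cases "n = 0") (simp_all add: mzt_coeffs_def)
  qed
  show "((\<lambda>n. (norm (mzt_coeffs c n))\<^sup>2) has_sum (Q - (norm (c (- 1)))\<^sup>2)) {..-1}"
    by (rule has_sum_cong[THEN iffD1, OF _ has_sum_shift_neg_ints[OF Q]]) (auto simp: mzt_coeffs_def)
qed

text \<open>
  By the rule for the two sums, the left-hand side equals \<open>- \<parallel>f\<^sub>-\<^sub>1\<parallel>\<^sup>2\<close>.
\<close>

lemma Mzt_alpha_form:
  assumes r: "0 < r" "r < 1" and f: "f \<in> H2r r E"
  shows "(H2r_norm r (Mzt r (Mzt r f)))\<^sup>2 - (1 + r\<^sup>2) * (H2r_norm r (Mzt r f))\<^sup>2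
    + r\<^sup>2 * (H2r_norm r f)\<^sup>2 \<le> 0"
proof -
  obtain c P Q where 0: "H2r_rep r f c P Q" using f H2r_iff_rep by blast
  note 1 = H2r_rep_Mzt[OF r 0]
  note 2 = H2r_rep_Mzt[OF r 1]
  have pos: "0 < 1 - r\<^sup>2" using r by (simp add: power2_less_1_iff)
  define s where "s = r\<^sup>2"
  define p where "p = (norm (c (- 1)))\<^sup>2"
  define q where "q = (norm (mzt_coeffs c (- 1)))\<^sup>2"
  have "(q + s * (p + s * P) + (Q - p - q)) / (1 - s) - (1 + s) * ((p + s * P + (Q - p)) / (1 - s))
      + s * ((P + Q) / (1 - s))
    = ((q + s * (p + s * P) + (Q - p - q)) - (1 + s) * (p + s * P + (Q - p)) + s * (P + Q)) / (1 - s)"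
    unfolding times_divide_eq_right add_divide_distrib[symmetric] diff_divide_distrib[symmetric] ..
  also have "(q + s * (p + s * P) + (Q - p - q)) - (1 + s) * (p + s * P + (Q - p)) + s * (P + Q)
      = - (p * (1 - s))"
    by (simp add: algebra_simps)
  also have "- (p * (1 - s)) / (1 - s) \<le> 0" using pos by (simp add: s_def p_def)
  finally show ?thesis
    unfolding H2r_norm_eq[OF r 0] H2r_norm_eq[OF r 1] H2r_norm_eq[OF r 2] s_def p_def q_def .
qed

section \<open>Positivity of \<open>\<alpha>(T\<^sup>*, T)\<close> for parts of the model\<close>

lemma bounded_op_on_UNIV_iff:
  "bounded_op_on UNIV A \<longleftrightarrow> bounded_linear A \<and> (\<forall>c x. A (c *\<^sub>C x) = c *\<^sub>C A x)"
proof (intro iffI conjI)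
  assume "bounded_op_on UNIV A"
  then show "bounded_linear A" "\<forall>c x. A (c *\<^sub>C x) = c *\<^sub>C A x"
    by (auto simp: bounded_op_on_imp_bounded_linear bounded_op_onD)
next
  assume A: "bounded_linear A \<and> (\<forall>c x. A (c *\<^sub>C x) = c *\<^sub>C A x)"
  then obtain K where "\<And>x. norm (A x) \<le> norm x * K" using bounded_linear.bounded by blast
  then show "bounded_op_on UNIV A"
    using A by (intro bounded_op_onI[where B = K]) (auto simp: mult.commute linear_simps)
qed

lemma bounded_op_compose:
  "bounded_op_on UNIV A \<Longrightarrow> bounded_op_on UNIV B \<Longrightarrow> bounded_op_on UNIV (\<lambda>x. A (B x))"
  by (simp add: bounded_op_on_UNIV_iff bounded_linear_compose)

lemma bounded_op_funpow:
  "bounded_op_on UNIV A \<Longrightarrow> bounded_op_on UNIV (A ^^ n)"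
proof (induction n)
  case 0
  then show ?case by (auto simp: bounded_op_on_UNIV_iff id_def bounded_linear_ident)
next
  case (Suc n)
  then show ?case using bounded_op_compose by (auto simp: comp_def)
qed

lemma bounded_op_scaleR:
  "bounded_op_on UNIV A \<Longrightarrow> bounded_op_on UNIV (\<lambda>x. t *\<^sub>R A x)"
  unfolding bounded_op_on_UNIV_iff
  by (auto simp: bounded_linear_const_scaleR) (simp add: scaleR_scaleC scaleC_scaleC mult.commute)

lemma adjoint_inner:
  assumes "bounded_op_on UNIV T"
  shows "adjoint_on UNIV T y \<bullet> x = y \<bullet> T x"
proof -
  have "T x \<bullet> y = x \<bullet> adjoint_on UNIV T y"
    using adjoint_on_works(2)[OF closed_csubspace_UNIV assms, of x y] by (simp add: inner_eq_Re_cinner)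
  then show ?thesis by (simp only: inner_commute)
qed

lemma alpha_op_inner:
  assumes "bounded_op_on UNIV T"
  shows "alpha_op r T x \<bullet> y = - (T (T x) \<bullet> T (T y)) + (1 + r\<^sup>2) * (T x \<bullet> T y) - r\<^sup>2 * (x \<bullet> y)"
  by (simp add: alpha_op_def Let_def inner_add_left inner_diff_left adjoint_inner[OF assms])

lemma bounded_alpha_op:
  assumes T: "bounded_op_on UNIV T"
  shows "bounded_op_on UNIV (alpha_op r T)"
proof -
  note A = adjoint_on_works(1)[OF closed_csubspace_UNIV T]
  have "bounded_linear (alpha_op r T)"
  proof -
    let ?A = "adjoint_on UNIV T"
    have t: "bounded_linear T" and a: "bounded_linear ?A" using T A by (simp_all add: bounded_op_on_UNIV_iff)
    note c = bounded_linear_compose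
    have 1: "bounded_linear (\<lambda>x. ?A (T x))" by (rule c[OF a t])
    have 2: "bounded_linear (\<lambda>x. ?A (?A (T (T x))))" by (rule c[OF a c[OF 1 t]])
    show ?thesis
      unfolding alpha_op_def[abs_def] Let_def
      by (intro bounded_linear_sub bounded_linear_add bounded_linear_minus bounded_linear_const_scaleR
          bounded_linear_ident 1 2)
  qed
  moreover have "alpha_op r T (c *\<^sub>C x) = c *\<^sub>C alpha_op r T x" for c x
    by (simp add: alpha_op_def Let_def bounded_op_onD[OF T] bounded_op_onD[OF A] scaleR_scaleC
        scaleC_add_right scaleC_diff_right scaleC_minus_right scaleC_scaleC mult.commute)
  ultimately show ?thesis by (simp add: bounded_op_on_UNIV_iff)
qed

lemma positive_alpha_op_iff:
  assumes T: "bounded_op_on UNIV T"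
  shows "positive_op (alpha_op r T) \<longleftrightarrow>
    (\<forall>x. (norm (T (T x)))\<^sup>2 - (1 + r\<^sup>2) * (norm (T x))\<^sup>2 + r\<^sup>2 * (norm x)\<^sup>2 \<le> 0)"
proof -
  have form: "alpha_op r T x \<bullet> x = - ((norm (T (T x)))\<^sup>2 - (1 + r\<^sup>2) * (norm (T x))\<^sup>2 + r\<^sup>2 * (norm x)\<^sup>2)" for x
    by (simp add: alpha_op_inner[OF T] power2_norm_eq_inner)
  show ?thesis
  proof
    assume "positive_op (alpha_op r T)"
    from positive_op_sym(3)[OF this]
    show "\<forall>x. (norm (T (T x)))\<^sup>2 - (1 + r\<^sup>2) * (norm (T x))\<^sup>2 + r\<^sup>2 * (norm x)\<^sup>2 \<le> 0"
      unfolding form by (simp only: neg_0_le_iff_le) blast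
  next
    assume *: "\<forall>x. (norm (T (T x)))\<^sup>2 - (1 + r\<^sup>2) * (norm (T x))\<^sup>2 + r\<^sup>2 * (norm x)\<^sup>2 \<le> 0"
    show "positive_op (alpha_op r T)"
    proof (rule positive_opI[OF bounded_alpha_op[OF T]])
      show "alpha_op r T x \<bullet> y = x \<bullet> alpha_op r T y" for x y
        by (simp add: alpha_op_inner[OF T] inner_commute[of x "alpha_op r T y"])
          (simp add: inner_commute)
      show "0 \<le> alpha_op r T x \<bullet> x" for x unfolding form using * by (simp only: neg_0_le_iff_le)
    qed
  qed
qed

lemma H2r_sum_norm_sq: "(H2r_sum_norm r p)\<^sup>2 = (H2r_norm r (fst p))\<^sup>2 + (norm (snd p))\<^sup>2"
  by (simp add: H2r_sum_norm_def)

text \<open>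
  The form of \<open>\<alpha>(T\<^sup>*, T)\<close> involves only norms along the orbit of a vector and is additive on direct
  sums. Hence it can be computed in the model, where both summands contribute the right sign; for \<open>S\<close>
  this holds because \<open>S\<close> is a restriction of \<open>N\<close>.
\<close>

lemma part_of_model_imp_positive:
  fixes T :: "'a::chilbert_space \<Rightarrow> 'a" and E :: "'e::chilbert_space set"
  assumes r: "0 < r" "r < 1" and T: "bounded_op_on UNIV T"
    and model: "part_of_model r T E TYPE('s::chilbert_space)"
  shows "positive_op (alpha_op r T)"
proof -
  obtain K :: "'s set" and S L N M where
    minimal: "minimal_normal_extension K S L N"
    and spec: "spectrum_on L N \<subseteq> {z. cmod z = r} \<union> {z. cmod z = 1}"
    and inv: "closed_invariant_subspace (H2r_sum_norm r) (H2r r E \<times> K) (map_prod (Mzt r) S) M"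
    and equiv: "unitarily_equivalent norm UNIV T (H2r_sum_norm r) M (map_prod (Mzt r) S)"
    using model unfolding part_of_model_def by blast
  obtain U where U: "range U = M" "\<And>x. H2r_sum_norm r (U x) = norm x"
    "\<And>x. U (T x) = map_prod (Mzt r) S (U x)"
    using equiv unfolding unitarily_equivalent_def by auto
  have ext: "closed_csubspace L" "normal_on L N" "K \<subseteq> L" "bounded_op_on K S" "\<And>k. k \<in> K \<Longrightarrow> N k = S k"
    using minimal unfolding minimal_normal_extension_def normal_extension_def by auto
  show ?thesis
    unfolding positive_alpha_op_iff[OF T]
  proof
    fix x
    obtain f k where fk: "U x = (f, k)" by fastforce
    have mem: "f \<in> H2r r E" "k \<in> K"
      using inv U(1) fk unfolding closed_invariant_subspace_def by (metis mem_Sigma_iff rangeI subsetD)+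
    have norms: "(norm x)\<^sup>2 = (H2r_norm r f)\<^sup>2 + (norm k)\<^sup>2"
      "(norm (T x))\<^sup>2 = (H2r_norm r (Mzt r f))\<^sup>2 + (norm (S k))\<^sup>2"
      "(norm (T (T x)))\<^sup>2 = (H2r_norm r (Mzt r (Mzt r f)))\<^sup>2 + (norm (S (S k)))\<^sup>2"
      by (simp_all add: U(2)[symmetric] U(3) fk H2r_sum_norm_sq)
    have "S k \<in> K" using bounded_op_onD(1)[OF ext(4) mem(2)] .
    then have "N k = S k" "N (N k) = S (S k)" "k \<in> L" using ext(3,5) mem(2) by auto
    then have "(norm (S (S k)))\<^sup>2 - (1 + r\<^sup>2) * (norm (S k))\<^sup>2 + r\<^sup>2 * (norm k)\<^sup>2 \<le> 0"
      using normal_alpha_form_nonneg[OF ext(1,2) r spec] by metis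
    with Mzt_alpha_form[OF r mem(1)]
    show "(norm (T (T x)))\<^sup>2 - (1 + r\<^sup>2) * (norm (T x))\<^sup>2 + r\<^sup>2 * (norm x)\<^sup>2 \<le> 0"
      unfolding norms by (simp add: algebra_simps)
  qed
qed

section \<open>Multiples of unitary operators\<close>

definition scaled_unitary_on :: "'a::chilbert_space set \<Rightarrow> real \<Rightarrow> ('a \<Rightarrow> 'a) \<Rightarrow> bool" where
  "scaled_unitary_on K s V \<longleftrightarrow>
     closed_csubspace K \<and> 0 < s \<and> invertible_op_on K V \<and> (\<forall>k\<in>K. norm (V k) = s * norm k)"

lemma scaled_unitary_cinner:
  assumes V: "scaled_unitary_on K s V" and x: "x \<in> K" and y: "y \<in> K"
  shows "cinner (V x) (V y) = of_real (s\<^sup>2) * cinner x y"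
proof -
  have K: "closed_csubspace K" and b: "bounded_op_on K V" and n: "\<And>k. k \<in> K \<Longrightarrow> norm (V k) = s * norm k"
    using V by (auto simp: scaled_unitary_on_def invertible_op_on_def)
  have re: "V x \<bullet> V z = s\<^sup>2 * (x \<bullet> z)" if z: "z \<in> K" for z
  proof -
    have "(norm (V x + V z))\<^sup>2 - (norm (V x - V z))\<^sup>2 = s\<^sup>2 * ((norm (x + z))\<^sup>2 - (norm (x - z))\<^sup>2)"
      using n[OF csubspaceD(2)[OF K x z]] n[OF csubspaceD(3)[OF K x z]]
      by (simp add: bounded_op_onD(2)[OF b x z] bounded_op_on_diff[OF K b x z] power_mult_distrib algebra_simps)
    moreover have "(norm (a + b))\<^sup>2 - (norm (a - b))\<^sup>2 = 4 * (a \<bullet> b)" for a b :: 'a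
      by (simp add: power2_norm_eq_inner inner_add inner_diff inner_commute)
    ultimately show ?thesis by simp
  qed
  show ?thesis
    using re[OF y] re[OF csubspaceD(4)[OF K y], of \<i>] bounded_op_onD(3)[OF b y]
    by (simp add: cinner_eq_Complex_inner complex_eq_iff)
qed

lemma invertible_op_onI:
  assumes K: "closed_csubspace K" and A: "bounded_op_on K A" and C: "0 < C"
    and surj: "\<And>y. y \<in> K \<Longrightarrow> \<exists>x\<in>K. A x = y"
    and below: "\<And>x. x \<in> K \<Longrightarrow> C * norm x \<le> norm (A x)"
  shows "invertible_op_on K A"
proof -
  have inj: "x = y" if "x \<in> K" "y \<in> K" "A x = A y" for x y
  proof -
    have "C * norm (x - y) \<le> 0"
      using below[OF csubspaceD(3)[OF K that(1,2)]] that(3) bounded_op_on_diff[OF K A that(1,2)] by simp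
    then show ?thesis using C by (simp add: mult_le_0_iff)
  qed
  obtain B where B: "\<And>y. y \<in> K \<Longrightarrow> B y \<in> K" "\<And>y. y \<in> K \<Longrightarrow> A (B y) = y"
    using surj by metis
  have "bounded_op_on K B"
  proof (rule bounded_op_onI)
    show "B (x + y) = B x + B y" if "x \<in> K" "y \<in> K" for x y
      by (rule inj) (use that B csubspaceD(2)[OF K] bounded_op_onD(2)[OF A] in auto)
    show "B (c *\<^sub>C x) = c *\<^sub>C B x" if "x \<in> K" for c x
      by (rule inj) (use that B csubspaceD(4)[OF K] bounded_op_onD(3)[OF A] in auto)
    show "norm (B x) \<le> (1 / C) * norm x" if "x \<in> K" for x
      using below[OF B(1)[OF that]] B(2)[OF that] C by (simp add: field_simps)
  qed (rule B(1))
  moreover have "B (A x) = x" if "x \<in> K" for x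
    by (rule inj) (use that B bounded_op_onD(1)[OF A that] in auto)
  ultimately show ?thesis using A B(2) unfolding invertible_op_on_def by blast
qed

text \<open>
  \<open>V x - l x = y\<close> is the fixed point equation of a contraction: \<open>x = (V x - y) / l\<close> if \<open>\<bar>l\<bar> > s\<close>, and
  \<open>x = V\<^sup>-\<^sup>1 (y + l x)\<close> if \<open>\<bar>l\<bar> < s\<close>.
\<close>

lemma scaled_unitary_resolvent:
  assumes V: "scaled_unitary_on K s V" and l: "cmod l \<noteq> s"
  shows "y \<in> K \<Longrightarrow> \<exists>x\<in>K. V x - l *\<^sub>C x = y"
    and "x \<in> K \<Longrightarrow> \<bar>s - cmod l\<bar> * norm x \<le> norm (V x - l *\<^sub>C x)"
proof -
  have K: "closed_csubspace K" and s: "0 < s" and b: "bounded_op_on K V"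
    and n: "\<And>k. k \<in> K \<Longrightarrow> norm (V k) = s * norm k"
    using V by (auto simp: scaled_unitary_on_def invertible_op_on_def)
  obtain I where I: "bounded_op_on K I" "\<And>x. x \<in> K \<Longrightarrow> V (I x) = x" "\<And>x. x \<in> K \<Longrightarrow> I (V x) = x"
    using V by (auto simp: scaled_unitary_on_def invertible_op_on_def)
  note KD = csubspaceD[OF K]
  have nI: "norm (I k) = norm k / s" if "k \<in> K" for k
    using n[OF bounded_op_onD(1)[OF I(1) that]] I(2)[OF that] s by (simp add: field_simps)
  have compl: "complete K" "K \<noteq> {}" using KD(1,6) by (auto simp: complete_eq_closed)
  show "\<exists>x\<in>K. V x - l *\<^sub>C x = y" if y: "y \<in> K"
  proof (cases "cmod l > s")
    case True
    define F where "F x = inverse l *\<^sub>C (V x - y)" for x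
    have l0: "l \<noteq> 0" using True s by auto
    have "\<exists>!x. x \<in> K \<and> F x = x"
    proof (rule Banach_fix[OF compl, of "s / cmod l"])
      show "F ` K \<subseteq> K" using y KD(3,4) bounded_op_onD(1)[OF b] by (auto simp: F_def)
      show "dist (F x) (F z) \<le> s / cmod l * dist x z" if "x \<in> K" "z \<in> K" for x z
      proof -
        have "F x - F z = inverse l *\<^sub>C V (x - z)"
          using bounded_op_on_diff[OF K b that] by (simp add: F_def flip: scaleC_diff_right)
        then show ?thesis
          using n[OF KD(3)[OF that]] by (simp add: dist_norm norm_scaleC norm_inverse divide_inverse)
      qed
    qed (use True s in \<open>auto simp: divide_less_eq\<close>)
    then obtain x where x: "x \<in> K" "F x = x" by blast
    have "l *\<^sub>C F x = V x - y" using l0 by (simp add: F_def scaleC_scaleC scaleC_one)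
    then show ?thesis using x by (intro bexI[of _ x]) auto
  next
    case False
    define F where "F x = I (y + l *\<^sub>C x)" for x
    have "\<exists>!x. x \<in> K \<and> F x = x"
    proof (rule Banach_fix[OF compl, of "cmod l / s"])
      show "F ` K \<subseteq> K" using y KD(2,4) bounded_op_onD(1)[OF I(1)] by (auto simp: F_def)
      show "dist (F x) (F z) \<le> cmod l / s * dist x z" if "x \<in> K" "z \<in> K" for x z
      proof -
        have mem: "y + l *\<^sub>C x \<in> K" "y + l *\<^sub>C z \<in> K" using y that KD(2,4) by auto
        have "F x - F z = I (l *\<^sub>C (x - z))"
          using bounded_op_on_diff[OF K I(1) mem] by (simp add: F_def scaleC_diff_right)
        then show ?thesis
          using nI[OF KD(4)[OF KD(3)[OF that]], of l] by (simp add: dist_norm norm_scaleC)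
      qed
    qed (use False l s in \<open>auto simp: divide_less_eq\<close>)
    then obtain x where x: "x \<in> K" "F x = x" by blast
    have "V (F x) = y + l *\<^sub>C x" unfolding F_def using x y KD(2,4) by (intro I(2)) auto
    then show ?thesis using x by (intro bexI[of _ x]) auto
  qed
  show "\<bar>s - cmod l\<bar> * norm x \<le> norm (V x - l *\<^sub>C x)" if "x \<in> K"
    using norm_triangle_ineq3[of "V x" "l *\<^sub>C x"] n[OF that]
    by (simp add: norm_scaleC left_diff_distrib[symmetric] abs_mult)
qed

text \<open>
  The adjoint of \<open>V\<^sub>i\<close> is \<open>s\<^sub>i\<^sup>2 V\<^sub>i\<^sup>-\<^sup>1\<close>, so the direct sum is normal and is its own minimal normal
  extension.
\<close>

lemma scaled_unitary_sum:
  fixes V1 :: "'a::chilbert_space \<Rightarrow> 'a" and V2 :: "'b::chilbert_space \<Rightarrow> 'b"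
  assumes V1: "scaled_unitary_on K1 s1 V1" and V2: "scaled_unitary_on K2 s2 V2"
  defines "S \<equiv> map_prod V1 V2" and "K \<equiv> K1 \<times> K2"
  shows "minimal_normal_extension K S K S"
    and "spectrum_on K S \<subseteq> {z. cmod z = s1} \<union> {z. cmod z = s2}"
proof -
  have K1: "closed_csubspace K1" and K2: "closed_csubspace K2" and s: "0 < s1" "0 < s2"
    and b1: "bounded_op_on K1 V1" and b2: "bounded_op_on K2 V2"
    using V1 V2 by (auto simp: scaled_unitary_on_def invertible_op_on_def)
  obtain I1 where I1: "bounded_op_on K1 I1" "\<And>x. x \<in> K1 \<Longrightarrow> V1 (I1 x) = x" "\<And>x. x \<in> K1 \<Longrightarrow> I1 (V1 x) = x"
    using V1 by (auto simp: scaled_unitary_on_def invertible_op_on_def)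
  obtain I2 where I2: "bounded_op_on K2 I2" "\<And>x. x \<in> K2 \<Longrightarrow> V2 (I2 x) = x" "\<And>x. x \<in> K2 \<Longrightarrow> I2 (V2 x) = x"
    using V2 by (auto simp: scaled_unitary_on_def invertible_op_on_def)
  note D1 = csubspaceD[OF K1] and D2 = csubspaceD[OF K2]
  have K: "closed_csubspace K"
    unfolding closed_csubspace_def complex_vector.subspace_def K_def
    using D1 D2 by (auto simp: scaleC_prod_def closed_Times zero_prod_def)
  have bsub: "bounded_op_on K (\<lambda>p. S p - l *\<^sub>C p)" for l
  proof -
    obtain B1 where B1: "0 < B1" "\<forall>x\<in>K1. norm (V1 x) \<le> B1 * norm x" using bounded_op_onD(4)[OF b1] by blast
    obtain B2 where B2: "0 < B2" "\<forall>x\<in>K2. norm (V2 x) \<le> B2 * norm x" using bounded_op_onD(4)[OF b2] by blast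
    show ?thesis
    proof (rule bounded_op_onI)
      show "S p - l *\<^sub>C p \<in> K" if "p \<in> K" for p
        using that D1(3,4) D2(3,4) bounded_op_onD(1)[OF b1] bounded_op_onD(1)[OF b2]
        by (auto simp: S_def K_def scaleC_prod_def)
      show "S (p + q) - l *\<^sub>C (p + q) = (S p - l *\<^sub>C p) + (S q - l *\<^sub>C q)" if "p \<in> K" "q \<in> K" for p q
        using that bounded_op_onD(2)[OF b1] bounded_op_onD(2)[OF b2]
        by (auto simp: S_def K_def scaleC_add_right)
      show "S (c *\<^sub>C p) - l *\<^sub>C c *\<^sub>C p = c *\<^sub>C (S p - l *\<^sub>C p)" if "p \<in> K" for c p
        using that bounded_op_onD(3)[OF b1] bounded_op_onD(3)[OF b2]
        by (auto simp: S_def K_def scaleC_prod_def scaleC_diff_right scaleC_scaleC mult.commute)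
      show "norm (S p - l *\<^sub>C p) \<le> (B1 + B2 + cmod l) * norm p" if "p \<in> K" for p
      proof -
        have p: "fst p \<in> K1" "snd p \<in> K2" using that by (auto simp: K_def)
        have "norm (S p) \<le> norm (V1 (fst p)) + norm (V2 (snd p))"
          unfolding S_def map_prod_def by (simp add: case_prod_beta norm_Pair_le)
        also have "\<dots> \<le> B1 * norm (fst p) + B2 * norm (snd p)" using B1 B2 p by (intro add_mono) auto
        also have "\<dots> \<le> B1 * norm p + B2 * norm p"
          using B1(1) B2(1) norm_fst_le[of "fst p" "snd p"] norm_snd_le[of "snd p" "fst p"]
          by (intro add_mono mult_left_mono) auto
        finally show ?thesis
          using norm_triangle_ineq4[of "S p" "l *\<^sub>C p"] by (simp add: norm_scaleC algebra_simps)
      qed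
    qed
  qed
  have bS: "bounded_op_on K S" using bsub[of 0] by simp
  have adj: "adjoint_on K S p = (s1\<^sup>2 *\<^sub>R I1 (fst p), s2\<^sup>2 *\<^sub>R I2 (snd p))" if p: "p \<in> K" for p
  proof (rule adjoint_on_eqI[OF K])
    have p': "fst p \<in> K1" "snd p \<in> K2" using p by (auto simp: K_def)
    have I: "I1 (fst p) \<in> K1" "I2 (snd p) \<in> K2"
      using bounded_op_onD(1)[OF I1(1)] bounded_op_onD(1)[OF I2(1)] p' by auto
    then show "(s1\<^sup>2 *\<^sub>R I1 (fst p), s2\<^sup>2 *\<^sub>R I2 (snd p)) \<in> K"
      using D1(5) D2(5) by (auto simp: K_def)
    show "cinner (S x) p = cinner x (s1\<^sup>2 *\<^sub>R I1 (fst p), s2\<^sup>2 *\<^sub>R I2 (snd p))" if x: "x \<in> K" for x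
    proof -
      have x': "fst x \<in> K1" "snd x \<in> K2" using x by (auto simp: K_def)
      show ?thesis
        using scaled_unitary_cinner[OF V1 x'(1) I(1)] scaled_unitary_cinner[OF V2 x'(2) I(2)]
          I1(2)[OF p'(1)] I2(2)[OF p'(2)]
        by (simp add: S_def cinner_prod_def cinner_linear)
    qed
  qed
  have "normal_on K S"
    unfolding normal_on_def
  proof (intro conjI bS ballI)
    fix p assume p: "p \<in> K"
    have p': "fst p \<in> K1" "snd p \<in> K2" using p by (auto simp: K_def)
    have I: "I1 (fst p) \<in> K1" "I2 (snd p) \<in> K2"
      using bounded_op_onD(1)[OF I1(1)] bounded_op_onD(1)[OF I2(1)] p' by auto
    show "adjoint_on K S (S p) = S (adjoint_on K S p)"
      unfolding adj[OF p] adj[OF bounded_op_onD(1)[OF bS p]]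
      using I1(2,3)[OF p'(1)] I2(2,3)[OF p'(2)] bounded_op_onD(3)[OF b1 I(1)] bounded_op_onD(3)[OF b2 I(2)]
      by (simp add: S_def scaleR_scaleC)
  qed
  then show "minimal_normal_extension K S K S"
    using K bS unfolding minimal_normal_extension_def normal_extension_def reducing_for_def by auto
  show "spectrum_on K S \<subseteq> {z. cmod z = s1} \<union> {z. cmod z = s2}"
  proof (rule ccontr)
    assume "\<not> ?thesis"
    then obtain l where l: "\<not> invertible_op_on K (\<lambda>x. S x - l *\<^sub>C x)" "cmod l \<noteq> s1" "cmod l \<noteq> s2"
      unfolding spectrum_on_def by auto
    define C where "C = min \<bar>s1 - cmod l\<bar> \<bar>s2 - cmod l\<bar>"
    have C: "0 < C" using l by (auto simp: C_def)
    have "invertible_op_on K (\<lambda>x. S x - l *\<^sub>C x)"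
    proof (rule invertible_op_onI[OF K bsub C])
      fix p assume "p \<in> K"
      then have p: "fst p \<in> K1" "snd p \<in> K2" by (auto simp: K_def)
      obtain x1 x2 where "x1 \<in> K1" "V1 x1 - l *\<^sub>C x1 = fst p" "x2 \<in> K2" "V2 x2 - l *\<^sub>C x2 = snd p"
        using scaled_unitary_resolvent(1)[OF V1 l(2) p(1)] scaled_unitary_resolvent(1)[OF V2 l(3) p(2)] by blast
      then show "\<exists>x\<in>K. S x - l *\<^sub>C x = p"
        by (intro bexI[of _ "(x1, x2)"]) (auto simp: S_def K_def scaleC_prod_def)
      have "C * norm (fst p) \<le> norm (V1 (fst p) - l *\<^sub>C fst p)"
        using scaled_unitary_resolvent(2)[OF V1 l(2) p(1)] mult_right_mono[of C "\<bar>s1 - cmod l\<bar>" "norm (fst p)"]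
        by (simp add: C_def)
      moreover have "C * norm (snd p) \<le> norm (V2 (snd p) - l *\<^sub>C snd p)"
        using scaled_unitary_resolvent(2)[OF V2 l(3) p(2)] mult_right_mono[of C "\<bar>s2 - cmod l\<bar>" "norm (snd p)"]
        by (simp add: C_def)
      ultimately have "(C * norm (fst p))\<^sup>2 + (C * norm (snd p))\<^sup>2
          \<le> (norm (V1 (fst p) - l *\<^sub>C fst p))\<^sup>2 + (norm (V2 (snd p) - l *\<^sub>C snd p))\<^sup>2"
        using C by (intro add_mono power_mono) auto
      then have "(C * norm p)\<^sup>2 \<le> (norm (S p - l *\<^sub>C p))\<^sup>2"
        by (simp add: norm_prod_def S_def scaleC_prod_def power_mult_distrib distrib_left case_prod_beta map_prod_def)
      then show "C * norm p \<le> norm (S p - l *\<^sub>C p)" by (rule power2_le_imp_le) simp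
    qed
    then show False using l(1) by simp
  qed
qed

lemma closed_csubspace_closure_range:
  assumes Q: "bounded_op_on UNIV Q"
  shows "closed_csubspace (closure (range Q))"
proof -
  have "0 \<in> closure (range Q)"
    using bounded_op_on_zero[OF closed_csubspace_UNIV Q] closure_subset by (metis rangeI subsetD)
  moreover have "x + y \<in> closure (range Q)" if "x \<in> closure (range Q)" "y \<in> closure (range Q)" for x y
  proof -
    obtain u v where "\<And>n. u n \<in> range Q" "u \<longlonglongrightarrow> x" "\<And>n. v n \<in> range Q" "v \<longlonglongrightarrow> y"
      using \<open>x \<in> _\<close> \<open>y \<in> _\<close> unfolding closure_sequential by metis
    moreover have "u n + v n \<in> range Q" for n
      using calculation(1,3)[of n] bounded_op_onD(2)[OF Q, symmetric] by auto
    moreover have "(\<lambda>n. u n + v n) \<longlonglongrightarrow> x + y" using calculation(2,4) by (rule tendsto_add)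
    ultimately show ?thesis
      unfolding closure_sequential by (intro exI[of _ "\<lambda>n. u n + v n"]) simp
  qed
  moreover have "c *\<^sub>C x \<in> closure (range Q)" if x: "x \<in> closure (range Q)" for c x
  proof -
    obtain u where u: "\<And>n. u n \<in> range Q" "u \<longlonglongrightarrow> x"
      using x unfolding closure_sequential by metis
    have "c *\<^sub>C u n \<in> range Q" for n
      using u(1)[of n] bounded_op_onD(3)[OF Q, symmetric] by auto
    moreover have "(\<lambda>n. c *\<^sub>C u n) \<longlonglongrightarrow> c *\<^sub>C x" by (intro tendsto_scaleC tendsto_const u)
    ultimately show ?thesis
      unfolding closure_sequential by (intro exI[of _ "\<lambda>n. c *\<^sub>C u n"]) simp
  qed
  ultimately show ?thesis
    unfolding closed_csubspace_def complex_vector.subspace_def by auto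
qed

text \<open>
  The map \<open>Q x \<mapsto> Q (T x)\<close> multiplies distances by \<open>s\<close>, so it is well defined on the range of \<open>Q\<close> and
  carries Cauchy sequences to Cauchy sequences.
\<close>

lemma intertwiner_extension:
  fixes Q T :: "'a::chilbert_space \<Rightarrow> 'a"
  assumes Q: "bounded_op_on UNIV Q" and T: "bounded_op_on UNIV T"
    and scale: "\<And>x. norm (Q (T x)) = s * norm (Q x)" and s: "0 < s"
  obtains V where "bounded_op_on (closure (range Q)) V" "\<And>x. V (Q x) = Q (T x)"
    "\<And>k. k \<in> closure (range Q) \<Longrightarrow> norm (V k) = s * norm k"
proof -
  let ?K = "closure (range Q)"
  have K: "closed_csubspace ?K" by (rule closed_csubspace_closure_range[OF Q])
  note lin = bounded_op_onD(2,3)[OF Q] bounded_op_onD(2,3)[OF T]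
    bounded_op_on_diff[OF closed_csubspace_UNIV Q] bounded_op_on_diff[OF closed_csubspace_UNIV T]
  have "\<exists>x. (\<lambda>n. Q (x n)) \<longlonglongrightarrow> k" if k: "k \<in> ?K" for k
  proof -
    obtain u where u: "\<And>n. u n \<in> range Q" "u \<longlonglongrightarrow> k" using k unfolding closure_sequential by metis
    then obtain x where "\<And>n. u n = Q (x n)" unfolding image_iff by metis
    then have "u = (\<lambda>n. Q (x n))" by auto
    then show ?thesis using u(2) by auto
  qed
  then obtain X where X: "\<And>k. k \<in> ?K \<Longrightarrow> (\<lambda>n. Q (X k n)) \<longlonglongrightarrow> k" by metis
  have QTdiff: "norm (Q (T x) - Q (T y)) = s * norm (Q x - Q y)" for x y
    using scale[of "x - y"] by (simp add: lin)
  have "convergent (\<lambda>n. Q (T (X k n)))" if k: "k \<in> ?K" for k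
  proof -
    have "Cauchy (\<lambda>n. Q (X k n))" using X[OF k] by (rule LIMSEQ_imp_Cauchy)
    then have "Cauchy (\<lambda>n. Q (T (X k n)))"
      unfolding Cauchy_def dist_norm QTdiff
      using s by (metis divide_pos_pos mult.commute pos_less_divide_eq)
    then show ?thesis by (rule Cauchy_convergent)
  qed
  then obtain V where V: "\<And>k. k \<in> ?K \<Longrightarrow> (\<lambda>n. Q (T (X k n))) \<longlonglongrightarrow> V k"
    unfolding convergent_def by metis
  have key: "(\<lambda>n. Q (T (x n))) \<longlonglongrightarrow> V k" if k: "k \<in> ?K" and x: "(\<lambda>n. Q (x n)) \<longlonglongrightarrow> k" for k x
  proof -
    have "(\<lambda>n. Q (T (x n)) - Q (T (X k n))) \<longlonglongrightarrow> 0"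
    proof (rule Lim_null_comparison)
      show "\<forall>\<^sub>F n in sequentially. norm (Q (T (x n)) - Q (T (X k n))) \<le> s * norm (Q (x n) - Q (X k n))"
        by (simp add: QTdiff)
      have "(\<lambda>n. Q (x n) - Q (X k n)) \<longlonglongrightarrow> k - k" by (intro tendsto_diff x X k)
      then show "(\<lambda>n. s * norm (Q (x n) - Q (X k n))) \<longlonglongrightarrow> 0"
        by (intro tendsto_mult_right_zero tendsto_norm_zero) simp
    qed
    from tendsto_add[OF this V[OF k]] show ?thesis by simp
  qed
  have norm: "norm (V k) = s * norm k" if k: "k \<in> ?K" for k
  proof (rule LIMSEQ_unique)
    show "(\<lambda>n. norm (Q (T (X k n)))) \<longlonglongrightarrow> norm (V k)" by (intro tendsto_norm V k)
    show "(\<lambda>n. norm (Q (T (X k n)))) \<longlonglongrightarrow> s * norm k"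
      unfolding scale by (intro tendsto_mult tendsto_const tendsto_norm X k)
  qed
  show thesis
  proof
    show "V (Q x) = Q (T x)" for x
    proof -
      have "Q x \<in> ?K" by (rule closure_subset[THEN subsetD]) (rule rangeI)
      from key[OF this, of "\<lambda>_. x"] show ?thesis by (simp add: LIMSEQ_const_iff)
    qed
    show "bounded_op_on ?K V"
    proof (rule bounded_op_onI)
      show "V k \<in> ?K" if "k \<in> ?K" for k
        unfolding closure_sequential using V[OF that] by (intro exI[of _ "\<lambda>n. Q (T (X k n))"]) simp
      show "V (k + l) = V k + V l" if kl: "k \<in> ?K" "l \<in> ?K" for k l
      proof (rule LIMSEQ_unique)
        show "(\<lambda>n. Q (T (X k n)) + Q (T (X l n))) \<longlonglongrightarrow> V k + V l" by (intro tendsto_add V kl)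
        have "(\<lambda>n. Q (X k n + X l n)) \<longlonglongrightarrow> k + l" using tendsto_add[OF X X] kl by (simp add: lin)
        from key[OF csubspaceD(2)[OF K kl] this]
        show "(\<lambda>n. Q (T (X k n)) + Q (T (X l n))) \<longlonglongrightarrow> V (k + l)" by (simp add: lin)
      qed
      show "V (c *\<^sub>C k) = c *\<^sub>C V k" if k: "k \<in> ?K" for c k
      proof (rule LIMSEQ_unique)
        show "(\<lambda>n. c *\<^sub>C Q (T (X k n))) \<longlonglongrightarrow> c *\<^sub>C V k" by (intro tendsto_scaleC tendsto_const V k)
        have "(\<lambda>n. Q (c *\<^sub>C X k n)) \<longlonglongrightarrow> c *\<^sub>C k"
          using tendsto_scaleC[OF tendsto_const X[OF k]] by (simp add: lin)
        from key[OF csubspaceD(4)[OF K k] this]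
        show "(\<lambda>n. c *\<^sub>C Q (T (X k n))) \<longlonglongrightarrow> V (c *\<^sub>C k)" by (simp add: lin)
      qed
      show "norm (V k) \<le> s * norm k" if "k \<in> ?K" for k using norm[OF that] by simp
    qed
  qed (rule norm)
qed

text \<open>
  Invertibility of \<open>T\<close> is what makes the extended intertwiner surjective: the intertwiner of \<open>T\<^sup>-\<^sup>1\<close>
  is its inverse on a dense subspace.
\<close>

lemma scaled_unitary_from_intertwiner:
  fixes Q T T' :: "'a::chilbert_space \<Rightarrow> 'a"
  assumes Q: "bounded_op_on UNIV Q" and T: "bounded_op_on UNIV T" and T': "bounded_op_on UNIV T'"
    and inverse: "\<And>x. T (T' x) = x" "\<And>x. T' (T x) = x"
    and scale: "\<And>x. norm (Q (T x)) = s * norm (Q x)" and s: "0 < s"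
  obtains V where "scaled_unitary_on (closure (range Q)) s V" "\<And>x. V (Q x) = Q (T x)"
proof -
  let ?K = "closure (range Q)"
  have K: "closed_csubspace ?K" by (rule closed_csubspace_closure_range[OF Q])
  obtain V where V: "bounded_op_on ?K V" "\<And>x. V (Q x) = Q (T x)" "\<And>k. k \<in> ?K \<Longrightarrow> norm (V k) = s * norm k"
    using intertwiner_extension[OF Q T scale s] by blast
  have scale': "norm (Q (T' x)) = (1 / s) * norm (Q x)" for x
    using scale[of "T' x"] s by (simp add: inverse)
  have s': "0 < 1 / s" using s by simp
  obtain V' where V': "bounded_op_on ?K V'" "\<And>x. V' (Q x) = Q (T' x)" "\<And>k. k \<in> ?K \<Longrightarrow> norm (V' k) = (1 / s) * norm k"
    using intertwiner_extension[OF Q T' scale' s'] by blast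
  \<comment> \<open>Both compositions are isometric and fix the dense set \<open>range Q\<close>.\<close>
  have id: "A (B k) = k"
    if A: "bounded_op_on ?K A" "\<And>k. k \<in> ?K \<Longrightarrow> norm (A k) = a * norm k"
      and B: "bounded_op_on ?K B" "\<And>k. k \<in> ?K \<Longrightarrow> norm (B k) = b * norm k"
      and ab: "a * b = 1" and fixed: "\<And>x. A (B (Q x)) = Q x" and k: "k \<in> ?K" for A B a b k
  proof -
    obtain u where u: "\<And>n. u n \<in> range Q" "u \<longlonglongrightarrow> k" using k unfolding closure_sequential by metis
    have uK: "u n \<in> ?K" for n by (rule closure_subset[THEN subsetD]) (rule u(1))
    have "norm (A (B k) - u n) = norm (k - u n)" for n
    proof -
      have "A (B k) - u n = A (B (k - u n))"
        using fixed u(1)[of n] bounded_op_on_diff[OF K B(1) k uK[of n]]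
          bounded_op_on_diff[OF K A(1) bounded_op_onD(1)[OF B(1) k] bounded_op_onD(1)[OF B(1) uK[of n]]]
        by auto
      moreover have "norm (A (B v)) = norm v" if v: "v \<in> ?K" for v
        using A(2)[OF bounded_op_onD(1)[OF B(1) v]] B(2)[OF v] ab by (simp flip: mult.assoc)
      ultimately show ?thesis using csubspaceD(3)[OF K k uK] by simp
    qed
    moreover have "(\<lambda>n. norm (k - u n)) \<longlonglongrightarrow> norm (k - k)" by (intro tendsto_norm tendsto_diff tendsto_const u)
    moreover have "(\<lambda>n. norm (A (B k) - u n)) \<longlonglongrightarrow> norm (A (B k) - k)"
      by (intro tendsto_norm tendsto_diff tendsto_const u)
    ultimately have "norm (A (B k) - k) = 0" using LIMSEQ_unique by fastforce
    then show ?thesis by simp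
  qed
  have "V (V' k) = k" "V' (V k) = k" if "k \<in> ?K" for k
    using id[OF V(1,3) V'(1,3) _ _ that] id[OF V'(1,3) V(1,3) _ _ that] s
    by (simp_all add: V(2) V'(2) inverse)
  then have "scaled_unitary_on ?K s V"
    unfolding scaled_unitary_on_def invertible_op_on_def using K s V(1,3) V'(1) by blast
  then show thesis using that V(2) by blast
qed

section \<open>Quadratic estimates along orbits\<close>

text \<open>
  Polarisation turns the convergence of norms into the convergence of the forms
  \<open>\<langle>G\<^sub>n x, G\<^sub>n y\<rangle>\<close>; \<open>Q\<close> is the square root of the operator that represents the limit form.
\<close>

lemma decreasing_limit_operator:
  fixes G :: "nat \<Rightarrow> 'a::chilbert_space \<Rightarrow> 'a"
  assumes G: "\<And>n. bounded_op_on UNIV (G n)" and dec: "\<And>n x. norm (G (Suc n) x) \<le> norm (G n x)"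
  obtains Q where "bounded_op_on UNIV Q" "\<And>x. (\<lambda>n. (norm (G n x))\<^sup>2) \<longlonglongrightarrow> (norm (Q x))\<^sup>2"
proof -
  have "convergent (\<lambda>n. (norm (G n x))\<^sup>2)" for x
  proof -
    have "decseq (\<lambda>n. (norm (G n x))\<^sup>2)" using dec by (intro decseq_SucI power_mono) auto
    then show ?thesis by (rule decseq_convergent[where B = 0]) (auto simp: convergent_def)
  qed
  then obtain \<nu> where \<nu>: "\<And>x. (\<lambda>n. (norm (G n x))\<^sup>2) \<longlonglongrightarrow> \<nu> x" unfolding convergent_def by metis
  have inner_lim: "(\<lambda>n. G n x \<bullet> G n y) \<longlonglongrightarrow> (\<nu> (x + y) - \<nu> (x - y)) / 4" for x y
  proof -
    have "(norm (a + b))\<^sup>2 - (norm (a - b))\<^sup>2 = 4 * (a \<bullet> b)" for a b :: 'a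
      by (simp add: power2_norm_eq_inner inner_add inner_diff inner_commute)
    then have "G n x \<bullet> G n y = ((norm (G n (x + y)))\<^sup>2 - (norm (G n (x - y)))\<^sup>2) / 4" for n
      by (simp add: bounded_op_onD(2)[OF G] bounded_op_on_diff[OF closed_csubspace_UNIV G])
    then show ?thesis by (simp only:) (intro tendsto_intros \<nu>, simp)
  qed
  define b where "b x y = Complex ((\<nu> (x + y) - \<nu> (x - y)) / 4) ((\<nu> (x + \<i> *\<^sub>C y) - \<nu> (x - \<i> *\<^sub>C y)) / 4)" for x y
  have b: "(\<lambda>n. cinner (G n x) (G n y)) \<longlonglongrightarrow> b x y" for x y
  proof -
    have "cinner (G n x) (G n y) = Complex (G n x \<bullet> G n y) (G n x \<bullet> G n (\<i> *\<^sub>C y))" for n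
      by (simp add: cinner_eq_Complex_inner bounded_op_onD(3)[OF G])
    then show ?thesis unfolding b_def by (simp only:) (intro tendsto_Complex inner_lim)
  qed
  note bounded_op_onD(2,3)[OF G, simp]
  obtain B where B: "0 < B" "\<And>x. norm (G 0 x) \<le> B * norm x" using bounded_op_onD(4)[OF G] by blast
  have GB: "norm (G n x) \<le> B * norm x" for n x
  proof (induction n)
    case (Suc n)
    then show ?case using dec[of n x] by linarith
  qed (rule B(2))
  have "\<exists>A. bounded_op_on UNIV A \<and> (\<forall>x\<in>UNIV. \<forall>z\<in>UNIV. b x z = cinner x (A z))"
  proof (rule sesquilinear_form_representation[where B = "B * B"])
    show "b (x + y) z = b x z + b y z" for x y z
      by (rule LIMSEQ_unique[OF b]) (simp add: cinner_add_left tendsto_add b)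
    show "b (a *\<^sub>C x) z = a * b x z" for a x z
      by (rule LIMSEQ_unique[OF b]) (simp add: cinner_scaleC_left tendsto_mult_left b)
    show "b x (y + z) = b x y + b x z" for x y z
      by (rule LIMSEQ_unique[OF b]) (simp add: cinner_add_right tendsto_add b)
    show "b x (a *\<^sub>C z) = cnj a * b x z" for a x z
      by (rule LIMSEQ_unique[OF b]) (simp add: cinner_scaleC_right tendsto_mult_left b)
    show "cmod (b x z) \<le> B * B * norm x * norm z" for x z
    proof (rule LIMSEQ_le_const2[OF tendsto_norm[OF b[of x z]]])
      have "cmod (cinner (G n x) (G n z)) \<le> B * B * norm x * norm z" for n
      proof -
        have "cmod (cinner (G n x) (G n z)) \<le> norm (G n x) * norm (G n z)" by (rule cmod_cinner_le)
        also have "\<dots> \<le> (B * norm x) * (B * norm z)" using B(1) by (intro mult_mono GB) auto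
        finally show ?thesis by (simp add: mult_ac)
      qed
      then show "\<exists>N. \<forall>n\<ge>N. cmod (cinner (G n x) (G n z)) \<le> B * B * norm x * norm z" by blast
    qed
  qed (use B in auto)
  then obtain A where A: "bounded_op_on UNIV A" "\<And>x z. b x z = cinner x (A z)" by blast
  have bA: "Re (b x y) = x \<bullet> A y" for x y by (simp add: A(2) inner_eq_Re_cinner)
  have A_form: "A x \<bullet> x = \<nu> x" for x
  proof (rule LIMSEQ_unique[OF _ \<nu>])
    show "(\<lambda>n. (norm (G n x))\<^sup>2) \<longlonglongrightarrow> A x \<bullet> x"
      using tendsto_Re[OF b[of x x]] by (simp add: bA cinner_self inner_commute)
  qed
  have pos: "positive_op A"
  proof (rule positive_opI[OF A(1)])
    show "A x \<bullet> y = x \<bullet> A y" for x y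
    proof -
      have "(\<lambda>n. G n x \<bullet> G n y) \<longlonglongrightarrow> x \<bullet> A y" using tendsto_Re[OF b[of x y]] unfolding bA inner_eq_Re_cinner[symmetric] .
      moreover have "(\<lambda>n. G n y \<bullet> G n x) \<longlonglongrightarrow> y \<bullet> A x" using tendsto_Re[OF b[of y x]] unfolding bA inner_eq_Re_cinner[symmetric] .
      then have "(\<lambda>n. G n x \<bullet> G n y) \<longlonglongrightarrow> A x \<bullet> y" by (simp only: inner_commute)
      ultimately show ?thesis using LIMSEQ_unique by blast
    qed
    show "0 \<le> A x \<bullet> x" for x unfolding A_form by (rule LIMSEQ_le_const[OF \<nu>]) auto
  qed
  show thesis
  proof
    show "bounded_op_on UNIV (sqrt_op A)" using sqrt_op_works(1)[OF pos] by (simp add: positive_op_def)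
    show "(\<lambda>n. (norm (G n x))\<^sup>2) \<longlonglongrightarrow> (norm (sqrt_op A x))\<^sup>2" for x
      unfolding norm_sqrt_op[OF pos] A_form by (rule \<nu>)
  qed
qed

lemma nonneg_seq_no_uniform_decrease:
  fixes a :: "nat \<Rightarrow> real"
  assumes nonneg: "\<And>n. 0 \<le> a n" and step: "\<And>n. a (Suc n) \<le> a n - \<delta>" and "0 < \<delta>"
  shows False
proof -
  have "a n \<le> a 0 - real n * \<delta>" for n
  proof (induction n)
    case (Suc n)
    then show ?case using step[of n] by (simp add: algebra_simps)
  qed simp
  moreover obtain n where "a 0 / \<delta> < real n" using reals_Archimedean2 by blast
  then have "a 0 < real n * \<delta>" using \<open>0 < \<delta>\<close> by (simp add: field_simps)
  ultimately show False using nonneg[of n] by (smt (verit))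
qed

text \<open>
  Put \<open>\<beta>(y) = \<parallel>T y\<parallel>\<^sup>2 - r\<^sup>2 \<parallel>y\<parallel>\<^sup>2\<close> and \<open>\<epsilon>(y) = \<parallel>y\<parallel>\<^sup>2 - \<parallel>T y\<parallel>\<^sup>2\<close>. The hypothesis reads both
  \<open>\<beta>(T y) \<le> \<beta>(y)\<close> and \<open>r\<^sup>2 \<epsilon>(y) \<le> \<epsilon>(T y)\<close>. If \<open>\<beta>(x) < 0\<close>, it stays below \<open>\<beta>(x)\<close> along the forward orbit,
  and if \<open>\<epsilon>(x) < 0\<close>, it stays below \<open>\<epsilon>(x)\<close> along the backward orbit; either way the square norms
  would decrease by a fixed amount at each step.
\<close>

lemma alpha_nonneg_bounds:
  fixes T T' :: "'a::real_normed_vector \<Rightarrow> 'a"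
  assumes r: "0 < r" "r < 1" and inverse: "\<And>x. T (T' x) = x"
    and form: "\<And>x. (norm (T (T x)))\<^sup>2 - (1 + r\<^sup>2) * (norm (T x))\<^sup>2 + r\<^sup>2 * (norm x)\<^sup>2 \<le> 0"
  shows "r * norm x \<le> norm (T x)" and "norm (T x) \<le> norm x"
proof -
  have r2: "0 < r\<^sup>2" "r\<^sup>2 < 1" using r by (auto simp: power2_less_1_iff)
  define \<beta> where "\<beta> y = (norm (T y))\<^sup>2 - r\<^sup>2 * (norm y)\<^sup>2" for y
  define \<epsilon> where "\<epsilon> y = (norm y)\<^sup>2 - (norm (T y))\<^sup>2" for y
  have "0 \<le> \<beta> x"
  proof (rule ccontr)
    assume neg: "\<not> 0 \<le> \<beta> x"
    have dec: "\<beta> ((T ^^ k) x) \<le> \<beta> x" for k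
    proof (induction k)
      case (Suc k)
      then show ?case using form[of "(T ^^ k) x"] by (simp add: \<beta>_def algebra_simps)
    qed simp
    show False
    proof (rule nonneg_seq_no_uniform_decrease[of "\<lambda>k. (norm ((T ^^ k) x))\<^sup>2" "- \<beta> x"])
      show "(norm ((T ^^ Suc k) x))\<^sup>2 \<le> (norm ((T ^^ k) x))\<^sup>2 - - \<beta> x" for k
      proof -
        have "r\<^sup>2 * (norm ((T ^^ k) x))\<^sup>2 \<le> 1 * (norm ((T ^^ k) x))\<^sup>2"
          using r2 by (intro mult_right_mono) auto
        then show ?thesis using dec[of k] by (simp add: \<beta>_def)
      qed
    qed (use neg in auto)
  qed
  then have "(r * norm x)\<^sup>2 \<le> (norm (T x))\<^sup>2" by (simp add: \<beta>_def power_mult_distrib)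
  then show "r * norm x \<le> norm (T x)" by (rule power2_le_imp_le) simp
  have "0 \<le> \<epsilon> x"
  proof (rule ccontr)
    assume neg: "\<not> 0 \<le> \<epsilon> x"
    have dec: "\<epsilon> ((T' ^^ k) x) \<le> \<epsilon> x" for k
    proof (induction k)
      case (Suc k)
      define y where "y = T' ((T' ^^ k) x)"
      have "r\<^sup>2 * \<epsilon> y \<le> \<epsilon> x"
        using form[of y] Suc by (simp add: \<epsilon>_def y_def inverse algebra_simps)
      moreover have "\<epsilon> y \<le> r\<^sup>2 * \<epsilon> y" if "\<epsilon> y \<le> 0"
        using mult_right_mono_neg[of "r\<^sup>2" 1 "\<epsilon> y"] that r2 by simp
      moreover have "0 \<le> r\<^sup>2 * \<epsilon> y" if "0 \<le> \<epsilon> y" using that by simp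
      ultimately have "\<epsilon> y \<le> \<epsilon> x" using neg by (smt (verit))
      then show ?case by (simp add: y_def)
    qed simp
    show False
    proof (rule nonneg_seq_no_uniform_decrease[of "\<lambda>k. (norm ((T' ^^ k) x))\<^sup>2" "- \<epsilon> x"])
      show "(norm ((T' ^^ Suc k) x))\<^sup>2 \<le> (norm ((T' ^^ k) x))\<^sup>2 - - \<epsilon> x" for k
        using dec[of "Suc k"] by (simp add: \<epsilon>_def inverse)
    qed (use neg in auto)
  qed
  then have "(norm (T x))\<^sup>2 \<le> (norm x)\<^sup>2" by (simp add: \<epsilon>_def)
  then show "norm (T x) \<le> norm x" by (rule power2_le_imp_le) simp
qed

section \<open>Isometric embeddings into \<open>H\<^sup>2\<^sub>r(\<bbbB>, E) \<oplus> K\<close>\<close>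

lemma H2r_diff:
  assumes r: "0 < r" "r < 1" and f: "f \<in> H2r r UNIV" and g: "g \<in> H2r r UNIV"
  shows "f - g \<in> H2r r UNIV"
    and "(H2r_norm r (f - g))\<^sup>2 \<le> 2 * (H2r_norm r f)\<^sup>2 + 2 * (H2r_norm r g)\<^sup>2"
proof -
  obtain c P Q d P' Q' where c: "H2r_rep r f c P Q" and d: "H2r_rep r g d P' Q'"
    using f g unfolding H2r_iff_rep by blast
  obtain P'' Q'' where e: "H2r_rep r (f - g) (\<lambda>n. c n - d n) P'' Q''"
    and le: "P'' + Q'' \<le> 2 * (P + Q) + 2 * (P' + Q')"
    using H2r_rep_diff[OF r(1) c d] by blast
  show "f - g \<in> H2r r UNIV" using e unfolding H2r_iff_rep by blast
  have "0 < 1 - r\<^sup>2" using r by (simp add: power2_less_1_iff)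
  then have "(P'' + Q'') / (1 - r\<^sup>2) \<le> (2 * (P + Q) + 2 * (P' + Q')) / (1 - r\<^sup>2)"
    using le by (intro divide_right_mono) auto
  then show "(H2r_norm r (f - g))\<^sup>2 \<le> 2 * (H2r_norm r f)\<^sup>2 + 2 * (H2r_norm r g)\<^sup>2"
    unfolding H2r_norm_eq[OF r c] H2r_norm_eq[OF r d] H2r_norm_eq[OF r e] by (simp add: add_divide_distrib)
qed

lemma H2r_norm_zero:
  assumes r: "0 < r" "r < 1" and f: "f \<in> H2r r UNIV" and z: "H2r_norm r f = 0"
  shows "f = 0"
proof -
  obtain c P Q where c: "H2r_rep r f c P Q" using f unfolding H2r_iff_rep by blast
  have "0 < 1 - r\<^sup>2" using r by (simp add: power2_less_1_iff)
  then have "P + Q = 0" using H2r_norm_eq[OF r c] z by simp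
  then show ?thesis using H2r_rep_zero[OF r(1) c] H2r_rep_nonneg[OF c] by simp
qed

lemma H2r_sum_norm_diff:
  fixes p q :: "(complex \<Rightarrow> 'e::chilbert_space) \<times> 's::chilbert_space"
  assumes r: "0 < r" "r < 1" and "fst p \<in> H2r r UNIV" "fst q \<in> H2r r UNIV"
  shows "(H2r_sum_norm r (p - q))\<^sup>2 \<le> 2 * (H2r_sum_norm r p)\<^sup>2 + 2 * (H2r_sum_norm r q)\<^sup>2"
proof -
  have "(norm (x - y))\<^sup>2 + (norm (x + y))\<^sup>2 = 2 * (norm x)\<^sup>2 + 2 * (norm y)\<^sup>2" for x y :: 's
    by (simp add: power2_norm_eq_inner inner_add inner_diff inner_commute)
  then have "(norm (snd p - snd q))\<^sup>2 \<le> 2 * (norm (snd p))\<^sup>2 + 2 * (norm (snd q))\<^sup>2"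
    by (smt (verit) zero_le_power2)
  then show ?thesis using H2r_diff(2)[OF assms] unfolding H2r_sum_norm_sq by simp
qed

text \<open>
  The usual argument that complete subspaces are closed, for the norm of the model space, which is
  not a type class norm.
\<close>

lemma closed_range_isometry:
  fixes U :: "'a::chilbert_space \<Rightarrow> (complex \<Rightarrow> 'e::chilbert_space) \<times> 's::chilbert_space"
  assumes r: "0 < r" "r < 1" and range: "\<And>x. fst (U x) \<in> H2r r UNIV"
    and diff: "\<And>x y. U (x - y) = U x - U y" and iso: "\<And>x. H2r_sum_norm r (U x) = norm x"
  shows "closed_in_norm (H2r_sum_norm r) (H2r r E \<times> K) (range U)"
  unfolding closed_in_norm_def
proof (intro allI ballI impI)
  fix s p
  assume p: "p \<in> H2r r E \<times> K" and "(\<forall>n. s n \<in> range U) \<and> (\<lambda>n. H2r_sum_norm r (s n - p)) \<longlonglongrightarrow> 0"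
  then have s: "\<And>n. s n \<in> range U" and lim: "(\<lambda>n. H2r_sum_norm r (s n - p)) \<longlonglongrightarrow> 0" by auto
  from s obtain h where h: "\<And>n. s n = U (h n)" unfolding image_iff by metis
  define \<eta> where "\<eta> n = (H2r_sum_norm r (U (h n) - p))\<^sup>2" for n
  have \<eta>: "\<eta> \<longlonglongrightarrow> 0" using tendsto_power[OF lim, of 2] unfolding h \<eta>_def[abs_def] by simp
  have pU: "fst p \<in> H2r r UNIV" using p unfolding H2r_iff_rep by (cases p) (auto simp: H2r_iff_rep)
  have mem: "fst (U x - p) \<in> H2r r UNIV" for x using H2r_diff(1)[OF r range pU] by simp
  have dist: "(norm (h m - h n))\<^sup>2 \<le> 2 * \<eta> m + 2 * \<eta> n" for m n
  proof -
    have "(norm (h m - h n))\<^sup>2 = (H2r_sum_norm r ((U (h m) - p) - (U (h n) - p)))\<^sup>2"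
      by (simp flip: iso diff)
    also have "\<dots> \<le> 2 * \<eta> m + 2 * \<eta> n" unfolding \<eta>_def by (rule H2r_sum_norm_diff[OF r mem mem])
    finally show ?thesis .
  qed
  have "Cauchy h"
  proof (rule metric_CauchyI)
    fix e :: real assume e: "0 < e"
    then have "0 < e\<^sup>2 / 4" by simp
    then obtain M where M: "\<And>n. n \<ge> M \<Longrightarrow> \<bar>\<eta> n\<bar> < e\<^sup>2 / 4"
      using \<eta> unfolding LIMSEQ_iff by (metis diff_zero real_norm_def)
    have "dist (h m) (h n) < e" if "m \<ge> M" "n \<ge> M" for m n
    proof -
      have "(norm (h m - h n))\<^sup>2 < e\<^sup>2" using dist[of m n] M[OF that(1)] M[OF that(2)] by linarith
      then show ?thesis using e by (simp add: dist_norm power2_less_imp_less)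
    qed
    then show "\<exists>M. \<forall>m\<ge>M. \<forall>n\<ge>M. dist (h m) (h n) < e" by blast
  qed
  then obtain x where x: "h \<longlonglongrightarrow> x" using Cauchy_convergent convergent_def by blast
  have "(H2r_sum_norm r (U x - p))\<^sup>2 \<le> 2 * \<eta> n + 2 * (norm (h n - x))\<^sup>2" for n
  proof -
    have "U x - p = (U (h n) - p) - U (h n - x)" by (simp add: diff)
    then have "(H2r_sum_norm r (U x - p))\<^sup>2 \<le> 2 * \<eta> n + 2 * (H2r_sum_norm r (U (h n - x)))\<^sup>2"
      unfolding \<eta>_def using H2r_sum_norm_diff[OF r mem range] by metis
    then show ?thesis by (simp add: iso)
  qed
  moreover have "(\<lambda>n. 2 * \<eta> n + 2 * (norm (h n - x))\<^sup>2) \<longlonglongrightarrow> 2 * 0 + 2 * (norm (x - x))\<^sup>2"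
    by (intro tendsto_intros \<eta> x)
  ultimately have "(H2r_sum_norm r (U x - p))\<^sup>2 \<le> 0"
    using LIMSEQ_le_const[of _ "2 * 0 + 2 * (norm (x - x))\<^sup>2"] by fastforce
  then have "(H2r_norm r (fst (U x - p)))\<^sup>2 = 0" "(norm (snd (U x - p)))\<^sup>2 = 0"
    unfolding H2r_sum_norm_sq using zero_le_power2[of "H2r_norm r (fst (U x - p))"]
      zero_le_power2[of "norm (snd (U x - p))"] by linarith+
  then have "fst (U x - p) = 0" "snd (U x - p) = 0" using H2r_norm_zero[OF r mem] by auto
  then have "p = U x" by (simp add: prod_eq_iff)
  then show "p \<in> range U" by blast
qed

section \<open>The model of an operator with \<open>\<alpha>(T\<^sup>*, T) \<ge> 0\<close>\<close>

text \<open>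
  The embedding is \<open>x \<mapsto> (W x, Q\<^sub>1 x, Q\<^sub>2 x)\<close>, where \<open>W x\<close> has the coefficients \<open>D T\<^sup>-\<^sup>n\<^sup>-\<^sup>1 x\<close> for \<open>n \<ge> 0\<close> and
  \<open>- D T\<^sup>-\<^sup>n\<^sup>-\<^sup>1 x\<close> for \<open>n < 0\<close>; the sign accounts for the sign change in \<open>mzt_coeffs\<close>. It is isometric
  because the two sums in the norm of \<open>W x\<close> telescope, their limits being the norms of \<open>Q\<^sub>1 x\<close> and
  \<open>Q\<^sub>2 x\<close>.
\<close>

lemma positive_imp_part_of_model:
  fixes T :: "'a::chilbert_space \<Rightarrow> 'a"
  assumes r: "0 < r" "r < 1" and T: "bounded_op_on UNIV T" and inv: "invertible_op_on UNIV T"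
    and pos: "positive_op (alpha_op r T)"
  shows "part_of_model r T (defect_space r T) TYPE('a \<times> 'a)"
proof -
  obtain T' where T': "bounded_op_on UNIV T'" and TT': "\<And>x. T (T' x) = x" and T'T: "\<And>x. T' (T x) = x"
    using inv unfolding invertible_op_on_def by blast
  have r2: "0 < r\<^sup>2" "0 < 1 - r\<^sup>2" using r by (auto simp: power2_less_1_iff)
  have form: "(norm (T (T x)))\<^sup>2 - (1 + r\<^sup>2) * (norm (T x))\<^sup>2 + r\<^sup>2 * (norm x)\<^sup>2 \<le> 0" for x
    using pos unfolding positive_alpha_op_iff[OF T] by blast
  note bounds = alpha_nonneg_bounds[OF r TT' form]
  define D where "D = defect_op r T"
  have D: "bounded_op_on UNIV D"
    using sqrt_op_works(1)[OF pos] by (simp add: D_def defect_op_def positive_op_def)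
  have normD: "(norm (D x))\<^sup>2 = - (norm (T (T x)))\<^sup>2 + (1 + r\<^sup>2) * (norm (T x))\<^sup>2 - r\<^sup>2 * (norm x)\<^sup>2" for x
    unfolding D_def defect_op_def norm_sqrt_op[OF pos] alpha_op_inner[OF T] by (simp add: power2_norm_eq_inner)
  note bT = bounded_op_funpow[OF T] and bT' = bounded_op_funpow[OF T']
  have pow_T: "(T ^^ n) (T x) = (T ^^ Suc n) x" for n x by (simp add: funpow_swap1)
  have pow_T': "(T' ^^ Suc n) (T x) = (T' ^^ n) x" for n x by (simp only: funpow_Suc_right comp_apply T'T)

  \<comment> \<open>The limits of the norms along both ends of the orbit give the normal summand.\<close>
  obtain Q1 where Q1: "bounded_op_on UNIV Q1" "\<And>x. (\<lambda>n. (norm ((T ^^ n) x))\<^sup>2) \<longlonglongrightarrow> (norm (Q1 x))\<^sup>2"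
    using decreasing_limit_operator[of "\<lambda>n. T ^^ n"] bT bounds(2) by auto
  have "norm (r ^ Suc n *\<^sub>R (T' ^^ Suc n) x) \<le> norm (r ^ n *\<^sub>R (T' ^^ n) x)" for n x
    using mult_left_mono[OF bounds(1)[of "(T' ^^ Suc n) x"], of "r ^ n"] r by (simp add: TT' mult_ac)
  then obtain Q2 where Q2: "bounded_op_on UNIV Q2"
    "\<And>x. (\<lambda>n. (norm (r ^ n *\<^sub>R (T' ^^ n) x))\<^sup>2) \<longlonglongrightarrow> (norm (Q2 x))\<^sup>2"
    using decreasing_limit_operator[of "\<lambda>n x. r ^ n *\<^sub>R (T' ^^ n) x", OF bounded_op_scaleR[OF bT']] by blast
  have Q1T: "norm (Q1 (T x)) = 1 * norm (Q1 x)" for x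
  proof -
    have "(\<lambda>n. (norm ((T ^^ n) (T x)))\<^sup>2) \<longlonglongrightarrow> (norm (Q1 x))\<^sup>2"
      unfolding pow_T using LIMSEQ_Suc[OF Q1(2)] .
    then have "(norm (Q1 (T x)))\<^sup>2 = (norm (Q1 x))\<^sup>2" using Q1(2) LIMSEQ_unique by blast
    then show ?thesis by (simp add: power2_eq_iff_nonneg)
  qed
  have Q2T: "norm (Q2 (T x)) = r * norm (Q2 x)" for x
  proof -
    have "(norm (r ^ Suc n *\<^sub>R (T' ^^ Suc n) (T x)))\<^sup>2 = r\<^sup>2 * (norm (r ^ n *\<^sub>R (T' ^^ n) x))\<^sup>2" for n
      unfolding pow_T' by (simp add: power_mult_distrib)
    then have "(\<lambda>n. r\<^sup>2 * (norm (r ^ n *\<^sub>R (T' ^^ n) x))\<^sup>2) \<longlonglongrightarrow> (norm (Q2 (T x)))\<^sup>2"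
      using LIMSEQ_Suc[OF Q2(2)[of "T x"]] by simp
    moreover have "(\<lambda>n. r\<^sup>2 * (norm (r ^ n *\<^sub>R (T' ^^ n) x))\<^sup>2) \<longlonglongrightarrow> r\<^sup>2 * (norm (Q2 x))\<^sup>2"
      by (intro tendsto_mult tendsto_const Q2(2))
    ultimately have "(norm (Q2 (T x)))\<^sup>2 = (r * norm (Q2 x))\<^sup>2"
      using LIMSEQ_unique by (simp add: power_mult_distrib) blast
    then show ?thesis using r by (simp add: power2_eq_iff_nonneg)
  qed
  obtain V1 where V1: "scaled_unitary_on (closure (range Q1)) 1 V1" "\<And>x. V1 (Q1 x) = Q1 (T x)"
    using scaled_unitary_from_intertwiner[OF Q1(1) T T' TT' T'T Q1T] by auto
  obtain V2 where V2: "scaled_unitary_on (closure (range Q2)) r V2" "\<And>x. V2 (Q2 x) = Q2 (T x)"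
    using scaled_unitary_from_intertwiner[OF Q2(1) T T' TT' T'T Q2T r(1)] by auto
  let ?K = "closure (range Q1) \<times> closure (range Q2)" and ?S = "map_prod V1 V2"

  \<comment> \<open>The defect along the orbit gives the summand in \<open>H\<^sup>2\<^sub>r\<close>; both sums telescope.\<close>
  define c where "c x n = (if 0 \<le> n then D ((T' ^^ Suc (nat n)) x) else - D ((T ^^ nat (- 1 - n)) x))" for x n
  define P where "P x = (norm x)\<^sup>2 - (norm (T x))\<^sup>2 - (1 - r\<^sup>2) * (norm (Q2 x))\<^sup>2" for x
  define Q where "Q x = (norm (T x))\<^sup>2 - r\<^sup>2 * (norm x)\<^sup>2 - (1 - r\<^sup>2) * (norm (Q1 x))\<^sup>2" for x
  have sumQ: "((\<lambda>n. (norm (c x n))\<^sup>2) has_sum Q x) {..-1}" for x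
  proof -
    define b where "b k = (norm ((T ^^ Suc k) x))\<^sup>2 - r\<^sup>2 * (norm ((T ^^ k) x))\<^sup>2" for k
    have "b \<longlonglongrightarrow> (norm (Q1 x))\<^sup>2 - r\<^sup>2 * (norm (Q1 x))\<^sup>2"
      unfolding b_def[abs_def] by (intro tendsto_intros Q1(2) LIMSEQ_Suc[OF Q1(2)])
    from telescope_sums'[OF this] have "(\<lambda>k. b k - b (Suc k)) sums Q x"
      by (simp add: b_def Q_def algebra_simps)
    moreover have "b k - b (Suc k) = (norm (c x (- 1 - int k)))\<^sup>2" for k
      by (simp add: b_def c_def normD algebra_simps)
    ultimately have "(\<lambda>k. (norm (c x (- 1 - int k)))\<^sup>2) sums Q x" by simp
    then show ?thesis unfolding has_sum_neg_ints_iff by (rule sums_nonneg_imp_has_sum) simp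
  qed
  have sumP: "((\<lambda>n. r powi (2 * n) * (norm (c x n))\<^sup>2) has_sum P x) {0..}" for x
  proof -
    define a where "a k = (norm (r ^ k *\<^sub>R (T' ^^ k) x))\<^sup>2" for k
    define e where "e k = (r ^ k)\<^sup>2 * ((norm ((T' ^^ k) x))\<^sup>2 - (norm (T ((T' ^^ k) x)))\<^sup>2)" for k
    have a: "a \<longlonglongrightarrow> (norm (Q2 x))\<^sup>2" unfolding a_def[abs_def] by (rule Q2(2))
    have "e (Suc k) = a (Suc k) - r\<^sup>2 * a k" for k
      by (simp add: e_def a_def TT' power_mult_distrib algebra_simps)
    then have "(\<lambda>k. e (Suc k)) \<longlonglongrightarrow> (norm (Q2 x))\<^sup>2 - r\<^sup>2 * (norm (Q2 x))\<^sup>2"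
      by (simp only:) (intro tendsto_intros a LIMSEQ_Suc[OF a])
    then have "e \<longlonglongrightarrow> (norm (Q2 x))\<^sup>2 - r\<^sup>2 * (norm (Q2 x))\<^sup>2" by (rule LIMSEQ_imp_Suc)
    from telescope_sums'[OF this] have "(\<lambda>k. e k - e (Suc k)) sums P x"
      by (simp add: e_def P_def algebra_simps)
    moreover have "e k - e (Suc k) = r powi (2 * int k) * (norm (c x (int k)))\<^sup>2" for k
    proof -
      have "r powi (2 * int k) = (r ^ k)\<^sup>2"
        using power_int_of_nat[of r "2 * k"] by (simp add: power_mult mult.commute flip: power_mult)
      then show ?thesis by (simp add: e_def c_def normD TT' power_mult_distrib algebra_simps)
    qed
    ultimately have "(\<lambda>k. r powi (2 * int k) * (norm (c x (int k)))\<^sup>2) sums P x" by simp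
    then show ?thesis unfolding has_sum_nonneg_ints_iff
      by (rule sums_nonneg_imp_has_sum) (use r in simp)
  qed
  obtain W where W: "\<And>x. H2r_rep r (W x) (c x) (P x) (Q x)"
    using H2r_synthesis[OF r sumP sumQ] by metis
  have W_lau: "laurent_rep r (W x) (c x)" for x using W by (simp add: H2r_rep_def)
  have W_add: "W (x + y) = W x + W y" for x y
  proof (rule laurent_rep_fun_unique[OF W_lau])
    have "c (x + y) = (\<lambda>n. c x n + c y n)"
      by (auto simp: c_def fun_eq_iff bounded_op_onD(2)[OF D] bounded_op_onD(2)[OF bT] bounded_op_onD(2)[OF T']
          bounded_op_onD(2)[OF bT'])
    then show "laurent_rep r (W x + W y) (c (x + y))" using laurent_rep_add[OF W_lau W_lau] by simp
  qed
  have W_scale: "W (a *\<^sub>C x) = a *\<^sub>C W x" for a x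
  proof (rule laurent_rep_fun_unique[OF W_lau])
    have "c (a *\<^sub>C x) = (\<lambda>n. a *\<^sub>C c x n)"
      by (auto simp: c_def fun_eq_iff bounded_op_onD(3)[OF D] bounded_op_onD(3)[OF bT] bounded_op_onD(3)[OF T']
          bounded_op_onD(3)[OF bT'] scaleC_minus_right)
    then show "laurent_rep r (a *\<^sub>C W x) (c (a *\<^sub>C x))" using laurent_rep_scaleC[OF W_lau] by simp
  qed
  have W_T: "W (T x) = Mzt r (W x)" for x
  proof (rule laurent_rep_fun_unique[OF W_lau])
    have "mzt_coeffs (c x) n = c (T x) n" for n
    proof -
      consider "n = 0" | m where "n = int (Suc m)" | m where "n = - 1 - int m"
      proof -
        have "n = 0 \<or> n = int (Suc (nat (n - 1))) \<or> n = - 1 - int (nat (- 1 - n))" by linarith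
        then show thesis using that by blast
      qed
      then show ?thesis
      proof cases
        case 1
        then show ?thesis by (simp add: mzt_coeffs_def c_def T'T)
      next
        case (2 m)
        have "nat n = Suc m" "nat (n - 1) = m" "n > 0" using 2 by auto
        then show ?thesis using pow_T'[of "Suc m" x] by (simp add: mzt_coeffs_def c_def)
      next
        case (3 m)
        have "nat (- 1 - n) = m" "nat (- 1 - (n - 1)) = Suc m" "n < 0" using 3 by auto
        then show ?thesis by (simp add: mzt_coeffs_def c_def pow_T)
      qed
    qed
    then have "c (T x) = mzt_coeffs (c x)" by auto
    then show "laurent_rep r (Mzt r (W x)) (c (T x))"
      using H2r_rep_Mzt[OF r W, of x] by (simp add: H2r_rep_def)
  qed
  define U where "U x = (W x, (Q1 x, Q2 x))" for x
  have U_add: "U (x + y) = U x + U y" for x y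
    by (simp add: U_def W_add bounded_op_onD(2)[OF Q1(1)] bounded_op_onD(2)[OF Q2(1)])
  have U_scale: "U (a *\<^sub>C x) = a *\<^sub>C U x" for a x
    by (simp add: U_def W_scale bounded_op_onD(3)[OF Q1(1)] bounded_op_onD(3)[OF Q2(1)] scaleC_prod_def)
  have U_diff: "U (x - y) = U x - U y" for x y using U_add[of "x - y" y] by simp
  have U_T: "U (T x) = map_prod (Mzt r) ?S (U x)" for x
    by (simp add: U_def W_T V1(2) V2(2))
  have iso: "H2r_sum_norm r (U x) = norm x" for x
  proof -
    have "(H2r_sum_norm r (U x))\<^sup>2 = (P x + Q x) / (1 - r\<^sup>2) + ((norm (Q1 x))\<^sup>2 + (norm (Q2 x))\<^sup>2)"
      unfolding H2r_sum_norm_sq by (simp add: U_def H2r_norm_eq[OF r W] norm_prod_def)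
    also have "P x + Q x = (1 - r\<^sup>2) * ((norm x)\<^sup>2 - (norm (Q1 x))\<^sup>2 - (norm (Q2 x))\<^sup>2)"
      by (simp add: P_def Q_def algebra_simps)
    finally have "(H2r_sum_norm r (U x))\<^sup>2 = (norm x)\<^sup>2" using r2 by simp
    then show ?thesis by (simp add: power2_eq_iff_nonneg H2r_sum_norm_def)
  qed
  have W_mem: "W x \<in> H2r r (defect_space r T)" for x
  proof -
    have Dmem: "D y \<in> defect_space r T" for y
      unfolding defect_space_def D_def by (rule closure_subset[THEN subsetD]) (rule rangeI)
    have "- D y \<in> defect_space r T" for y
      using Dmem[of "- y"] bounded_op_on_diff[OF closed_csubspace_UNIV D, of 0 y]
        bounded_op_on_zero[OF closed_csubspace_UNIV D] by simp
    then have "range (c x) \<subseteq> defect_space r T" using Dmem by (auto simp: c_def)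
    then show ?thesis using W unfolding H2r_iff_rep by blast
  qed
  have W_UNIV: "fst (U x) \<in> H2r r UNIV" for x
    using W unfolding U_def H2r_iff_rep by auto
  have "closed_invariant_subspace (H2r_sum_norm r) (H2r r (defect_space r T) \<times> ?K)
      (map_prod (Mzt r) ?S) (range U)"
    unfolding closed_invariant_subspace_def
  proof (intro conjI)
    show "range U \<subseteq> H2r r (defect_space r T) \<times> ?K"
      using W_mem closure_subset[of "range Q1"] closure_subset[of "range Q2"] by (auto simp: U_def)
    have "U 0 = 0" using U_diff[of 0 0] by simp
    then show "complex_vector.subspace (range U)"
      unfolding complex_vector.subspace_def
      by (auto simp flip: U_add U_scale)
    show "closed_in_norm (H2r_sum_norm r) (H2r r (defect_space r T) \<times> ?K) (range U)"
      by (rule closed_range_isometry[OF r W_UNIV U_diff iso])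
    show "map_prod (Mzt r) ?S ` range U \<subseteq> range U"
    proof (rule image_subsetI)
      fix p assume "p \<in> range U"
      then obtain x where "p = U x" by blast
      then show "map_prod (Mzt r) ?S p \<in> range U" by (simp flip: U_T)
    qed
  qed
  moreover have "unitarily_equivalent norm UNIV T (H2r_sum_norm r) (range U) (map_prod (Mzt r) ?S)"
    unfolding unitarily_equivalent_def clinear_on_def
    by (rule exI[of _ U]) (simp add: U_add U_scale iso U_T)
  moreover have "spectrum_on ?K ?S \<subseteq> {z. cmod z = r} \<union> {z. cmod z = 1}"
    using scaled_unitary_sum(2)[OF V1(1) V2(1)] by blast
  moreover have "closed_csubspace (defect_space r T)"
    unfolding defect_space_def using closed_csubspace_closure_range[OF D] by (simp add: D_def)
  ultimately show ?thesis
    unfolding part_of_model_def using scaled_unitary_sum(1)[OF V1(1) V2(1)] by blast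
qed

theorem theorem1p2:
  fixes r :: real and T :: "'a::chilbert_space \<Rightarrow> 'a"
  assumes "0 < r" and "r < 1"
    and "bounded_op_on UNIV T" and "invertible_op_on UNIV T"
  shows "(positive_op (alpha_op r T) \<longleftrightarrow> has_model r T TYPE('a) TYPE('a \<times> 'a)) \<and>
         (has_model r T TYPE('e::chilbert_space) TYPE('s::chilbert_space)
            \<longrightarrow> positive_op (alpha_op r T)) \<and>
         (positive_op (alpha_op r T)
            \<longrightarrow> part_of_model r T (defect_space r T) TYPE('a \<times> 'a))"
proof -
  have "part_of_model r T (defect_space r T) TYPE('a \<times> 'a)" if "positive_op (alpha_op r T)"
    by (rule positive_imp_part_of_model[OF assms that])
  moreover have "positive_op (alpha_op r T)" if "has_model r T TYPE('a) TYPE('a \<times> 'a)"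
    using that part_of_model_imp_positive[OF assms(1-3)] unfolding has_model_def by blast
  moreover have "positive_op (alpha_op r T)" if "has_model r T TYPE('e) TYPE('s)"
    using that part_of_model_imp_positive[OF assms(1-3)] unfolding has_model_def by blast
  ultimately show ?thesis unfolding has_model_def by blast
qed

end
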